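(* Let $M/F$ be a field extension of degree $n$ such that $G=\mathrm{Aut}_F(M)$ is non-trivial and solvable, and let $A$ be a central simple algebra of degree $n$ over $F$ with maximal subfield $M$. Fix a chain of subgroups $\{1\}=G_0\le G_1\le\dots\le G_k=G$ such that, for all $j\in\{0,\dots,k-1\}$, $G_j$ is normal in $G_{j+1}$ and $G_{j+1}/G_j$ is cyclic of prime order $q_j$, generated by the coset of $\sigma_{j+1}\in G_{j+1}$. Then there exists a chain of subalgebras $$M=A_0\subset A_1\subset\dots\subset A_k=M(G)\subset A$$ of $A$ such that each $A_i$ is a $G_i$-crossed product algebra over $Z_i=\mathrm{Fix}(G_i)$, and $$A_{i+1}\cong A_i[t_i;\tau_i]/A_i[t_i;\tau_i](t_i^{q_i}-c_i)$$ for all $i\in\{0,\dots,k-1\}$, where (i) $q_i$ is the prime order of the factor group $G_{i+1}/G_i$; (ii) $\tau_i$ is an $F$-automorphism of $A_i$ of inner order $q_i$ which restricts on $M$ to the automorphism $\sigma_{i+1}\in G_{i+1}$ generating $G_{i+1}/G_i$; and (iii) $c_i\in\mathrm{Fix}(\tau_i)$ is invertible.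
   Context: All algebras are unital, associative and finite-dimensional. A central simple algebra $A$ over $F$ has degree $n$ if $\dim_F A=n^2$; a maximal subfield of $A$ is a subfield $M\supseteq F$ of $A$ with $[M:F]=n$. For a group $H$ of automorphisms of $M$, $\mathrm{Fix}(H)$ is its fixed field in $M$; for an automorphism $\tau$ of a ring $S$, $\mathrm{Fix}(\tau)=\{s\in S:\tau(s)=s\}$. A central simple algebra over a field $Z$ is an $H$-crossed product algebra over $Z$ if it contains a maximal subfield that is Galois over $Z$ with Galois group $H$. $M(G)$: by Skolem–Noether, for each $\sigma\in G$ there is an invertible $x_\sigma\in A$ with $x_\sigma m x_\sigma^{-1}=\sigma(m)$ for all $m\in M$, unique up to left multiplication by $M^\times$; $M(G)$ is the left $M$-span of $\{x_\sigma:\sigma\in G\}$ in $A$. For a ring $S$ and an automorphism $\tau$ of $S$, $S[t;\tau]$ is the twisted polynomial ring with $ta=\tau(a)t$ for $a\in S$. For monic $f\in S[t;\tau]$ of degree $m$, $S[t;\tau]/S[t;\tau]f$ denotes the set of twisted polynomials of degree $<m$ with multiplication $g\circ h=$ remainder of $gh$ under right division by $f$; when $S[t;\tau]f$ is a two-sided ideal this is the usual quotient ring. The inner order of an automorphism $\tau$ of $S$ is the smallest positive integer $m$ such that $\tau^m$ is an inner automorphism $z\mapsto uzu^{-1}$ of $S$. *)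

theory Defs
  imports
    "HOL-Algebra.Embedded_Algebras"
    "HOL-Algebra.Solvable_Groups"
    "HOL-Algebra.Elementary_Groups"
    "HOL-Algebra.Bij"
    "HOL-Algebra.UnivPoly"
    "HOL-Computational_Algebra.Primes"
begin

text \<open>
  All algebras are rings containing their base field as a subset; a subalgebra with underlying
  set \<open>B\<close> is the ring \<open>A\<lparr>carrier := B\<rparr>\<close>.
\<close>

subsection \<open>Central simple algebras and crossed products\<close>

definition ring_center :: "('a, 'b) ring_scheme \<Rightarrow> 'a set"
  where "ring_center R = {z \<in> carrier R. \<forall>a \<in> carrier R. z \<otimes>\<^bsub>R\<^esub> a = a \<otimes>\<^bsub>R\<^esub> z}"

definition simple_ring :: "('a, 'b) ring_scheme \<Rightarrow> bool"
  where "simple_ring R \<longleftrightarrow> ring R \<and> carrier R \<noteq> {\<zero>\<^bsub>R\<^esub>} \<and>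
    (\<forall>I. ideal I R \<longrightarrow> I = {\<zero>\<^bsub>R\<^esub>} \<or> I = carrier R)"

definition central_simple :: "('a, 'b) ring_scheme \<Rightarrow> 'a set \<Rightarrow> nat \<Rightarrow> bool"
  \<comment> \<open>central simple of degree \<open>n\<close> over \<open>Z\<close>\<close>
  where "central_simple R Z n \<longleftrightarrow> simple_ring R \<and> subfield Z R \<and> ring_center R = Z \<and>
    ring.dimension R (n ^ 2) Z (carrier R)"

definition maximal_subfield :: "('a, 'b) ring_scheme \<Rightarrow> 'a set \<Rightarrow> nat \<Rightarrow> 'a set \<Rightarrow> bool"
  where "maximal_subfield R Z n L \<longleftrightarrow> subfield L R \<and> Z \<subseteq> L \<and> ring.dimension R n Z L"

text \<open>Automorphisms of \<open>L\<close> are extensional functions on \<open>L\<close>, as in \<^const>\<open>BijGroup\<close>.\<close>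

definition aut_group :: "('a, 'b) ring_scheme \<Rightarrow> 'a set \<Rightarrow> 'a set \<Rightarrow> ('a \<Rightarrow> 'a) monoid"
  where "aut_group R Z L = (BijGroup L)\<lparr>carrier :=
    {h \<in> Bij L. h \<in> ring_iso (R\<lparr>carrier := L\<rparr>) (R\<lparr>carrier := L\<rparr>) \<and> (\<forall>z \<in> Z. h z = z)}\<rparr>"

definition fixed_set :: "'a set \<Rightarrow> ('a \<Rightarrow> 'a) set \<Rightarrow> 'a set"
  where "fixed_set L H = {x \<in> L. \<forall>h \<in> H. h x = x}"

text \<open>
  Galois in Artin's sense: the automorphisms of \<open>L\<close> over \<open>Z\<close> fix no more than \<open>Z\<close>. Only used for
  subfields \<open>L\<close> of finite degree over \<open>Z\<close>; finiteness is part of \<^const>\<open>maximal_subfield\<close>.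
\<close>

definition galois_ext :: "('a, 'b) ring_scheme \<Rightarrow> 'a set \<Rightarrow> 'a set \<Rightarrow> bool"
  where "galois_ext R Z L \<longleftrightarrow> fixed_set L (carrier (aut_group R Z L)) = Z"

definition crossed_product :: "('a, 'b) ring_scheme \<Rightarrow> 'a set \<Rightarrow> ('c, 'd) monoid_scheme \<Rightarrow> bool"
  where "crossed_product R Z H \<longleftrightarrow> (\<exists>d. central_simple R Z d \<and>
    (\<exists>L. maximal_subfield R Z d L \<and> galois_ext R Z L \<and> aut_group R Z L \<cong> H))"

subsection \<open>The span of the Skolem--Noether elements\<close>

definition sn_elt :: "('a, 'b) ring_scheme \<Rightarrow> 'a set \<Rightarrow> ('a \<Rightarrow> 'a) \<Rightarrow> 'a"
  where "sn_elt A M s = (SOME x. x \<in> Units A \<and> (\<forall>m \<in> M. x \<otimes>\<^bsub>A\<^esub> m \<otimes>\<^bsub>A\<^esub> inv\<^bsub>A\<^esub> x = s m))"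

text \<open>
  Replacing the chosen elements by other ones multiplies them by units of \<open>M\<close> from the left, so
  the following left \<open>M\<close>-span does not depend on the choice made in \<^const>\<open>sn_elt\<close>.
\<close>

definition sn_span :: "('a, 'b) ring_scheme \<Rightarrow> 'a set \<Rightarrow> ('a \<Rightarrow> 'a) set \<Rightarrow> 'a set"
  where "sn_span A M H = {\<Oplus>\<^bsub>A\<^esub>s \<in> H. c s \<otimes>\<^bsub>A\<^esub> sn_elt A M s | c. c \<in> H \<rightarrow> M}"

subsection \<open>Automorphisms of rings\<close>

definition inner_aut :: "('a, 'b) ring_scheme \<Rightarrow> ('a \<Rightarrow> 'a) \<Rightarrow> bool"
  where "inner_aut S h \<longleftrightarrow>
    (\<exists>u \<in> Units S. \<forall>z \<in> carrier S. h z = u \<otimes>\<^bsub>S\<^esub> z \<otimes>\<^bsub>S\<^esub> inv\<^bsub>S\<^esub> u)"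

text \<open>A relation, because an automorphism need not have finite inner order.\<close>

definition has_inner_order :: "('a, 'b) ring_scheme \<Rightarrow> ('a \<Rightarrow> 'a) \<Rightarrow> nat \<Rightarrow> bool"
  where "has_inner_order S h m \<longleftrightarrow> 0 < m \<and> inner_aut S (h ^^ m) \<and>
    (\<forall>l. 0 < l \<and> l < m \<longrightarrow> \<not> inner_aut S (h ^^ l))"

subsection \<open>Twisted polynomials\<close>

text \<open>
  \<open>S[t;h]\<close> has the elements, addition and left \<open>S\<close>-module structure of \<^term>\<open>UP S\<close>, and
  \<open>(a t\<^sup>i) (b t\<^sup>j) = a h\<^sup>i(b) t\<^sup>i\<^sup>+\<^sup>j\<close>.
\<close>

definition twisted_poly :: "('a, 'b) ring_scheme \<Rightarrow> ('a \<Rightarrow> 'a) \<Rightarrow> ('a, nat \<Rightarrow> 'a) up_ring"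
  where "twisted_poly S h = (UP S)\<lparr>mult :=
    (\<lambda>p \<in> up S. \<lambda>q \<in> up S. \<lambda>n. \<Oplus>\<^bsub>S\<^esub>i \<in> {..n}. p i \<otimes>\<^bsub>S\<^esub> (h ^^ i) (q (n - i)))\<rparr>"

text \<open>
  The degree \<^const>\<open>deg\<close> of the zero polynomial is \<open>0\<close>; below the divisor \<open>f\<close> is monic of positive
  degree, so the zero polynomial is an admissible remainder.
\<close>

definition twisted_rem ::
  "('a, 'b) ring_scheme \<Rightarrow> ('a \<Rightarrow> 'a) \<Rightarrow> (nat \<Rightarrow> 'a) \<Rightarrow> (nat \<Rightarrow> 'a) \<Rightarrow> nat \<Rightarrow> 'a"
  where "twisted_rem S h f g = (let P = twisted_poly S h in
    (THE r. r \<in> carrier P \<and> deg S r < deg S f \<and> (\<exists>q \<in> carrier P. g = q \<otimes>\<^bsub>P\<^esub> f \<oplus>\<^bsub>P\<^esub> r)))"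

definition twisted_quot ::
  "('a, 'b) ring_scheme \<Rightarrow> ('a \<Rightarrow> 'a) \<Rightarrow> (nat \<Rightarrow> 'a) \<Rightarrow> ('a, nat \<Rightarrow> 'a) up_ring"
  where "twisted_quot S h f = (let P = twisted_poly S h in
    P\<lparr>carrier := {g \<in> carrier P. deg S g < deg S f},
      mult := (\<lambda>g g'. twisted_rem S h f (g \<otimes>\<^bsub>P\<^esub> g'))\<rparr>)"

text \<open>\<open>t\<^sup>m - c\<close>\<close>

definition twisted_binomial ::
  "('a, 'b) ring_scheme \<Rightarrow> ('a \<Rightarrow> 'a) \<Rightarrow> nat \<Rightarrow> 'a \<Rightarrow> nat \<Rightarrow> 'a"
  where "twisted_binomial S h m c = (let P = twisted_poly S h in
    (monom P \<one>\<^bsub>S\<^esub> 1) [^]\<^bsub>P\<^esub> m \<ominus>\<^bsub>P\<^esub> monom P c 0)"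

text \<open>
  \<open>F\<close> lies in \<open>S\<close> and acts on \<open>S[t;h]/S[t;h]f\<close> through the constant polynomials.
\<close>

definition twisted_quot_alg_iso ::
  "'a set \<Rightarrow> ('a, 'b) ring_scheme \<Rightarrow> ('a, 'b) ring_scheme \<Rightarrow> ('a \<Rightarrow> 'a) \<Rightarrow> (nat \<Rightarrow> 'a) \<Rightarrow> bool"
  \<comment> \<open>\<open>B\<close> and \<open>S[t;h]/S[t;h]f\<close> are isomorphic as \<open>F\<close>-algebras\<close>
  where "twisted_quot_alg_iso F B S h f \<longleftrightarrow>
    (\<exists>\<phi> \<in> ring_iso B (twisted_quot S h f). \<forall>a \<in> F. \<phi> a = monom (twisted_poly S h) a 0)"

end

theory Submission
  imports Defs
begin

text \<open>
  For \<open>H \<le> G\<close> let \<open>M(H)\<close> be the left \<open>M\<close>-span of the Skolem--Noether elements \<open>x\<^sub>s\<close> with \<open>s \<in> H\<close>, and take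
  \<open>A\<^sub>i = M(G\<^sub>i)\<close>. An \<open>M\<close>-\<open>M\<close>-subbimodule of \<open>A\<close> contains all components \<open>c\<^sub>s x\<^sub>s\<close> of each of its elements
  \<open>\<Oplus>s. c\<^sub>s x\<^sub>s\<close>. Applied to the zero bimodule, to ideals of \<open>M(H)\<close> and to the bimodule generated by
  \<open>\<Oplus>s. x\<^sub>s\<close>, this yields that the \<open>x\<^sub>s\<close> are independent over \<open>M\<close>, that \<open>M(H)\<close> is simple and, with Artin's
  trace argument, that \<open>[M : Fix(H)] = |H|\<close>. As \<open>M\<close> is its own centralizer in \<open>A\<close>, the center of \<open>M(H)\<close>
  is \<open>Fix(H)\<close>, so \<open>M(H)\<close> is an \<open>H\<close>-crossed product.

  In a step from \<open>K = G\<^sub>i\<close> to \<open>H = G\<^sub>i\<^sub>+\<^sub>1\<close> with \<open>s = \<sigma>\<^sub>i\<^sub>+\<^sub>1\<close>, conjugation by \<open>y = x\<^sub>s\<close> restricts to an automorphism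
  \<open>\<tau>\<close> of \<open>M(K)\<close>, and \<open>c = y\<^sup>q\<close> lies in \<open>M(K)\<close>. Since every element of \<open>H\<close> is uniquely \<open>k s\<^sup>j\<close> with
  \<open>k \<in> K\<close> and \<open>j < q\<close>, the powers \<open>y\<^sup>j\<close> with \<open>j < q\<close> form a left basis of \<open>M(H)\<close> over \<open>M(K)\<close>, and
  \<open>t \<mapsto> y\<close> induces the isomorphism. If \<open>\<tau>\<^sup>l\<close> were conjugation by \<open>u \<in> M(K)\<close>, then \<open>u\<close> would be a
  Skolem--Noether element for \<open>s\<^sup>l\<close>, which forces \<open>s\<^sup>l \<in> K\<close>.

  The Skolem--Noether theorem and the equality of \<open>M\<close> with its centralizer come from the operators
  \<open>x \<mapsto> \<Oplus>k. m\<^sub>k x e\<^sub>k\<close> with \<open>m\<^sub>k \<in> M\<close> and \<open>e\<^sub>k \<in> A\<close>, which exhaust the \<open>M\<close>-linear endomorphisms of \<open>A\<close>.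
\<close>

subsection \<open>Linear algebra with indexed families\<close>

text \<open>\<open>M\<close> need not be Galois over \<open>F\<close>: \<open>Fix(G)\<close> may be
  larger than \<open>F\<close> and \<open>M(G)\<close> smaller than \<open>A\<close>. So the degree
  \<open>[M : Fix(H)]\<close> cannot be read off from \<open>[M : F]\<close>, and it is computed
  inside \<open>A\<close> from the \<open>x\<^sub>s\<close>. Simplicity of \<open>A\<close>, and the
  fact that its center is no larger than \<open>F\<close>, enter through one statement: if
  \<open>\<Oplus>k. p\<^sub>k y e\<^sub>k\<close> vanishes for all \<open>y\<close> and the
  \<open>e\<^sub>k\<close> are independent over \<open>F\<close>, then all \<open>p\<^sub>k\<close>
  are zero. It makes the algebra of operators large enough, and it makes it meaningful to apply an
  automorphism of \<open>M\<close> to the left factors of an operator. The elements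
  \<open>x\<^sub>s\<close> are arbitrary choices. A product of two of them, or a power
  \<open>y\<^sup>j\<close>, agrees with the chosen element for the same automorphism only up to a
  factor in \<open>M\<close>. Independence and membership are therefore proved for all elements that
  induce the given automorphisms, and no cocycle is ever written down.\<close>

context ring begin

text \<open>Unlike the lists of \<^const>\<open>ring.Span\<close> and \<^const>\<open>ring.independent\<close>, families can be indexed by
  automorphisms.\<close>

definition fam_span :: "'a set \<Rightarrow> 'i set \<Rightarrow> ('i \<Rightarrow> 'a) \<Rightarrow> 'a set"
  where "fam_span K I v = {\<Oplus>i\<in>I. c i \<otimes> v i | c. c \<in> I \<rightarrow> K}"

definition fam_indep :: "'a set \<Rightarrow> 'i set \<Rightarrow> ('i \<Rightarrow> 'a) \<Rightarrow> bool"
  where "fam_indep K I v \<longleftrightarrow> (\<forall>c \<in> I \<rightarrow> K. (\<Oplus>i\<in>I. c i \<otimes> v i) = \<zero> \<longrightarrow> (\<forall>i\<in>I. c i = \<zero>))"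

section \<open>Finite sums in a ring\<close>

lemma finsum_swap:
  assumes "finite I" "finite J" and f: "\<And>i j. i \<in> I \<Longrightarrow> j \<in> J \<Longrightarrow> f i j \<in> carrier R"
  shows "(\<Oplus>i\<in>I. \<Oplus>j\<in>J. f i j) = (\<Oplus>j\<in>J. \<Oplus>i\<in>I. f i j)"
  using assms(1) f
proof (induction I)
  case (insert a I)
  then have "(\<Oplus>j\<in>J. \<Oplus>i\<in>insert a I. f i j) = (\<Oplus>j\<in>J. f a j \<oplus> (\<Oplus>i\<in>I. f i j))"
    by (intro finsum_cong') (auto simp: Pi_def finsum_insert)
  with insert show ?case by (simp add: Pi_def finsum_addf finsum_insert)
qed simp

lemma finsum_neg:
  assumes "f \<in> I \<rightarrow> carrier R"
  shows "(\<Oplus>i\<in>I. \<ominus> f i) = \<ominus> (\<Oplus>i\<in>I. f i)"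
proof -
  have "(\<Oplus>i\<in>I. \<ominus> f i) \<oplus> (\<Oplus>i\<in>I. f i) = (\<Oplus>i\<in>I. \<ominus> f i \<oplus> f i)"
    using assms by (intro finsum_addf [symmetric]) auto
  also have "\<dots> = (\<Oplus>i\<in>I. \<zero>)" using assms by (intro finsum_cong') (auto simp: l_neg Pi_iff)
  finally have "(\<Oplus>i\<in>I. \<ominus> f i) \<oplus> (\<Oplus>i\<in>I. f i) = \<zero>" by simp
  moreover have "(\<Oplus>i\<in>I. \<ominus> f i) \<in> carrier R" "(\<Oplus>i\<in>I. f i) \<in> carrier R"
    using assms by (auto intro!: finsum_closed simp: Pi_iff)
  ultimately show ?thesis by (metis minus_equality)
qed

lemma finsum_diff:
  assumes "f \<in> I \<rightarrow> carrier R" "g \<in> I \<rightarrow> carrier R"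
  shows "(\<Oplus>i\<in>I. f i \<ominus> g i) = (\<Oplus>i\<in>I. f i) \<ominus> (\<Oplus>i\<in>I. g i)"
proof -
  have "(\<Oplus>i\<in>I. f i \<ominus> g i) = (\<Oplus>i\<in>I. f i) \<oplus> (\<Oplus>i\<in>I. \<ominus> g i)"
    unfolding a_minus_def using assms by (intro finsum_addf) auto
  then show ?thesis using finsum_neg [OF assms(2)] by (simp add: a_minus_def)
qed

lemma finsum_delta:
  assumes "finite I" "j \<in> I" "f j \<in> carrier R"
  shows "(\<Oplus>i\<in>I. if i = j then f i else \<zero>) = f j"
proof -
  have "(\<Oplus>i\<in>I. if i = j then f i else \<zero>) = (\<Oplus>i\<in>{j}. f i)"
    using assms by (intro add.finprod_mono_neutral_cong_right) auto
  with assms show ?thesis by (simp add: finsum_insert)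
qed

text \<open>Only closure under addition is asked of \<open>E\<close>, so that it can be a subfield,
  a subring, a span or an auxiliary set. \<open>\<zero> \<in> E\<close> also covers infinite index
  sets, whose sum is \<open>\<zero>\<close> by convention.\<close>

lemma finsum_closed_in:
  assumes "\<zero> \<in> E" "\<And>x y. x \<in> E \<Longrightarrow> y \<in> E \<Longrightarrow> x \<oplus> y \<in> E" "E \<subseteq> carrier R" "f \<in> I \<rightarrow> E"
  shows "(\<Oplus>i\<in>I. f i) \<in> E"
  using assms(4)
proof (induction I rule: infinite_finite_induct)
  case (insert a I)
  then show ?case using assms by (subst finsum_insert) (auto simp: Pi_def)
qed (use assms in auto)

section \<open>Linear combinations, spans and independence of families\<close>

lemma combine_eq_finsum:
  assumes "length Ks = length Us" "set Ks \<subseteq> carrier R" "set Us \<subseteq> carrier R"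
  shows "combine Ks Us = (\<Oplus>i\<in>{..<length Us}. Ks ! i \<otimes> Us ! i)"
  using assms
proof (induction Ks Us rule: list_induct2)
  case (Cons k Ks u Us)
  let ?f = "\<lambda>i. (k # Ks) ! i \<otimes> (u # Us) ! i"
  have f: "?f \<in> {..<Suc (length Us)} \<rightarrow> carrier R"
    using Cons.prems Cons.hyps by (auto simp: nth_Cons' subset_iff)
  have "(\<Oplus>i\<in>{..<Suc (length Us)}. ?f i) = (\<Oplus>i\<in>insert 0 (Suc ` {..<length Us}). ?f i)"
    by (simp add: lessThan_Suc_eq_insert_0)
  also have "\<dots> = k \<otimes> u \<oplus> (\<Oplus>i\<in>Suc ` {..<length Us}. ?f i)"
    using f Cons.prems by (subst finsum_insert) (auto simp: lessThan_Suc_eq_insert_0)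
  also have "(\<Oplus>i\<in>Suc ` {..<length Us}. ?f i) = (\<Oplus>i\<in>{..<length Us}. ?f (Suc i))"
    using f by (intro finsum_reindex) (auto simp: lessThan_Suc_eq_insert_0)
  finally show ?case using Cons by simp
qed simp

text \<open>Coefficients are carried along the inverse of \<open>h\<close> on its image. This serves
  both for enumerating an index set by a list and for writing the members of a group as products of
  coset representatives.\<close>

lemma fam_reindex:
  assumes "inj_on h I" "v \<in> h ` I \<rightarrow> carrier R" "K \<subseteq> carrier R"
  shows "fam_span K (h ` I) v = fam_span K I (\<lambda>i. v (h i))"
    and "fam_indep K (h ` I) v \<longleftrightarrow> fam_indep K I (\<lambda>i. v (h i))"
proof -
  have re: "(\<Oplus>i\<in>h ` I. c i \<otimes> v i) = (\<Oplus>i\<in>I. c (h i) \<otimes> v (h i))" if "c \<in> h ` I \<rightarrow> K" for c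
    using that assms by (intro finsum_reindex) (auto simp: Pi_def)
  have lift: "\<exists>d \<in> h ` I \<rightarrow> K. (\<forall>i\<in>I. d (h i) = c i) \<and>
      (\<Oplus>i\<in>h ` I. d i \<otimes> v i) = (\<Oplus>i\<in>I. c i \<otimes> v (h i))" if c: "c \<in> I \<rightarrow> K" for c
  proof -
    define d where "d = (\<lambda>j. c (inv_into I h j))"
    have d: "d (h i) = c i" if "i \<in> I" for i using that assms(1) by (simp add: d_def)
    then have dK: "d \<in> h ` I \<rightarrow> K" using c by auto
    have "(\<Oplus>i\<in>h ` I. d i \<otimes> v i) = (\<Oplus>i\<in>I. c i \<otimes> v (h i))"
      unfolding re [OF dK] using c assms(2,3) d by (intro finsum_cong') (auto simp: Pi_def)
    then show ?thesis using d dK by blast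
  qed
  show "fam_span K (h ` I) v = fam_span K I (\<lambda>i. v (h i))"
  proof (intro equalityI subsetI)
    fix x assume "x \<in> fam_span K (h ` I) v"
    then obtain c where "c \<in> h ` I \<rightarrow> K" "x = (\<Oplus>i\<in>h ` I. c i \<otimes> v i)" unfolding fam_span_def by blast
    then show "x \<in> fam_span K I (\<lambda>i. v (h i))"
      unfolding fam_span_def using re by (auto intro!: exI [of _ "\<lambda>i. c (h i)"])
  next
    fix x assume "x \<in> fam_span K I (\<lambda>i. v (h i))"
    then obtain c where c: "c \<in> I \<rightarrow> K" "x = (\<Oplus>i\<in>I. c i \<otimes> v (h i))" unfolding fam_span_def by blast
    obtain d where "d \<in> h ` I \<rightarrow> K" "x = (\<Oplus>i\<in>h ` I. d i \<otimes> v i)" using lift [OF c(1)] c(2) by auto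
    then show "x \<in> fam_span K (h ` I) v" unfolding fam_span_def by blast
  qed
  show "fam_indep K (h ` I) v \<longleftrightarrow> fam_indep K I (\<lambda>i. v (h i))"
  proof
    assume L: "fam_indep K (h ` I) v"
    show "fam_indep K I (\<lambda>i. v (h i))" unfolding fam_indep_def
    proof (intro ballI impI)
      fix c i assume c: "c \<in> I \<rightarrow> K" "(\<Oplus>i\<in>I. c i \<otimes> v (h i)) = \<zero>" and i: "i \<in> I"
      obtain d where d: "d \<in> h ` I \<rightarrow> K" "\<forall>i\<in>I. d (h i) = c i" "(\<Oplus>i\<in>h ` I. d i \<otimes> v i) = \<zero>"
        using lift [OF c(1)] c(2) by auto
      then have "d (h i) = \<zero>" using L i unfolding fam_indep_def by blast
      then show "c i = \<zero>" using d(2) i by simp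
    qed
  next
    assume r: "fam_indep K I (\<lambda>i. v (h i))"
    show "fam_indep K (h ` I) v" unfolding fam_indep_def
    proof (intro ballI impI)
      fix c j assume c: "c \<in> h ` I \<rightarrow> K" "(\<Oplus>i\<in>h ` I. c i \<otimes> v i) = \<zero>" and j: "j \<in> h ` I"
      have "(\<lambda>i. c (h i)) \<in> I \<rightarrow> K" using c by auto
      then show "c j = \<zero>" using r re [OF c(1)] c(2) j unfolding fam_indep_def by fastforce
    qed
  qed
qed

lemma fam_indep_mono:
  assumes "fam_indep K I v" "J \<subseteq> I" "finite I" "v \<in> I \<rightarrow> carrier R" "\<zero> \<in> K" "K \<subseteq> carrier R"
  shows "fam_indep K J v"
  unfolding fam_indep_def
proof (intro ballI impI)
  fix c j assume c: "c \<in> J \<rightarrow> K" "(\<Oplus>i\<in>J. c i \<otimes> v i) = \<zero>" and j: "j \<in> J"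
  define d where "d = (\<lambda>i. if i \<in> J then c i else \<zero>)"
  have d: "d \<in> I \<rightarrow> K" using c(1) assms(5) by (auto simp: d_def)
  have "(\<Oplus>i\<in>I. d i \<otimes> v i) = (\<Oplus>i\<in>J. c i \<otimes> v i)"
    using assms d by (intro add.finprod_mono_neutral_cong_right) (auto simp: d_def Pi_def subset_iff)
  then have "d j = \<zero>" using assms(1,2) d c(2) j unfolding fam_indep_def by auto
  then show "c j = \<zero>" using j by (simp add: d_def)
qed

lemma fam_spanI: "c \<in> I \<rightarrow> K \<Longrightarrow> (\<Oplus>i\<in>I. c i \<otimes> v i) \<in> fam_span K I v"
  unfolding fam_span_def by blast

lemma fam_spanE:
  assumes "fam_span K I v = E" "x \<in> E"
  obtains c where "c \<in> I \<rightarrow> K" "x = (\<Oplus>i\<in>I. c i \<otimes> v i)"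
  using assms unfolding fam_span_def by blast

text \<open>The scalars form only a subring: besides the field \<open>M\<close>, the noncommutative
  ring \<open>M(K)\<close> occurs, with the powers of \<open>y\<close> as the family.\<close>

lemma fam_indep_unique:
  assumes K: "subring K R" and "fam_indep K I v" "v \<in> I \<rightarrow> carrier R" "c \<in> I \<rightarrow> K" "d \<in> I \<rightarrow> K"
    and eq: "(\<Oplus>i\<in>I. c i \<otimes> v i) = (\<Oplus>i\<in>I. d i \<otimes> v i)" and i: "i \<in> I"
  shows "c i = d i"
proof -
  have cd: "c i \<in> K" "d i \<in> K" "c i \<in> carrier R" "d i \<in> carrier R" "v i \<in> carrier R" if "i \<in> I" for i
    using assms(3-5) that subringE(1) [OF K] by auto
  have K': "c i \<ominus> d i \<in> K" if "i \<in> I" for i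
    using cd [OF that] subringE(5,7) [OF K] unfolding a_minus_def by auto
  have "(\<Oplus>i\<in>I. (c i \<ominus> d i) \<otimes> v i) = (\<Oplus>i\<in>I. c i \<otimes> v i \<ominus> d i \<otimes> v i)"
    using cd by (intro finsum_cong') (auto simp: a_minus_def l_distr l_minus)
  also have "\<dots> = (\<Oplus>i\<in>I. c i \<otimes> v i) \<ominus> (\<Oplus>i\<in>I. d i \<otimes> v i)"
    using cd by (intro finsum_diff) auto
  also have "\<dots> = \<zero>"
  proof -
    have "(\<Oplus>i\<in>I. d i \<otimes> v i) \<in> carrier R" using cd by (intro finsum_closed) auto
    then show ?thesis unfolding eq by (simp add: a_minus_def r_neg)
  qed
  finally have "c i \<ominus> d i = \<zero>"
    using assms(2) K' i unfolding fam_indep_def by (auto dest!: bspec [of _ _ "\<lambda>i. c i \<ominus> d i"])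
  then show ?thesis using cd [OF i] by simp
qed

section \<open>Bases and dimension over a subfield\<close>

context
  fixes K assumes K: "subfield K R"
begin

lemma subfield_carrier: "K \<subseteq> carrier R" using subfieldE(3) [OF K] .

lemma Span_eq_fam_span:
  assumes "set Us \<subseteq> carrier R"
  shows "Span K Us = fam_span K {..<length Us} ((!) Us)"
proof (intro equalityI subsetI)
  fix x assume "x \<in> Span K Us"
  then obtain Ks where Ks: "set Ks \<subseteq> K" "length Ks = length Us" "x = combine Ks Us"
    using Span_mem_iff_length_version [OF K assms] by blast
  then have "x = (\<Oplus>i\<in>{..<length Us}. Ks ! i \<otimes> Us ! i)"
    using subfield_carrier assms by (subst Ks(3), intro combine_eq_finsum) auto
  moreover have "(!) Ks \<in> {..<length Us} \<rightarrow> K" using Ks by auto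
  ultimately show "x \<in> fam_span K {..<length Us} ((!) Us)" unfolding fam_span_def by blast
next
  fix x assume "x \<in> fam_span K {..<length Us} ((!) Us)"
  then obtain c where c: "c \<in> {..<length Us} \<rightarrow> K" "x = (\<Oplus>i\<in>{..<length Us}. c i \<otimes> Us ! i)"
    unfolding fam_span_def by blast
  let ?Ks = "map c [0..<length Us]"
  have Ks: "set ?Ks \<subseteq> K" using c(1) by auto
  have "combine ?Ks Us = (\<Oplus>i\<in>{..<length Us}. ?Ks ! i \<otimes> Us ! i)"
    using Ks subfield_carrier assms by (intro combine_eq_finsum) auto
  also have "\<dots> = x" unfolding c(2) using c(1) subfield_carrier assms
    by (intro finsum_cong') (auto simp: Pi_def subset_iff)
  finally show "x \<in> Span K Us"
    using Span_mem_iff_length_version [OF K assms] Ks by (metis diff_zero length_map length_upt)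
qed

lemma independent_iff_fam_indep:
  assumes "set Us \<subseteq> carrier R"
  shows "independent K Us \<longleftrightarrow> fam_indep K {..<length Us} ((!) Us)"
proof
  assume ind: "independent K Us"
  show "fam_indep K {..<length Us} ((!) Us)" unfolding fam_indep_def
  proof (intro ballI impI)
    fix c i assume c: "c \<in> {..<length Us} \<rightarrow> K" "(\<Oplus>i\<in>{..<length Us}. c i \<otimes> Us ! i) = \<zero>"
      and i: "i \<in> {..<length Us}"
    let ?Ks = "map c [0..<length Us]"
    have Ks: "set ?Ks \<subseteq> K" using c(1) by auto
    have "combine ?Ks Us = (\<Oplus>i\<in>{..<length Us}. ?Ks ! i \<otimes> Us ! i)"
      using Ks subfield_carrier assms by (intro combine_eq_finsum) auto
    also have "\<dots> = (\<Oplus>i\<in>{..<length Us}. c i \<otimes> Us ! i)" using c(1) subfield_carrier assms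
      by (intro finsum_cong') (auto simp: Pi_def subset_iff)
    finally have "set (take (length Us) ?Ks) \<subseteq> {\<zero>}"
      using independent_imp_trivial_combine [OF K ind Ks] c(2) by simp
    then show "c i = \<zero>" using i by (auto simp: image_subset_iff)
  qed
next
  assume r: "fam_indep K {..<length Us} ((!) Us)"
  show "independent K Us"
  proof (rule ccontr)
    assume "\<not> independent K Us"
    then obtain Ks where Ks: "length Ks = length Us" "combine Ks Us = \<zero>" "set Ks \<subseteq> K" "set Ks \<noteq> {\<zero>}"
      using dependent_imp_non_trivial_combine [OF K assms] by blast
    have "(\<Oplus>i\<in>{..<length Us}. Ks ! i \<otimes> Us ! i) = \<zero>"
      using Ks combine_eq_finsum [of Ks Us] subfield_carrier assms by auto
    moreover have "(!) Ks \<in> {..<length Us} \<rightarrow> K"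
      using Ks(1,3) by (auto simp: subset_iff in_set_conv_nth)
    ultimately have "\<forall>i<length Us. Ks ! i = \<zero>" using r unfolding fam_indep_def by auto
    \<comment> \<open>The condition \<open>set Ks \<noteq> {\<zero>}\<close> also admits the empty
      list. That case alone is left, and the empty list is independent.\<close>
    then have "set Ks \<subseteq> {\<zero>}" using Ks(1) by (auto simp: in_set_conv_nth)
    then have "Us = []" using Ks(1,4) by (cases Ks) auto
    then show False using \<open>\<not> independent K Us\<close> by simp
  qed
qed

lemma fam_cong:
  assumes "\<And>i. i \<in> I \<Longrightarrow> v i = w i" "w \<in> I \<rightarrow> carrier R"
  shows "fam_span K I v = fam_span K I w" "fam_indep K I v \<longleftrightarrow> fam_indep K I w"
proof -
  have "(\<Oplus>i\<in>I. c i \<otimes> v i) = (\<Oplus>i\<in>I. c i \<otimes> w i)" if "c \<in> I \<rightarrow> K" for c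
    using assms that subfield_carrier by (intro finsum_cong') (auto simp: Pi_def)
  then show "fam_span K I v = fam_span K I w" "fam_indep K I v \<longleftrightarrow> fam_indep K I w"
    unfolding fam_span_def fam_indep_def
    by (auto cong: conj_cong) metis+
qed

text \<open>Any enumeration of \<open>I\<close> turns the family into a list, and this passes the
  dimension theory of lists on to families.\<close>

lemma ex_list_of_family:
  assumes "finite I" "v \<in> I \<rightarrow> carrier R"
  obtains Us where "set Us = v ` I" "length Us = card I" "Span K Us = fam_span K I v"
    "independent K Us \<longleftrightarrow> fam_indep K I v"
proof -
  obtain xs where xs: "set xs = I" "distinct xs" using assms(1) finite_distinct_list by blast
  let ?Us = "map v xs"
  have U: "set ?Us \<subseteq> carrier R" using assms(2) xs by auto
  have l: "length xs = card I" using distinct_card [OF xs(2)] xs(1) by simp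
  have inj: "inj_on ((!) xs) {..<length xs}" "(!) xs ` {..<length xs} = I"
    unfolding xs(1) [symmetric] set_conv_nth using xs(2) by (auto simp: inj_on_nth)
  have v: "v \<in> (!) xs ` {..<length xs} \<rightarrow> carrier R" using assms inj by auto
  have "(\<lambda>i. v (xs ! i)) \<in> {..<length xs} \<rightarrow> carrier R" using v by auto
  note c = fam_cong [of "{..<length xs}" "(!) ?Us", OF _ this]
  show ?thesis
  proof (rule that)
    show "set ?Us = v ` I" "length ?Us = card I" using xs l by auto
    show "Span K ?Us = fam_span K I v"
      using Span_eq_fam_span [OF U] fam_reindex(1) [OF inj(1) v subfield_carrier] c(1) inj(2) by simp
    show "independent K ?Us \<longleftrightarrow> fam_indep K I v"
      using independent_iff_fam_indep [OF U] fam_reindex(2) [OF inj(1) v subfield_carrier] c(2) inj(2)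
      by simp
  qed
qed

lemma fam_span_subspace:
  assumes "finite I" "v \<in> I \<rightarrow> carrier R"
  shows "fam_span K I v \<subseteq> carrier R" "\<zero> \<in> fam_span K I v"
    "a \<in> fam_span K I v \<Longrightarrow> b \<in> fam_span K I v \<Longrightarrow> a \<oplus> b \<in> fam_span K I v"
    "a \<in> fam_span K I v \<Longrightarrow> \<ominus> a \<in> fam_span K I v"
    "k \<in> K \<Longrightarrow> a \<in> fam_span K I v \<Longrightarrow> k \<otimes> a \<in> fam_span K I v"
    "i \<in> I \<Longrightarrow> v i \<in> fam_span K I v"
proof -
  obtain Us where Us: "set Us = v ` I" "Span K Us = fam_span K I v"
    using ex_list_of_family [OF assms] by metis
  have c: "set Us \<subseteq> carrier R" using Us(1) assms(2) by auto
  note props = Span_subgroup_props [OF K c] Span_smult_closed [OF K c] Span_base_incl [OF K c]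
  show "fam_span K I v \<subseteq> carrier R" "\<zero> \<in> fam_span K I v"
    "a \<in> fam_span K I v \<Longrightarrow> b \<in> fam_span K I v \<Longrightarrow> a \<oplus> b \<in> fam_span K I v"
    "a \<in> fam_span K I v \<Longrightarrow> \<ominus> a \<in> fam_span K I v"
    "k \<in> K \<Longrightarrow> a \<in> fam_span K I v \<Longrightarrow> k \<otimes> a \<in> fam_span K I v"
    "i \<in> I \<Longrightarrow> v i \<in> fam_span K I v"
    using props Us by auto
qed

lemma dimension_fam_span:
  assumes "finite I" "v \<in> I \<rightarrow> carrier R" "fam_indep K I v"
  shows "dimension (card I) K (fam_span K I v)"
  using ex_list_of_family [OF assms(1,2)] assms(3) dimension_independent by metis

lemma fam_indep_card_le:
  assumes "finite I" "v \<in> I \<rightarrow> E" "fam_indep K I v" "dimension n K E"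
  shows "card I \<le> n"
proof -
  have "v \<in> I \<rightarrow> carrier R" using assms(2) space_subgroup_props(1) [OF K assms(4)] by auto
  from ex_list_of_family [OF assms(1) this] obtain Us where
    "set Us = v ` I" "length Us = card I" "independent K Us" using assms(3) by metis
  then show ?thesis using independent_length_le_dimension [OF K assms(4), of Us] assms(2) by auto
qed

lemma fam_span_eqI:
  assumes "finite I" "v \<in> I \<rightarrow> E" "fam_indep K I v" "dimension (card I) K E"
  shows "fam_span K I v = E"
proof -
  have "v \<in> I \<rightarrow> carrier R" using assms(2) space_subgroup_props(1) [OF K assms(4)] by auto
  from ex_list_of_family [OF assms(1) this] obtain Us where
    "set Us = v ` I" "length Us = card I" "independent K Us" "Span K Us = fam_span K I v"
    using assms(3) by metis
  then show ?thesis using independent_length_eq_dimension [OF K assms(4), of Us] assms(2) by auto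
qed

lemma base_family:
  assumes "dimension n K E"
  obtains v where "v \<in> {..<n} \<rightarrow> E" "v \<in> {..<n} \<rightarrow> carrier R"
    "fam_indep K {..<n} v" "fam_span K {..<n} v = E"
proof -
  obtain Us where U: "set Us \<subseteq> carrier R" "independent K Us" "length Us = n" "Span K Us = E"
    using exists_base [OF K assms] by blast
  have "set Us \<subseteq> E" using Span_base_incl [OF K U(1)] U(4) by simp
  then show ?thesis
    using that [of "(!) Us"] U Span_eq_fam_span [OF U(1)] independent_iff_fam_indep [OF U(1)]
    by (auto simp: Pi_def subset_iff)
qed

lemma base_family_containing:
  assumes "dimension n K E" "w \<in> E" "w \<noteq> \<zero>"
  obtains v where "v \<in> {..<n} \<rightarrow> carrier R"
    "fam_indep K {..<n} v" "fam_span K {..<n} v = E" "v 0 = w" "0 < n"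
proof -
  have w: "w \<in> carrier R" using space_subgroup_props(1) [OF K assms(1)] assms(2) by auto
  have "independent K [w]" using w assms(3) by (intro li_Cons) auto
  then obtain Vs where Vs: "length (Vs @ [w]) = n" "independent K (Vs @ [w])" "Span K (Vs @ [w]) = E"
    using complete_base [OF K assms(1), of "[w]"] assms(2) by auto
  \<comment> \<open>\<open>complete_base\<close> leaves the given vector at the end of the list,
    whereas it has to receive the index \<open>0\<close>.\<close>
  let ?U = "w # Vs"
  have c: "set ?U \<subseteq> carrier R" using independent_in_carrier [OF Vs(2)] by auto
  have i: "independent K ?U" using independent_same_set [OF K _ _ Vs(2), of ?U] by simp
  have s: "Span K ?U = E" using Span_same_set [OF K, of "?U" "Vs @ [w]"] c Vs(3) by simp
  have l: "length ?U = n" using Vs(1) by simp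
  show ?thesis
  proof (rule that [of "(!) ?U"])
    show "(!) ?U \<in> {..<n} \<rightarrow> carrier R"
    proof
      fix i assume "i \<in> {..<n}"
      then have "?U ! i \<in> set ?U" using l by (intro nth_mem) simp
      then show "?U ! i \<in> carrier R" using c by blast
    qed
  qed (use Span_eq_fam_span [OF c] independent_iff_fam_indep [OF c] i s l in auto)
qed

text \<open>Gaussian elimination.\<close>

lemma homogeneous_system:
  assumes "finite J" "finite I" "card J < card I" "\<And>i j. i \<in> I \<Longrightarrow> j \<in> J \<Longrightarrow> a j i \<in> K"
  shows "\<exists>x \<in> I \<rightarrow> K. (\<exists>i\<in>I. x i \<noteq> \<zero>) \<and> (\<forall>j\<in>J. (\<Oplus>i\<in>I. x i \<otimes> a j i) = \<zero>)"
  using assms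
proof (induction J arbitrary: I a rule: finite_induct)
  case empty
  then have "I \<noteq> {}" by auto
  then show ?case using subringE(3) [OF subfieldE(1) [OF K]] subfieldE(6) [OF K]
    by (intro bexI [of _ "\<lambda>_. \<one>"]) auto
next
  case (insert j J)
  note cl = subringE [OF subfieldE(1) [OF K]]
  show ?case
  proof (cases "\<forall>i\<in>I. a j i = \<zero>")
    case True
    have "card J < card I" using insert by simp
    from insert.IH [OF insert.prems(1) this, of a] insert.prems(3) obtain x where
      x: "x \<in> I \<rightarrow> K" "\<exists>i\<in>I. x i \<noteq> \<zero>" "\<forall>j\<in>J. (\<Oplus>i\<in>I. x i \<otimes> a j i) = \<zero>" by auto
    have "(\<Oplus>i\<in>I. x i \<otimes> a j i) = (\<Oplus>i\<in>I. \<zero>)"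
      using True x(1) subfield_carrier by (intro finsum_cong') (auto simp: Pi_def)
    then show ?thesis using x by (intro bexI [of _ x]) auto
  next
    case False
    then obtain i0 where i0: "i0 \<in> I" "a j i0 \<noteq> \<zero>" by auto
    define p where "p = inv (a j i0)"
    have ai0: "a j i0 \<in> K - {\<zero>}" using i0 insert.prems(3) by auto
    have p: "p \<in> K" "p \<otimes> a j i0 = \<one>"
      using subfield_m_inv [OF K ai0] by (auto simp: p_def)
    define I' where "I' = I - {i0}"
    have aK: "a j' i \<in> K" "a j' i \<in> carrier R" if "i \<in> I" "j' \<in> insert j J" for i j'
      using insert.prems(3) [OF that] subfield_carrier by auto
    \<comment> \<open>The pivot of equation \<open>j\<close> eliminates the unknown
      \<open>i0\<close>; these are the coefficients of the other unknowns in equation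
      \<open>j'\<close> after the substitution.\<close>
    define b where "b = (\<lambda>j' i. a j' i \<ominus> a j i \<otimes> p \<otimes> a j' i0)"
    have bK: "b j' i \<in> K" if "i \<in> I'" "j' \<in> J" for i j'
      using that aK i0 p cl unfolding b_def a_minus_def I'_def by auto
    have I': "finite I'" "card J < card I'" "i0 \<notin> I'" "insert i0 I' = I"
      using insert i0 by (auto simp: I'_def)
    have "\<exists>x \<in> I' \<rightarrow> K. (\<exists>i\<in>I'. x i \<noteq> \<zero>) \<and> (\<forall>j'\<in>J. (\<Oplus>i\<in>I'. x i \<otimes> b j' i) = \<zero>)"
      by (rule insert.IH [OF I'(1,2)]) (use bK in auto)
    then obtain x where
      x: "x \<in> I' \<rightarrow> K" "\<exists>i\<in>I'. x i \<noteq> \<zero>" "\<forall>j'\<in>J. (\<Oplus>i\<in>I'. x i \<otimes> b j' i) = \<zero>" by blast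
    have xc: "x i \<in> carrier R" if "i \<in> I'" for i using x(1) that subfield_carrier by auto
    have pc: "p \<in> carrier R" using p subfield_carrier by auto
    have II: "i \<in> I" if "i \<in> I'" for i using that by (auto simp: I'_def)
    define s where "s = (\<Oplus>i\<in>I'. x i \<otimes> a j i)"
    have s: "s \<in> K" unfolding s_def
      by (rule finsum_closed_in) (use x aK cl II in \<open>auto simp: Pi_def\<close>)
    then have sc: "s \<in> carrier R" using subfield_carrier by auto
    \<comment> \<open>The value at \<open>i0\<close> is the one that equation \<open>j\<close>
      dictates.\<close>
    define y where "y = (\<lambda>i. if i = i0 then \<ominus> (s \<otimes> p) else x i)"
    have "\<ominus> (s \<otimes> p) \<in> K" using s p cl by blast
    then have y: "y \<in> I \<rightarrow> K" using x(1) by (auto simp: y_def I'_def)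
    have sum: "(\<Oplus>i\<in>I. y i \<otimes> a j' i) = (\<Oplus>i\<in>I'. x i \<otimes> a j' i) \<ominus> s \<otimes> p \<otimes> a j' i0"
      if j': "j' \<in> insert j J" for j'
    proof -
      have "(\<Oplus>i\<in>I. y i \<otimes> a j' i) = y i0 \<otimes> a j' i0 \<oplus> (\<Oplus>i\<in>I'. y i \<otimes> a j' i)"
        unfolding I'(4) [symmetric] using I' y aK j' subfield_carrier i0
        by (subst finsum_insert) (auto simp: Pi_def subset_iff)
      also have "(\<Oplus>i\<in>I'. y i \<otimes> a j' i) = (\<Oplus>i\<in>I'. x i \<otimes> a j' i)"
        using I' xc aK j' II by (intro finsum_cong') (auto simp: Pi_def y_def)
      finally show ?thesis using sc pc aK j' i0 xc II
        by (simp add: y_def a_minus_def l_minus a_comm Pi_def)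
    qed
    have "(\<Oplus>i\<in>I. y i \<otimes> a j' i) = \<zero>" if j': "j' \<in> insert j J" for j'
    proof (cases "j' = j")
      case True
      show ?thesis unfolding sum [OF j'] unfolding True s_def [symmetric]
        using sc pc p aK i0 by (simp add: m_assoc r_neg a_minus_def)
    next
      case False
      then have J: "j' \<in> J" using j' by auto
      have "(\<Oplus>i\<in>I'. x i \<otimes> b j' i) = (\<Oplus>i\<in>I'. x i \<otimes> a j' i \<ominus> x i \<otimes> a j i \<otimes> (p \<otimes> a j' i0))"
        using xc aK pc i0 j' II
        by (intro finsum_cong') (auto simp: b_def a_minus_def r_distr r_minus m_assoc)
      also have "\<dots> = (\<Oplus>i\<in>I'. x i \<otimes> a j' i) \<ominus> (\<Oplus>i\<in>I'. x i \<otimes> a j i \<otimes> (p \<otimes> a j' i0))"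
        using xc aK pc i0 j' II by (intro finsum_diff) auto
      also have "(\<Oplus>i\<in>I'. x i \<otimes> a j i \<otimes> (p \<otimes> a j' i0)) = s \<otimes> (p \<otimes> a j' i0)"
        unfolding s_def using xc aK pc i0 j' II I' by (intro finsum_ldistr [symmetric]) auto
      finally show ?thesis using sum [OF j'] x(3) J sc pc aK i0 j' by (simp add: m_assoc)
    qed
    moreover have "\<exists>i\<in>I. y i \<noteq> \<zero>" using x(2) I' II by (auto simp: y_def)
    ultimately show ?thesis using y by auto
  qed
qed

text \<open>Each of the \<open>card J\<close> vector equations amounts to \<open>card L\<close>
  scalar equations, one for each coordinate with respect to \<open>w\<close>.\<close>

lemma homogeneous_system_vectors:
  assumes "finite L" "w \<in> L \<rightarrow> carrier R" "finite J" "finite I" "card J * card L < card I"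
    and V: "\<forall>j\<in>J. \<forall>i\<in>I. V j i \<in> fam_span K L w"
  obtains x where "x \<in> I \<rightarrow> K" "\<exists>i\<in>I. x i \<noteq> \<zero>" "\<forall>j\<in>J. (\<Oplus>i\<in>I. x i \<otimes> V j i) = \<zero>"
proof -
  define c where "c = (\<lambda>j i. SOME c. c \<in> L \<rightarrow> K \<and> V j i = (\<Oplus>l\<in>L. c l \<otimes> w l))"
  have "\<exists>c. c \<in> L \<rightarrow> K \<and> V j i = (\<Oplus>l\<in>L. c l \<otimes> w l)" if "i \<in> I" "j \<in> J" for i j
    using fam_spanE [OF refl V [rule_format, OF that(2,1)]] by blast
  then have "c j i \<in> L \<rightarrow> K \<and> V j i = (\<Oplus>l\<in>L. c j i l \<otimes> w l)" if "i \<in> I" "j \<in> J" for i j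
    unfolding c_def by (rule someI_ex) (use that in auto)
  then have c: "c j i \<in> L \<rightarrow> K" "V j i = (\<Oplus>l\<in>L. c j i l \<otimes> w l)"
    if "i \<in> I" "j \<in> J" for i j
    using that by auto
  have cK: "c j i l \<in> K" "c j i l \<in> carrier R" if "i \<in> I" "j \<in> J" "l \<in> L" for i j l
    using c(1) [OF that(1,2)] that(3) subfield_carrier by auto
  have "card (J \<times> L) < card I" using assms by (simp add: card_cartesian_product)
  from homogeneous_system [OF _ assms(4) this, of "\<lambda>j i. c (fst j) i (snd j)"] have
    "\<exists>x \<in> I \<rightarrow> K. (\<exists>i\<in>I. x i \<noteq> \<zero>) \<and>
      (\<forall>j\<in>J \<times> L. (\<Oplus>i\<in>I. x i \<otimes> c (fst j) i (snd j)) = \<zero>)"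
    using assms(1,3) cK by (auto simp: mem_Times_iff)
  then obtain x where x: "x \<in> I \<rightarrow> K" "\<exists>i\<in>I. x i \<noteq> \<zero>"
    "\<And>j l. j \<in> J \<Longrightarrow> l \<in> L \<Longrightarrow> (\<Oplus>i\<in>I. x i \<otimes> c j i l) = \<zero>"
    by force
  show ?thesis
  proof (rule that [OF x(1,2)], intro ballI)
    fix j assume j: "j \<in> J"
    have xc: "x i \<in> carrier R" if "i \<in> I" for i using x(1) that subfield_carrier by auto
    have wc: "w l \<in> carrier R" if "l \<in> L" for l using assms(2) that by auto
    have "(\<Oplus>i\<in>I. x i \<otimes> V j i) = (\<Oplus>i\<in>I. \<Oplus>l\<in>L. x i \<otimes> c j i l \<otimes> w l)"
    proof (rule finsum_cong')
      fix i assume i: "i \<in> I"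
      have "x i \<otimes> V j i = (\<Oplus>l\<in>L. x i \<otimes> (c j i l \<otimes> w l))"
        unfolding c(2) [OF i j] using xc [OF i] wc cK i j assms(1) by (intro finsum_rdistr) auto
      also have "\<dots> = (\<Oplus>l\<in>L. x i \<otimes> c j i l \<otimes> w l)"
        using xc [OF i] wc cK i j by (intro finsum_cong') (auto simp: m_assoc)
      finally show "x i \<otimes> V j i = (\<Oplus>l\<in>L. x i \<otimes> c j i l \<otimes> w l)" .
    qed (use xc wc cK j in auto)
    also have "\<dots> = (\<Oplus>l\<in>L. \<Oplus>i\<in>I. x i \<otimes> c j i l \<otimes> w l)"
      using assms xc wc cK j by (intro finsum_swap) auto
    also have "\<dots> = (\<Oplus>l\<in>L. (\<Oplus>i\<in>I. x i \<otimes> c j i l) \<otimes> w l)"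
      using assms xc wc cK j by (intro finsum_cong' finsum_ldistr [symmetric]) auto
    also have "\<dots> = (\<Oplus>l\<in>L. \<zero>)"
      using x(3) j wc by (intro finsum_cong') auto
    finally show "(\<Oplus>i\<in>I. x i \<otimes> V j i) = \<zero>" by simp
  qed
qed

text \<open>The Steinitz bound is the case of a single vector equation: more vectors than spanning
  ones would satisfy a nontrivial relation.\<close>

lemma fam_indep_card_le_span:
  assumes "finite I" "finite J" "fam_indep K I v" "v \<in> I \<rightarrow> carrier R" "u \<in> J \<rightarrow> carrier R"
    and "\<forall>i\<in>I. v i \<in> fam_span K J u"
  shows "card I \<le> card J"
proof (rule ccontr)
  assume "\<not> card I \<le> card J"
  then have card: "card {()} * card J < card I" by simp
  have "\<forall>j\<in>{()}. \<forall>i\<in>I. v i \<in> fam_span K J u" using assms(6) by simp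
  from homogeneous_system_vectors [OF assms(2,5) finite.insertI [OF finite.emptyI] assms(1) card this]
  obtain c where "c \<in> I \<rightarrow> K" "\<exists>i\<in>I. c i \<noteq> \<zero>" "\<forall>j\<in>{()}. (\<Oplus>i\<in>I. c i \<otimes> v i) = \<zero>" .
  then show False using assms(3) unfolding fam_indep_def by blast
qed

end

text \<open>A list that spans over \<open>F\<close> also spans over \<open>K\<close>, so a finite
  dimension over \<open>K\<close> exists. Its value is left open and is found later by
  counting.\<close>

lemma dimension_over_larger_subfield:
  assumes F: "subfield F R" and K: "subfield K R" and "F \<subseteq> K" "dimension d F E"
    and smult: "\<forall>k\<in>K. \<forall>e\<in>E. k \<otimes> e \<in> E"
  obtains m where "dimension m K E"
proof -
  obtain Us where Us: "set Us \<subseteq> carrier R" "Span F Us = E"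
    using exists_base [OF F assms(4)] by blast
  have "subgroup E (add_monoid R)" using Span_is_add_subgroup [OF F Us(1)] Us(2) by simp
  moreover have "K <#> set Us \<subseteq> E"
    using smult Span_base_incl [OF F Us(1)] Us(2) unfolding set_mult_def by blast
  ultimately have "Span K Us \<subseteq> E" by (rule Span_min [OF K Us(1)])
  moreover have "E \<subseteq> Span K Us"
    unfolding Us(2) [symmetric] Span_eq_combine_set [OF F Us(1)] Span_eq_combine_set [OF K Us(1)]
    using assms(3) by blast
  ultimately show ?thesis
    using that Span_finite_dimension [OF K Us(1)] unfolding finite_dimension_def by auto
qed

text \<open>The \<open>r\<close>-th coefficients of all relations \<open>\<Oplus>i. p\<^sub>i y e\<^sub>i = 0\<close> form an ideal. If it is not zero, some
  relation has \<open>r\<close>-th coefficient \<open>1\<close>; its commutators with ring elements are shorter relations, so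
  by induction all its coefficients are central.\<close>

lemma bimultiplication_independence:
  assumes simple: "simple_ring R" and F: "subfield F R" and center: "ring_center R = F"
    and "finite I" "e \<in> I \<rightarrow> carrier R" "fam_indep F I e" "p \<in> I \<rightarrow> carrier R"
    and "\<And>y. y \<in> carrier R \<Longrightarrow> (\<Oplus>i\<in>I. p i \<otimes> y \<otimes> e i) = \<zero>"
  shows "\<forall>i\<in>I. p i = \<zero>"
  using assms(4-)
proof (induction I arbitrary: p rule: finite_induct)
  case (insert r I)
  define S where "S = {p \<in> insert r I \<rightarrow> carrier R.
    \<forall>y \<in> carrier R. (\<Oplus>i\<in>insert r I. p i \<otimes> y \<otimes> e i) = \<zero>}"
  have e: "e i \<in> carrier R" if "i \<in> insert r I" for i using insert.prems(1) that by auto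
  have Sc: "q i \<in> carrier R" if "q \<in> S" "i \<in> insert r I" for q i using that by (auto simp: S_def)
  have S0: "(\<Oplus>i\<in>insert r I. q i \<otimes> y \<otimes> e i) = \<zero>" if "q \<in> S" "y \<in> carrier R" for q y
    using that by (auto simp: S_def)
  have eI: "fam_indep F I e"
    using fam_indep_mono [OF insert.prems(2), of I] insert.hyps insert.prems(1)
      subringE(2) [OF subfieldE(1) [OF F]] subfieldE(3) [OF F] by auto
  have zero: "\<forall>i\<in>I. q i = \<zero>" if "q \<in> S" "q r = \<zero>" for q
  proof (rule insert.IH)
    show "q \<in> I \<rightarrow> carrier R" "e \<in> I \<rightarrow> carrier R" using that Sc e by auto
    fix y assume y: "y \<in> carrier R"
    have "(\<Oplus>i\<in>insert r I. q i \<otimes> y \<otimes> e i) = q r \<otimes> y \<otimes> e r \<oplus> (\<Oplus>i\<in>I. q i \<otimes> y \<otimes> e i)"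
      using insert.hyps that Sc e y by (intro finsum_insert) auto
    then show "(\<Oplus>i\<in>I. q i \<otimes> y \<otimes> e i) = \<zero>"
      using S0 [OF that(1) y] that Sc e y by (simp add: Pi_def)
  qed (rule eI)
  have add: "(\<lambda>i. q i \<oplus> q' i) \<in> S" if q: "q \<in> S" "q' \<in> S" for q q'
  proof -
    have "(\<Oplus>i\<in>insert r I. (q i \<oplus> q' i) \<otimes> y \<otimes> e i) = \<zero>" if y: "y \<in> carrier R" for y
    proof -
      have "(\<Oplus>i\<in>insert r I. (q i \<oplus> q' i) \<otimes> y \<otimes> e i)
        = (\<Oplus>i\<in>insert r I. q i \<otimes> y \<otimes> e i \<oplus> q' i \<otimes> y \<otimes> e i)"
        using Sc [OF q(1)] Sc [OF q(2)] e y by (intro finsum_cong') (auto simp: l_distr)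
      also have "\<dots> = (\<Oplus>i\<in>insert r I. q i \<otimes> y \<otimes> e i) \<oplus> (\<Oplus>i\<in>insert r I. q' i \<otimes> y \<otimes> e i)"
        using Sc [OF q(1)] Sc [OF q(2)] e y by (intro finsum_addf) auto
      finally show ?thesis using S0 [OF q(1) y] S0 [OF q(2) y] by simp
    qed
    then show ?thesis using Sc [OF q(1)] Sc [OF q(2)] unfolding S_def by auto
  qed
  have lmul: "(\<lambda>i. x \<otimes> q i) \<in> S" if q: "q \<in> S" and x: "x \<in> carrier R" for q x
  proof -
    have "(\<Oplus>i\<in>insert r I. x \<otimes> q i \<otimes> y \<otimes> e i) = \<zero>" if y: "y \<in> carrier R" for y
    proof -
      have "(\<Oplus>i\<in>insert r I. x \<otimes> q i \<otimes> y \<otimes> e i) = (\<Oplus>i\<in>insert r I. x \<otimes> (q i \<otimes> y \<otimes> e i))"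
        using Sc [OF q] e x y by (intro finsum_cong') (auto simp: m_assoc)
      also have "\<dots> = x \<otimes> (\<Oplus>i\<in>insert r I. q i \<otimes> y \<otimes> e i)"
        using Sc [OF q] e x y insert.hyps by (intro finsum_rdistr [symmetric]) auto
      finally show ?thesis using S0 [OF q y] x by simp
    qed
    then show ?thesis using Sc [OF q] x unfolding S_def by auto
  qed
  have rmul: "(\<lambda>i. q i \<otimes> x) \<in> S" if q: "q \<in> S" and x: "x \<in> carrier R" for q x
  proof -
    have "(\<Oplus>i\<in>insert r I. q i \<otimes> x \<otimes> y \<otimes> e i) = \<zero>" if y: "y \<in> carrier R" for y
    proof -
      have "(\<Oplus>i\<in>insert r I. q i \<otimes> x \<otimes> y \<otimes> e i) = (\<Oplus>i\<in>insert r I. q i \<otimes> (x \<otimes> y) \<otimes> e i)"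
        using Sc [OF q] e x y by (intro finsum_cong') (auto simp: m_assoc)
      then show ?thesis using S0 [OF q, of "x \<otimes> y"] x y by simp
    qed
    then show ?thesis using Sc [OF q] x unfolding S_def by auto
  qed
  define J where "J = (\<lambda>q. q r) ` S"
  have "ideal J R"
  proof (rule idealI [OF ring_axioms])
    show "subgroup J (add_monoid R)"
    proof (rule add.subgroupI)
      show "J \<subseteq> carrier R" using Sc by (auto simp: J_def)
      have "p \<in> S" using insert.prems by (simp add: S_def)
      then show "J \<noteq> {}" by (auto simp: J_def)
      fix a assume "a \<in> J"
      then obtain q where q: "q \<in> S" "a = q r" by (auto simp: J_def)
      have "\<ominus> a = \<ominus> \<one> \<otimes> q r" using q Sc by (simp add: l_minus)
      then show "\<ominus> a \<in> J" using lmul [OF q(1), of "\<ominus> \<one>"] by (force simp: J_def)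
      fix b assume "b \<in> J"
      then obtain q' where q': "q' \<in> S" "b = q' r" by (auto simp: J_def)
      then show "a \<oplus> b \<in> J" using add [OF q(1) q'(1)] q(2) by (force simp: J_def)
    qed
  next
    fix a x assume "a \<in> J" and x: "x \<in> carrier R"
    then obtain q where q: "q \<in> S" "a = q r" by (auto simp: J_def)
    show "x \<otimes> a \<in> J" using lmul [OF q(1) x] q(2) by (force simp: J_def)
    show "a \<otimes> x \<in> J" using rmul [OF q(1) x] q(2) by (force simp: J_def)
  qed
  then consider "J = {\<zero>}" | "J = carrier R" using simple unfolding simple_ring_def by blast
  then show ?case
  proof cases
    case 1
    have "p \<in> S" using insert.prems by (simp add: S_def)
    then have "p r = \<zero>" using 1 by (auto simp: J_def)
    then show ?thesis using zero [OF \<open>p \<in> S\<close>] by simp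
  next
    case 2
    then have "\<one> \<in> J" by simp
    then obtain q where q: "q \<in> S" "q r = \<one>" unfolding J_def by auto
    have qF: "q i \<in> F" if i: "i \<in> insert r I" for i
    proof -
      have "q i \<otimes> x = x \<otimes> q i" if x: "x \<in> carrier R" for x
      proof (cases "i = r")
        case False
        \<comment> \<open>The commutator of \<open>x\<close> with the relation, written with the
          factor \<open>\<ominus> \<one>\<close> because closure of \<open>S\<close> is available
          for sums and for multiples. Its coefficient at \<open>r\<close> vanishes since
          \<open>q r = \<one>\<close>.\<close>
        let ?q = "\<lambda>i. x \<otimes> q i \<oplus> \<ominus> \<one> \<otimes> (q i \<otimes> x)"
        have "?q \<in> S" using q x by (intro add lmul rmul) auto
        moreover have "?q r = \<zero>" using q x by (simp add: l_minus r_neg)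
        ultimately have "?q i = \<zero>" using zero False i by auto
        then show ?thesis using Sc [OF q(1) i] x
          by (metis (no_types, lifting) a_minus_def l_minus l_one m_closed one_closed r_right_minus_eq)
      qed (use q x in simp)
      then show ?thesis using center Sc [OF q(1) i] unfolding ring_center_def by auto
    qed
    \<comment> \<open>At \<open>y = \<one>\<close> the relation becomes an \<open>F\<close>-linear
      relation between the independent \<open>e i\<close>, which rules out
      \<open>q r = \<one>\<close>.\<close>
    have "(\<Oplus>i\<in>insert r I. q i \<otimes> e i) = (\<Oplus>i\<in>insert r I. q i \<otimes> \<one> \<otimes> e i)"
      using Sc [OF q(1)] e by (intro finsum_cong') auto
    then have "(\<Oplus>i\<in>insert r I. q i \<otimes> e i) = \<zero>" using S0 [OF q(1), of \<one>] by simp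
    then have "q r = \<zero>" using insert.prems(2) qF unfolding fam_indep_def by blast
    then show ?thesis using q subfieldE(6) [OF F] by simp
  qed
qed simp

end

subsection \<open>Maximal subfields and the Skolem--Noether theorem\<close>

locale algebra_with_maximal_subfield = ring A for A (structure) +
  fixes F M :: "'a set" and n :: nat
  assumes central_simple: "central_simple A F n" and maximal: "maximal_subfield A F n M"
begin

abbreviation G where "G \<equiv> aut_group A F M"

lemma simple: "simple_ring A" and F: "subfield F A" and center: "ring_center A = F"
  and dim_F: "dimension (n ^ 2) F (carrier A)"
  using central_simple by (auto simp: central_simple_def)

lemma M: "subfield M A" and FM: "F \<subseteq> M" and dim_M_F: "dimension n F M"
  using maximal by (auto simp: maximal_subfield_def)

lemmas M_cl = subringE [OF subfieldE(1) [OF M]]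
lemmas F_cl = subringE [OF subfieldE(1) [OF F]]

lemma M_carr: "m \<in> M \<Longrightarrow> m \<in> carrier A" using M_cl(1) by auto
lemma F_carr: "m \<in> F \<Longrightarrow> m \<in> carrier A" using F_cl(1) by auto
lemma M_comm: "a \<in> M \<Longrightarrow> b \<in> M \<Longrightarrow> a \<otimes> b = b \<otimes> a" using subfieldE(4) [OF M] .
lemma one_not_zero: "\<one> \<noteq> \<zero>" using subfieldE(6) [OF M] .
lemma M_minus: "a \<in> M \<Longrightarrow> b \<in> M \<Longrightarrow> a \<ominus> b \<in> M" by (simp add: a_minus_def M_cl)

lemma F_central: "f \<in> F \<Longrightarrow> a \<in> carrier A \<Longrightarrow> f \<otimes> a = a \<otimes> f"
  using center unfolding ring_center_def by blast

lemma M_unit: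
  assumes "m \<in> M" "m \<noteq> \<zero>"
  shows "m \<in> Units A" "inv m \<in> M" "inv m \<otimes> m = \<one>" "m \<otimes> inv m = \<one>" "inv m \<noteq> \<zero>"
  using subfield_m_inv [OF M, of m] assms M_carr unfolding Units_def by auto

lemma M_finsum: "f \<in> I \<rightarrow> M \<Longrightarrow> (\<Oplus>i\<in>I. f i) \<in> M"
  by (rule finsum_closed_in) (use M_cl in auto)

lemma bimult_indep:
  assumes "finite I" "e \<in> I \<rightarrow> carrier A" "fam_indep F I e" "p \<in> I \<rightarrow> carrier A"
    and "\<And>y. y \<in> carrier A \<Longrightarrow> (\<Oplus>i\<in>I. p i \<otimes> y \<otimes> e i) = \<zero>" and "i \<in> I"
  shows "p i = \<zero>"
  using bimultiplication_independence [OF simple F center assms(1-5)] assms(6) by blast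

text \<open>The tower formula gives \<open>n * d = n ^ 2\<close>. The factor \<open>n\<close> can be
  cancelled, since a space of dimension \<open>0\<close> does not contain
  \<open>\<one>\<close>.\<close>

lemma dim_M: "dimension n M (carrier A)" and n_pos: "0 < n"
proof -
  show "0 < n"
  proof (rule ccontr)
    assume "\<not> 0 < n"
    then have "M = {\<zero>}" using dimension_zero [OF F] dim_M_F by simp
    then show False using M_cl(3) one_not_zero by auto
  qed
  obtain d where d: "dimension d M (carrier A)"
    using dimension_over_larger_subfield [OF F M FM dim_F] M_carr by auto
  have "n * d = n ^ 2"
    using dimension_is_inj [OF F telescopic_base [OF F M dim_M_F d] dim_F] .
  then show "dimension n M (carrier A)" using d \<open>0 < n\<close> by (simp add: power2_eq_square)
qed

lemma aut_groupD:
  assumes "s \<in> carrier G"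
  shows "m \<in> M \<Longrightarrow> s m \<in> M" "f \<in> F \<Longrightarrow> s f = f" "s \<one> = \<one>"
    "m \<in> M \<Longrightarrow> m' \<in> M \<Longrightarrow> s (m \<otimes> m') = s m \<otimes> s m'"
    "m \<in> M \<Longrightarrow> m' \<in> M \<Longrightarrow> s (m \<oplus> m') = s m \<oplus> s m'"
    "bij_betw s M M" "s \<in> extensional M" "s \<zero> = \<zero>"
    "m \<in> M \<Longrightarrow> m \<noteq> \<zero> \<Longrightarrow> s m \<noteq> \<zero>"
proof -
  have h: "s \<in> Bij M" "s \<in> ring_iso (A\<lparr>carrier := M\<rparr>) (A\<lparr>carrier := M\<rparr>)" "\<forall>z\<in>F. s z = z"
    using assms by (auto simp: aut_group_def)
  show "m \<in> M \<Longrightarrow> s m \<in> M" "s \<one> = \<one>" "bij_betw s M M"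
    "m \<in> M \<Longrightarrow> m' \<in> M \<Longrightarrow> s (m \<otimes> m') = s m \<otimes> s m'"
    "m \<in> M \<Longrightarrow> m' \<in> M \<Longrightarrow> s (m \<oplus> m') = s m \<oplus> s m'"
    using ring_iso_memE [OF h(2)] by auto
  show "f \<in> F \<Longrightarrow> s f = f" "s \<in> extensional M" using h by (auto simp: Bij_def)
  then show z: "s \<zero> = \<zero>" using F_cl(2) h(3) by auto
  show "m \<in> M \<Longrightarrow> m \<noteq> \<zero> \<Longrightarrow> s m \<noteq> \<zero>"
    using \<open>bij_betw s M M\<close> z M_cl(2) unfolding bij_betw_def inj_on_def by metis
qed

lemma aut_finsum:
  assumes s: "s \<in> carrier G" and "f \<in> I \<rightarrow> M"
  shows "s (\<Oplus>i\<in>I. f i) = (\<Oplus>i\<in>I. s (f i))"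
  using assms(2)
proof (induction I rule: infinite_finite_induct)
  case (insert a I)
  have "f a \<in> M" "(\<Oplus>i\<in>I. f i) \<in> M" using insert.prems by (auto intro: M_finsum)
  then show ?case using insert aut_groupD [OF s] M_carr by (simp add: finsum_insert Pi_def)
qed (use aut_groupD [OF s] in auto)

text \<open>The operators \<open>x \<mapsto> \<Oplus>i. m\<^sub>i x g\<^sub>i\<close> form the algebra \<open>M \<otimes> A\<^sup>o\<^sup>p\<close>, on which an automorphism of
  \<open>M\<close> acts through the first factor.\<close>

lemma operator_transport:
  assumes s: "s \<in> carrier G" and I: "finite I"
    and m: "m \<in> I \<rightarrow> M" "m' \<in> I \<rightarrow> M" and g: "g \<in> I \<rightarrow> carrier A" "g' \<in> I \<rightarrow> carrier A"
    and eq: "\<And>x. x \<in> carrier A \<Longrightarrow> (\<Oplus>i\<in>I. m i \<otimes> x \<otimes> g i) = (\<Oplus>i\<in>I. m' i \<otimes> x \<otimes> g' i)"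
    and x: "x \<in> carrier A"
  shows "(\<Oplus>i\<in>I. s (m i) \<otimes> x \<otimes> g i) = (\<Oplus>i\<in>I. s (m' i) \<otimes> x \<otimes> g' i)"
proof -
  obtain e where e: "e \<in> {..<n ^ 2} \<rightarrow> carrier A" "fam_indep F {..<n ^ 2} e"
    "fam_span F {..<n ^ 2} e = carrier A" using base_family [OF F dim_F] .
  let ?N = "{..<n ^ 2}"
  have coords: "\<exists>\<phi>. (\<forall>i\<in>I. \<forall>k\<in>?N. \<phi> i k \<in> F) \<and> (\<forall>i\<in>I. h i = (\<Oplus>k\<in>?N. \<phi> i k \<otimes> e k))"
    if h: "h \<in> I \<rightarrow> carrier A" for h
  proof -
    define \<phi> where "\<phi> = (\<lambda>i. SOME c. c \<in> ?N \<rightarrow> F \<and> h i = (\<Oplus>k\<in>?N. c k \<otimes> e k))"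
    have "\<phi> i \<in> ?N \<rightarrow> F \<and> h i = (\<Oplus>k\<in>?N. \<phi> i k \<otimes> e k)" if "i \<in> I" for i
    proof -
      have "h i \<in> carrier A" using h that by auto
      from fam_spanE [OF e(3) this]
      have "\<exists>c. c \<in> ?N \<rightarrow> F \<and> h i = (\<Oplus>k\<in>?N. c k \<otimes> e k)" by blast
      then show ?thesis unfolding \<phi>_def by (rule someI_ex)
    qed
    then show ?thesis by (intro exI [of _ \<phi>]) auto
  qed
  \<comment> \<open>The \<open>F\<close>-coordinates of the right factors are central and move into
    the left factors. In this normal form, with the fixed basis \<open>e\<close> on the right, the
    left factors are determined by the operator.\<close>
  have expand: "(\<Oplus>i\<in>I. u i \<otimes> y \<otimes> h i) = (\<Oplus>k\<in>?N. (\<Oplus>i\<in>I. u i \<otimes> \<phi> i k) \<otimes> y \<otimes> e k)"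
    if u: "u \<in> I \<rightarrow> M" and y: "y \<in> carrier A" and h: "h \<in> I \<rightarrow> carrier A"
      and \<phi>: "\<forall>i\<in>I. \<forall>k\<in>?N. \<phi> i k \<in> F" "\<forall>i\<in>I. h i = (\<Oplus>k\<in>?N. \<phi> i k \<otimes> e k)" for u y h \<phi>
  proof -
    have uc: "u i \<in> carrier A" if "i \<in> I" for i using u that M_carr by auto
    have ec: "e k \<in> carrier A" if "k \<in> ?N" for k using e that by auto
    have pc: "\<phi> i k \<in> carrier A" if "i \<in> I" "k \<in> ?N" for i k using \<phi> that F_carr by auto
    have "(\<Oplus>i\<in>I. u i \<otimes> y \<otimes> h i) = (\<Oplus>i\<in>I. \<Oplus>k\<in>?N. u i \<otimes> \<phi> i k \<otimes> y \<otimes> e k)"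
    proof (rule finsum_cong')
      fix i assume i: "i \<in> I"
      have "u i \<otimes> y \<otimes> h i = (\<Oplus>k\<in>?N. u i \<otimes> y \<otimes> (\<phi> i k \<otimes> e k))"
        using \<phi>(2) i uc y pc ec by (simp add: finsum_rdistr Pi_def)
      also have "\<dots> = (\<Oplus>k\<in>?N. u i \<otimes> \<phi> i k \<otimes> y \<otimes> e k)"
      proof (rule finsum_cong')
        fix k assume k: "k \<in> ?N"
        have "y \<otimes> (\<phi> i k \<otimes> e k) = \<phi> i k \<otimes> (y \<otimes> e k)"
          using F_central [of "\<phi> i k" y] \<phi>(1) i k y pc [OF i k] ec [OF k] by (simp flip: m_assoc)
        then show "u i \<otimes> y \<otimes> (\<phi> i k \<otimes> e k) = u i \<otimes> \<phi> i k \<otimes> y \<otimes> e k"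
          using uc [OF i] y pc [OF i k] ec [OF k] by (simp add: m_assoc)
      qed (use i uc y pc ec in auto)
      finally show "u i \<otimes> y \<otimes> h i = (\<Oplus>k\<in>?N. u i \<otimes> \<phi> i k \<otimes> y \<otimes> e k)" .
    qed (use uc y pc ec in \<open>auto intro!: finsum_closed\<close>)
    also have "\<dots> = (\<Oplus>k\<in>?N. \<Oplus>i\<in>I. u i \<otimes> \<phi> i k \<otimes> y \<otimes> e k)"
      using I uc y pc ec by (intro finsum_swap) auto
    also have "\<dots> = (\<Oplus>k\<in>?N. (\<Oplus>i\<in>I. u i \<otimes> \<phi> i k) \<otimes> y \<otimes> e k)"
    proof (rule finsum_cong')
      fix k assume k: "k \<in> ?N"
      show "(\<Oplus>i\<in>I. u i \<otimes> \<phi> i k \<otimes> y \<otimes> e k) = (\<Oplus>i\<in>I. u i \<otimes> \<phi> i k) \<otimes> y \<otimes> e k"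
        using I uc y pc [OF _ k] ec [OF k] by (simp add: finsum_ldistr Pi_def)
    qed (use uc y pc ec in \<open>auto intro!: finsum_closed m_closed\<close>)
    finally show ?thesis .
  qed
  obtain \<phi> where \<phi>: "\<forall>i\<in>I. \<forall>k\<in>?N. \<phi> i k \<in> F" "\<forall>i\<in>I. g i = (\<Oplus>k\<in>?N. \<phi> i k \<otimes> e k)"
    using coords [OF g(1)] by blast
  obtain \<psi> where \<psi>: "\<forall>i\<in>I. \<forall>k\<in>?N. \<psi> i k \<in> F" "\<forall>i\<in>I. g' i = (\<Oplus>k\<in>?N. \<psi> i k \<otimes> e k)"
    using coords [OF g(2)] by blast
  define a where "a = (\<lambda>k. \<Oplus>i\<in>I. m i \<otimes> \<phi> i k)"
  define b where "b = (\<lambda>k. \<Oplus>i\<in>I. m' i \<otimes> \<psi> i k)"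
  have aM: "a k \<in> M" "b k \<in> M" if "k \<in> ?N" for k
    unfolding a_def b_def using that m \<phi>(1) \<psi>(1) FM
    by (auto intro!: M_finsum M_cl(6) simp: Pi_iff subset_iff)
  have ab: "a k = b k" if k: "k \<in> ?N" for k
  proof -
    have "(\<Oplus>k\<in>?N. (a k \<ominus> b k) \<otimes> y \<otimes> e k) = \<zero>" if y: "y \<in> carrier A" for y
    proof -
      have "(\<Oplus>k\<in>?N. (a k \<ominus> b k) \<otimes> y \<otimes> e k) = (\<Oplus>k\<in>?N. a k \<otimes> y \<otimes> e k \<ominus> b k \<otimes> y \<otimes> e k)"
        using aM M_carr y e(1) by (intro finsum_cong') (auto simp: a_minus_def l_distr l_minus Pi_iff)
      also have "\<dots> = (\<Oplus>k\<in>?N. a k \<otimes> y \<otimes> e k) \<ominus> (\<Oplus>k\<in>?N. b k \<otimes> y \<otimes> e k)"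
        using aM M_carr y e(1) by (intro finsum_diff) auto
      also have "(\<Oplus>k\<in>?N. a k \<otimes> y \<otimes> e k) = (\<Oplus>k\<in>?N. b k \<otimes> y \<otimes> e k)"
        unfolding a_def b_def
        using expand [OF m(1) y g(1) \<phi>] expand [OF m(2) y g(2) \<psi>] eq [OF y] by simp
      finally show ?thesis using aM M_carr y e(1) by (simp add: r_neg a_minus_def Pi_iff)
    qed
    moreover have "(\<lambda>k. a k \<ominus> b k) \<in> ?N \<rightarrow> carrier A" using aM M_carr by auto
    ultimately have "a k \<ominus> b k = \<zero>"
      using bimult_indep [OF _ e(1,2), of "\<lambda>k. a k \<ominus> b k" k] k by auto
    then show ?thesis using aM [OF k] M_carr by simp
  qed
  \<comment> \<open>\<open>s\<close> fixes \<open>F\<close>, so applying it to the left factors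
    commutes with passing to the normal form.\<close>
  have s_sum: "(\<Oplus>i\<in>I. s (u i) \<otimes> \<rho> i k) = s (\<Oplus>i\<in>I. u i \<otimes> \<rho> i k)"
    if u: "u \<in> I \<rightarrow> M" and \<rho>: "\<forall>i\<in>I. \<forall>k\<in>?N. \<rho> i k \<in> F" and k: "k \<in> ?N" for u \<rho> k
  proof -
    have "s (\<Oplus>i\<in>I. u i \<otimes> \<rho> i k) = (\<Oplus>i\<in>I. s (u i \<otimes> \<rho> i k))"
      using u \<rho> k FM by (intro aut_finsum [OF s]) (auto intro!: M_cl(6) simp: Pi_iff subset_iff)
    also have "\<dots> = (\<Oplus>i\<in>I. s (u i) \<otimes> \<rho> i k)"
    proof (rule finsum_cong')
      show "(\<lambda>i. s (u i) \<otimes> \<rho> i k) \<in> I \<rightarrow> carrier A"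
        using u \<rho> k aut_groupD(1) [OF s] M_carr F_carr by (auto intro!: m_closed simp: Pi_iff)
      show "s (u i \<otimes> \<rho> i k) = s (u i) \<otimes> \<rho> i k" if "i \<in> I" for i
        using u \<rho> k that FM aut_groupD(2,4) [OF s] by (auto simp: Pi_iff subset_iff)
    qed simp
    finally show ?thesis by simp
  qed
  have sm: "(\<lambda>i. s (m i)) \<in> I \<rightarrow> M" "(\<lambda>i. s (m' i)) \<in> I \<rightarrow> M" using m aut_groupD(1) [OF s] by auto
  have "(\<Oplus>k\<in>?N. (\<Oplus>i\<in>I. s (m i) \<otimes> \<phi> i k) \<otimes> x \<otimes> e k)
    = (\<Oplus>k\<in>?N. (\<Oplus>i\<in>I. s (m' i) \<otimes> \<psi> i k) \<otimes> x \<otimes> e k)"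
  proof (rule finsum_cong')
    show "(\<lambda>k. (\<Oplus>i\<in>I. s (m' i) \<otimes> \<psi> i k) \<otimes> x \<otimes> e k) \<in> ?N \<rightarrow> carrier A"
      using s_sum [OF m(2) \<psi>(1)] aM aut_groupD(1) [OF s] M_carr x e(1) unfolding b_def
      by (auto simp: Pi_iff)
    show "(\<Oplus>i\<in>I. s (m i) \<otimes> \<phi> i k) \<otimes> x \<otimes> e k = (\<Oplus>i\<in>I. s (m' i) \<otimes> \<psi> i k) \<otimes> x \<otimes> e k"
      if "k \<in> ?N" for k
      using s_sum [OF m(2) \<psi>(1) that] s_sum [OF m(1) \<phi>(1) that] ab [OF that]
      unfolding a_def b_def by simp
  qed simp
  then show ?thesis
    using expand [OF sm(1) x g(1) \<phi>] expand [OF sm(2) x g(2) \<psi>] by simp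
qed

text \<open>Counting unknowns: over \<open>M\<close>, the \<open>n\<^sup>2\<close>-dimensional algebra of operators \<open>x \<mapsto> \<Oplus>k. m\<^sub>k x e\<^sub>k\<close>
  injects into, hence exhausts, the \<open>M\<close>-linear endomorphisms of \<open>A\<close>.\<close>

lemma ex_rank_one_operator:
  assumes a: "a \<in> carrier A" "a \<noteq> \<zero>"
  obtains m and N :: nat and e where "m \<in> {..<N} \<rightarrow> M" "e \<in> {..<N} \<rightarrow> carrier A"
    "(\<Oplus>k\<in>{..<N}. m k \<otimes> a \<otimes> e k) = \<one>"
    "\<forall>x\<in>carrier A. (\<Oplus>k\<in>{..<N}. m k \<otimes> x \<otimes> e k) \<in> M"
proof -
  define N where "N = n ^ 2"
  obtain w where w: "w \<in> {..<n} \<rightarrow> carrier A" "fam_indep M {..<n} w"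
    "fam_span M {..<n} w = carrier A" "w 0 = a"
    using base_family_containing [OF M dim_M a] .
  obtain e where e: "e \<in> {..<N} \<rightarrow> carrier A" "fam_indep F {..<N} e"
    using base_family [OF F dim_F] unfolding N_def by metis
  have wc: "w j \<in> carrier A" if "j < n" for j using w that by auto
  have ec: "e k \<in> carrier A" if "k < N" for k using e that by auto
  \<comment> \<open>The unknowns \<open>x k\<close> with \<open>k < N\<close> are the left factors
    of an operator, and the extra unknown \<open>x N\<close> is its value at \<open>a = w 0\<close>.
    The equations demand that the operator sends \<open>w 0\<close> to \<open>x N\<close> and every
    other \<open>w j\<close> to \<open>\<zero>\<close>. There are \<open>n * n\<close> scalar
    equations for \<open>N + 1\<close> unknowns.\<close>
  define V where "V = (\<lambda>j k. if k = N then if j = 0 then \<ominus> \<one> else \<zero> else w j \<otimes> e k)"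
  have V: "\<forall>j\<in>{..<n}. \<forall>k\<in>insert N {..<N}. V j k \<in> carrier A"
    using wc ec by (auto simp: V_def)
  then have V': "\<forall>j\<in>{..<n}. \<forall>k\<in>insert N {..<N}. V j k \<in> fam_span M {..<n} w" by (simp only: w(3))
  have card: "card {..<n} * card {..<n} < card (insert N {..<N})" by (simp add: N_def power2_eq_square)
  obtain x where x: "x \<in> insert N {..<N} \<rightarrow> M" "\<exists>k\<in>insert N {..<N}. x k \<noteq> \<zero>"
    "\<forall>j\<in>{..<n}. (\<Oplus>k\<in>insert N {..<N}. x k \<otimes> V j k) = \<zero>"
    using homogeneous_system_vectors
      [OF M finite_lessThan w(1) finite_lessThan finite.insertI [OF finite_lessThan] card V'] .
  have xM: "x k \<in> M" "x k \<in> carrier A" if "k \<le> N" for k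
    using funcset_mem [OF x(1), of k] that M_carr by (auto simp: le_less)
  have Tw: "(\<Oplus>k\<in>{..<N}. x k \<otimes> w j \<otimes> e k) = (if j = 0 then x N else \<zero>)" if j: "j < n" for j
  proof -
    have "(\<Oplus>k\<in>insert N {..<N}. x k \<otimes> V j k) = x N \<otimes> V j N \<oplus> (\<Oplus>k\<in>{..<N}. x k \<otimes> V j k)"
      using V xM j by (intro finsum_insert) auto
    also have "(\<Oplus>k\<in>{..<N}. x k \<otimes> V j k) = (\<Oplus>k\<in>{..<N}. x k \<otimes> w j \<otimes> e k)"
      using xM wc [OF j] ec by (intro finsum_cong') (auto simp: V_def m_assoc)
    finally have *: "x N \<otimes> V j N \<oplus> (\<Oplus>k\<in>{..<N}. x k \<otimes> w j \<otimes> e k) = \<zero>" using x(3) j by simp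
    have c: "(\<Oplus>k\<in>{..<N}. x k \<otimes> w j \<otimes> e k) \<in> carrier A"
      using xM wc [OF j] ec by (intro finsum_closed) auto
    show ?thesis
    proof (cases "j = 0")
      case True
      have "\<ominus> x N \<oplus> (\<Oplus>k\<in>{..<N}. x k \<otimes> w j \<otimes> e k) = \<zero>"
        using * True xM [of N] by (simp add: V_def r_minus)
      then have "\<ominus> (\<Oplus>k\<in>{..<N}. x k \<otimes> w j \<otimes> e k) = \<ominus> x N"
        using xM [of N] c by (intro minus_equality) auto
      then show ?thesis using True xM [of N] minus_minus [OF c] by simp
    qed (use * c xM [of N] in \<open>simp add: V_def\<close>)
  qed
  have T: "(\<Oplus>k\<in>{..<N}. x k \<otimes> y \<otimes> e k) = d 0 \<otimes> x N"
    if d: "d \<in> {..<n} \<rightarrow> M" and y: "y = (\<Oplus>j\<in>{..<n}. d j \<otimes> w j)" for d y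
  proof -
    have dM: "d j \<in> M" "d j \<in> carrier A" if "j < n" for j using d that M_carr by auto
    have "(\<Oplus>k\<in>{..<N}. x k \<otimes> y \<otimes> e k) = (\<Oplus>k\<in>{..<N}. \<Oplus>j\<in>{..<n}. d j \<otimes> (x k \<otimes> w j \<otimes> e k))"
    proof (rule finsum_cong')
      fix k assume "k \<in> {..<N}"
      then have k: "x k \<in> M" "x k \<in> carrier A" "e k \<in> carrier A" using xM ec by auto
      have "x k \<otimes> y \<otimes> e k = (\<Oplus>j\<in>{..<n}. x k \<otimes> (d j \<otimes> w j) \<otimes> e k)"
        unfolding y using k dM wc by (simp add: finsum_rdistr finsum_ldistr Pi_def)
      also have "\<dots> = (\<Oplus>j\<in>{..<n}. d j \<otimes> (x k \<otimes> w j \<otimes> e k))"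
      proof (rule finsum_cong')
        fix j assume "j \<in> {..<n}"
        then have j: "d j \<in> M" "d j \<in> carrier A" "w j \<in> carrier A" using dM wc by auto
        have "x k \<otimes> (d j \<otimes> w j) = d j \<otimes> (x k \<otimes> w j)"
          using M_comm [OF k(1) j(1)] k j by (simp flip: m_assoc)
        then show "x k \<otimes> (d j \<otimes> w j) \<otimes> e k = d j \<otimes> (x k \<otimes> w j \<otimes> e k)"
          using k j by (simp add: m_assoc)
      qed (use k dM wc in auto)
      finally show "x k \<otimes> y \<otimes> e k = (\<Oplus>j\<in>{..<n}. d j \<otimes> (x k \<otimes> w j \<otimes> e k))" .
    qed (use xM ec dM wc in \<open>auto intro!: finsum_closed\<close>)
    also have "\<dots> = (\<Oplus>j\<in>{..<n}. \<Oplus>k\<in>{..<N}. d j \<otimes> (x k \<otimes> w j \<otimes> e k))"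
      using xM ec dM wc by (intro finsum_swap) auto
    also have "\<dots> = (\<Oplus>j\<in>{..<n}. if j = 0 then d j \<otimes> x N else \<zero>)"
    proof (rule finsum_cong')
      fix j assume j: "j \<in> {..<n}"
      have "(\<Oplus>k\<in>{..<N}. d j \<otimes> (x k \<otimes> w j \<otimes> e k)) = d j \<otimes> (\<Oplus>k\<in>{..<N}. x k \<otimes> w j \<otimes> e k)"
        using xM ec dM wc j by (intro finsum_rdistr [symmetric]) auto
      then show "(\<Oplus>k\<in>{..<N}. d j \<otimes> (x k \<otimes> w j \<otimes> e k)) = (if j = 0 then d j \<otimes> x N else \<zero>)"
        using Tw [of j] j dM by simp
    qed (use xM dM in auto)
    also have "\<dots> = d 0 \<otimes> x N" using n_pos dM xM by (intro finsum_delta) auto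
    finally show ?thesis .
  qed
  have Tall: "\<exists>d \<in> M. (\<Oplus>k\<in>{..<N}. x k \<otimes> y \<otimes> e k) = d \<otimes> x N" if "y \<in> carrier A" for y
  proof -
    from fam_spanE [OF w(3) that]
    obtain d where d: "d \<in> {..<n} \<rightarrow> M" "y = (\<Oplus>j\<in>{..<n}. d j \<otimes> w j)" .
    then show ?thesis using T [OF d] n_pos by (intro bexI [of _ "d 0"]) auto
  qed
  \<comment> \<open>With \<open>x N = \<zero>\<close> the operator would vanish on the basis
    \<open>w\<close>, hence everywhere, and independence of the \<open>e k\<close> over
    \<open>F\<close> would make the whole solution trivial. Dividing by \<open>x N\<close>
    afterwards turns the value at \<open>a\<close> into \<open>\<one>\<close>.\<close>
  have "x N \<noteq> \<zero>"
  proof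
    assume 0: "x N = \<zero>"
    have "(\<Oplus>k\<in>{..<N}. x k \<otimes> y \<otimes> e k) = \<zero>" if "y \<in> carrier A" for y
      using Tall [OF that] 0 M_carr by auto
    then have "x k = \<zero>" if "k < N" for k
      using bimult_indep [OF _ e, of x k] xM that by auto
    then show False using x(2) 0 by auto
  qed
  note z = M_unit [OF xM(1) [OF le_refl] this]
  have zc: "inv (x N) \<in> carrier A" using z M_carr by auto
  have pull: "(\<Oplus>k\<in>{..<N}. inv (x N) \<otimes> x k \<otimes> y \<otimes> e k) = inv (x N) \<otimes> (\<Oplus>k\<in>{..<N}. x k \<otimes> y \<otimes> e k)"
    if "y \<in> carrier A" for y
  proof -
    have "(\<Oplus>k\<in>{..<N}. inv (x N) \<otimes> x k \<otimes> y \<otimes> e k)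
      = (\<Oplus>k\<in>{..<N}. inv (x N) \<otimes> (x k \<otimes> y \<otimes> e k))"
      using that zc xM ec by (intro finsum_cong') (auto simp: m_assoc)
    then show ?thesis using that zc xM ec by (simp add: finsum_rdistr Pi_def)
  qed
  show ?thesis
  proof (rule that)
    show "(\<lambda>k. inv (x N) \<otimes> x k) \<in> {..<N} \<rightarrow> M" using z xM M_cl(6) by auto
    show "(\<Oplus>k\<in>{..<N}. inv (x N) \<otimes> x k \<otimes> a \<otimes> e k) = \<one>"
      using pull [OF a(1)] Tw [OF n_pos] w(4) z by simp
    show "\<forall>y\<in>carrier A. (\<Oplus>k\<in>{..<N}. inv (x N) \<otimes> x k \<otimes> y \<otimes> e k) \<in> M"
    proof
      fix y assume y: "y \<in> carrier A"
      show "(\<Oplus>k\<in>{..<N}. inv (x N) \<otimes> x k \<otimes> y \<otimes> e k) \<in> M"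
        using pull [OF y] Tall [OF y] z xM M_cl(6) by auto
    qed
  qed (rule e)
qed

text \<open>Take an operator \<open>T\<close> with values in \<open>M\<close> and
  \<open>T(1) = 1\<close>. As \<open>c\<close> commutes with the left factors of \<open>T\<close>,
  it follows that \<open>c = c T(1) = T(c)\<close>, a value of \<open>T\<close>.\<close>

lemma centralizer_M:
  assumes c: "c \<in> carrier A" and comm: "\<And>m. m \<in> M \<Longrightarrow> c \<otimes> m = m \<otimes> c"
  shows "c \<in> M"
proof -
  obtain m and N :: nat and e where T: "m \<in> {..<N} \<rightarrow> M" "e \<in> {..<N} \<rightarrow> carrier A"
    "(\<Oplus>k\<in>{..<N}. m k \<otimes> \<one> \<otimes> e k) = \<one>"
    "\<forall>x\<in>carrier A. (\<Oplus>k\<in>{..<N}. m k \<otimes> x \<otimes> e k) \<in> M"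
    using ex_rank_one_operator [OF one_closed one_not_zero] .
  have mc: "m k \<in> carrier A" "e k \<in> carrier A" "c \<otimes> m k = m k \<otimes> c" if "k < N" for k
    using T(1,2) that M_carr comm [of "m k"] by auto
  have "c = c \<otimes> (\<Oplus>k\<in>{..<N}. m k \<otimes> \<one> \<otimes> e k)" using T(3) c by simp
  also have "\<dots> = (\<Oplus>k\<in>{..<N}. c \<otimes> (m k \<otimes> \<one> \<otimes> e k))" using mc c by (intro finsum_rdistr) auto
  also have "\<dots> = (\<Oplus>k\<in>{..<N}. m k \<otimes> c \<otimes> e k)"
    using mc c by (intro finsum_cong') (auto simp flip: m_assoc)
  finally show ?thesis using bspec [OF T(4) c] by simp
qed

text \<open>Left multiplication by \<open>v\<close> is an injective \<open>F\<close>-linear map of a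
  finite-dimensional space, so \<open>\<one>\<close> is a value: \<open>v b = 1\<close>. Then
  \<open>v (b v - 1) = 0\<close>, and injectivity makes \<open>b\<close> a left inverse as
  well.\<close>

lemma left_regular_unit:
  assumes v: "v \<in> carrier A" and reg: "\<And>a. a \<in> carrier A \<Longrightarrow> v \<otimes> a = \<zero> \<Longrightarrow> a = \<zero>"
  shows "v \<in> Units A"
proof -
  let ?N = "{..<n ^ 2}"
  obtain e where e: "e \<in> ?N \<rightarrow> carrier A" "fam_indep F ?N e" using base_family [OF F dim_F] .
  have pull: "(\<Oplus>k\<in>?N. c k \<otimes> (v \<otimes> e k)) = v \<otimes> (\<Oplus>k\<in>?N. c k \<otimes> e k)" if c: "c \<in> ?N \<rightarrow> F" for c
  proof -
    have ce: "c k \<in> carrier A" "e k \<in> carrier A" "c k \<otimes> v = v \<otimes> c k" if "k \<in> ?N" for k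
      using c e that F_carr F_central [of "c k" v] v by auto
    have "(\<Oplus>k\<in>?N. c k \<otimes> (v \<otimes> e k)) = (\<Oplus>k\<in>?N. v \<otimes> (c k \<otimes> e k))"
    proof (rule finsum_cong')
      fix k assume "k \<in> ?N"
      from ce [OF this] show "c k \<otimes> (v \<otimes> e k) = v \<otimes> (c k \<otimes> e k)" using v by (simp flip: m_assoc)
    qed (use ce v in auto)
    then show ?thesis using ce v by (simp add: finsum_rdistr Pi_def)
  qed
  have sum_c: "(\<Oplus>k\<in>?N. c k \<otimes> e k) \<in> carrier A" if "c \<in> ?N \<rightarrow> F" for c
    using that e F_carr by (intro finsum_closed) (auto simp: Pi_iff)
  have "fam_indep F ?N (\<lambda>k. v \<otimes> e k)"
    unfolding fam_indep_def
  proof (intro ballI impI)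
    fix c k assume c: "c \<in> ?N \<rightarrow> F" "(\<Oplus>k\<in>?N. c k \<otimes> (v \<otimes> e k)) = \<zero>" and k: "k \<in> ?N"
    then have "(\<Oplus>k\<in>?N. c k \<otimes> e k) = \<zero>" using reg [OF sum_c] pull by simp
    then show "c k = \<zero>" using e(2) c(1) k unfolding fam_indep_def by blast
  qed
  moreover have "(\<lambda>k. v \<otimes> e k) \<in> ?N \<rightarrow> carrier A" using e v by auto
  ultimately have "fam_span F ?N (\<lambda>k. v \<otimes> e k) = carrier A"
    using dim_F by (intro fam_span_eqI [OF F]) auto
  from fam_spanE [OF this one_closed]
  obtain c where c: "c \<in> ?N \<rightarrow> F" "\<one> = (\<Oplus>k\<in>?N. c k \<otimes> (v \<otimes> e k))" .
  define b where "b = (\<Oplus>k\<in>?N. c k \<otimes> e k)"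
  have b: "b \<in> carrier A" "v \<otimes> b = \<one>" using c pull sum_c by (auto simp: b_def)
  have "v \<otimes> (b \<otimes> v \<ominus> \<one>) = v \<otimes> b \<otimes> v \<ominus> v"
    using b(1) v by (simp add: a_minus_def r_distr r_minus m_assoc)
  also have "\<dots> = \<zero>" using b v by (simp add: r_right_minus_eq)
  finally have "b \<otimes> v = \<one>" using reg [of "b \<otimes> v \<ominus> \<one>"] b v by simp
  then show ?thesis using b v unfolding Units_def by auto
qed

lemma aut_group_inverse:
  assumes s: "s \<in> carrier G"
  obtains t where "t \<in> carrier G" "\<And>m. m \<in> M \<Longrightarrow> t (s m) = m" "\<And>m. m \<in> M \<Longrightarrow> s (t m) = m"
proof -
  note sD = aut_groupD [OF s]
  have b: "inj_on s M" "s ` M = M" using sD(6) by (auto simp: bij_betw_def)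
  define t where "t = restrict (inv_into M s) M"
  have ts: "t (s m) = m" "s (t m) = m" "t m \<in> M" if "m \<in> M" for m
    using that b sD(1) f_inv_into_f [of m s M] inv_into_into [of m s M] by (auto simp: t_def)
  have "s \<in> Bij M" using s by (auto simp: aut_group_def)
  then have t: "t \<in> Bij M" unfolding t_def by (rule restrict_inv_into_Bij)
  let ?M = "A\<lparr>carrier := M\<rparr>"
  have M': "ring ?M" using subring_is_ring [OF subfieldE(1) [OF M]] .
  have "s \<in> ring_iso ?M ?M" using s by (auto simp: aut_group_def)
  from ring.ring_iso_restrict [OF M' ring_iso_set_sym [OF M' this], of t]
  have "t \<in> ring_iso ?M ?M" by (simp add: t_def)
  moreover have "t z = z" if "z \<in> F" for z using ts(1) [of z] sD(2) [OF that] that FM by auto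
  ultimately have "t \<in> carrier G" using t by (simp add: aut_group_def)
  then show ?thesis using that ts by blast
qed

text \<open>Applying \<open>s\<close> to the first factors of an operator with values in \<open>M\<close> gives an operator whose values
  \<open>v\<close> satisfy \<open>v m = s(m) v\<close>. A nonzero such \<open>v\<close> is not a left zero divisor: if \<open>v a = 0\<close> with
  \<open>a \<noteq> 0\<close>, write \<open>1 = \<Oplus>k. m\<^sub>k a e\<^sub>k\<close>; then \<open>v = \<Oplus>k. s(m\<^sub>k) v a e\<^sub>k = 0\<close>.\<close>

lemma skolem_noether:
  assumes s: "s \<in> carrier G"
  shows "\<exists>x \<in> Units A. \<forall>m \<in> M. x \<otimes> m \<otimes> inv x = s m"
proof -
  note sD = aut_groupD [OF s]
  obtain m and N :: nat and e where T: "m \<in> {..<N} \<rightarrow> M" "e \<in> {..<N} \<rightarrow> carrier A"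
    "(\<Oplus>k\<in>{..<N}. m k \<otimes> \<one> \<otimes> e k) = \<one>"
    "\<forall>x\<in>carrier A. (\<Oplus>k\<in>{..<N}. m k \<otimes> x \<otimes> e k) \<in> M"
    using ex_rank_one_operator [OF one_closed one_not_zero] .
  define S where "S = (\<lambda>x. \<Oplus>k\<in>{..<N}. s (m k) \<otimes> x \<otimes> e k)"
  have mc: "m k \<in> M" "m k \<in> carrier A" "e k \<in> carrier A" "s (m k) \<in> M" "s (m k) \<in> carrier A"
    if "k \<in> {..<N}" for k using T(1,2) that M_carr sD(1) by auto
  have Sc: "S x \<in> carrier A" if "x \<in> carrier A" for x
    unfolding S_def using mc that by (intro finsum_closed) auto
  have "\<exists>x \<in> carrier A. S x \<noteq> \<zero>"
  proof (rule ccontr)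
    assume "\<not> ?thesis"
    then have S0: "S x = \<zero>" if "x \<in> carrier A" for x using that by blast
    \<comment> \<open>If the transported operator were zero, transporting it back with the inverse
      of \<open>s\<close> would make the original one zero, against its value \<open>\<one>\<close>
      at \<open>\<one>\<close>.\<close>
    obtain t where t: "t \<in> carrier G" "\<And>m. m \<in> M \<Longrightarrow> t (s m) = m"
      using aut_group_inverse [OF s] by metis
    have z: "(\<Oplus>k\<in>{..<N}. \<zero> \<otimes> x \<otimes> e k) = \<zero>" if "x \<in> carrier A" for x
    proof -
      have "(\<Oplus>k\<in>{..<N}. \<zero> \<otimes> x \<otimes> e k) = (\<Oplus>k\<in>{..<N}. \<zero>)"
        using that mc by (intro finsum_cong') auto
      then show ?thesis by simp
    qed
    have "(\<Oplus>k\<in>{..<N}. t (s (m k)) \<otimes> \<one> \<otimes> e k) = (\<Oplus>k\<in>{..<N}. t \<zero> \<otimes> \<one> \<otimes> e k)"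
      using mc T(2) M_cl(2) S0 z unfolding S_def
      by (intro operator_transport [OF t(1), of _ "\<lambda>k. s (m k)" "\<lambda>_. \<zero>"]) auto
    also have "\<dots> = \<zero>" using z [OF one_closed] aut_groupD(8) [OF t(1)] by (simp only:)
    also have "(\<Oplus>k\<in>{..<N}. t (s (m k)) \<otimes> \<one> \<otimes> e k) = (\<Oplus>k\<in>{..<N}. m k \<otimes> \<one> \<otimes> e k)"
      using mc t by (intro finsum_cong') auto
    finally show False using T(3) one_not_zero by simp
  qed
  then obtain x where x: "x \<in> carrier A" "S x \<noteq> \<zero>" by blast
  define v where "v = S x"
  have v: "v \<in> carrier A" "v \<noteq> \<zero>" using x Sc by (auto simp: v_def)
  have comm: "v \<otimes> y = s y \<otimes> v" if y: "y \<in> M" for y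
  proof -
    have yc: "y \<in> carrier A" "s y \<in> carrier A" using y sD(1) M_carr by auto
    \<comment> \<open>The values of the original operator lie in \<open>M\<close> and commute with
      \<open>y\<close>, so multiplying it by \<open>y\<close> on the right or on the left gives the
      same operator. After the transport, the two forms read \<open>v y\<close> and
      \<open>s(y) v\<close>.\<close>
    have "(\<Oplus>k\<in>{..<N}. s (m k) \<otimes> x \<otimes> (e k \<otimes> y)) = (\<Oplus>k\<in>{..<N}. s (y \<otimes> m k) \<otimes> x \<otimes> e k)"
    proof (rule operator_transport [OF s])
      fix a assume a: "a \<in> carrier A"
      have "(\<Oplus>k\<in>{..<N}. m k \<otimes> a \<otimes> (e k \<otimes> y)) = (\<Oplus>k\<in>{..<N}. m k \<otimes> a \<otimes> e k \<otimes> y)"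
        using mc a yc by (intro finsum_cong') (auto simp: m_assoc)
      also have "\<dots> = (\<Oplus>k\<in>{..<N}. m k \<otimes> a \<otimes> e k) \<otimes> y"
        using mc a yc by (simp add: finsum_ldistr Pi_def)
      also have "\<dots> = y \<otimes> (\<Oplus>k\<in>{..<N}. m k \<otimes> a \<otimes> e k)" using M_comm bspec [OF T(4) a] y by blast
      also have "\<dots> = (\<Oplus>k\<in>{..<N}. y \<otimes> (m k \<otimes> a \<otimes> e k))"
        using mc a yc by (simp add: finsum_rdistr Pi_def)
      also have "\<dots> = (\<Oplus>k\<in>{..<N}. y \<otimes> m k \<otimes> a \<otimes> e k)"
        using mc a yc by (intro finsum_cong') (auto simp: m_assoc)
      finally show "(\<Oplus>k\<in>{..<N}. m k \<otimes> a \<otimes> (e k \<otimes> y)) = (\<Oplus>k\<in>{..<N}. y \<otimes> m k \<otimes> a \<otimes> e k)" .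
    qed (use mc y yc x M_cl(6) in auto)
    moreover have "(\<Oplus>k\<in>{..<N}. s (m k) \<otimes> x \<otimes> (e k \<otimes> y)) = v \<otimes> y"
    proof -
      have "(\<Oplus>k\<in>{..<N}. s (m k) \<otimes> x \<otimes> (e k \<otimes> y)) = (\<Oplus>k\<in>{..<N}. s (m k) \<otimes> x \<otimes> e k \<otimes> y)"
        using mc x yc by (intro finsum_cong') (auto simp: m_assoc)
      then show ?thesis unfolding v_def S_def using mc x yc by (simp add: finsum_ldistr Pi_def)
    qed
    moreover have "(\<Oplus>k\<in>{..<N}. s (y \<otimes> m k) \<otimes> x \<otimes> e k) = s y \<otimes> v"
    proof -
      have "(\<Oplus>k\<in>{..<N}. s (y \<otimes> m k) \<otimes> x \<otimes> e k) = (\<Oplus>k\<in>{..<N}. s y \<otimes> (s (m k) \<otimes> x \<otimes> e k))"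
        using mc x y yc sD(4) by (intro finsum_cong') (auto simp: m_assoc)
      then show ?thesis unfolding v_def S_def using mc x yc by (simp add: finsum_rdistr Pi_def)
    qed
    ultimately show ?thesis by simp
  qed
  have "v \<in> Units A"
  proof (rule left_regular_unit [OF v(1)], rule ccontr)
    fix a assume a: "a \<in> carrier A" "v \<otimes> a = \<zero>" "a \<noteq> \<zero>"
    obtain m and N :: nat and e where T: "m \<in> {..<N} \<rightarrow> M" "e \<in> {..<N} \<rightarrow> carrier A"
      "(\<Oplus>k\<in>{..<N}. m k \<otimes> a \<otimes> e k) = \<one>"
      "\<forall>x\<in>carrier A. (\<Oplus>k\<in>{..<N}. m k \<otimes> x \<otimes> e k) \<in> M"
      using ex_rank_one_operator [OF a(1,3)] .
    have mc: "m k \<in> M" "m k \<in> carrier A" "e k \<in> carrier A" "s (m k) \<in> carrier A"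
      if "k \<in> {..<N}" for k using T(1,2) that M_carr sD(1) by auto
    have "v = v \<otimes> (\<Oplus>k\<in>{..<N}. m k \<otimes> a \<otimes> e k)" using T(3) v by simp
    also have "\<dots> = (\<Oplus>k\<in>{..<N}. v \<otimes> (m k \<otimes> a \<otimes> e k))"
      using mc v a by (intro finsum_rdistr) auto
    also have "\<dots> = (\<Oplus>k\<in>{..<N}. \<zero>)"
    proof (rule finsum_cong')
      fix k assume "k \<in> {..<N}"
      note k = mc [OF this]
      have "v \<otimes> (m k \<otimes> a \<otimes> e k) = v \<otimes> m k \<otimes> a \<otimes> e k" using k v a by (simp add: m_assoc)
      also have "\<dots> = s (m k) \<otimes> (v \<otimes> a) \<otimes> e k" using comm [OF k(1)] k v a(1) by (simp add: m_assoc)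
      finally show "v \<otimes> (m k \<otimes> a \<otimes> e k) = \<zero>" using a k by simp
    qed auto
    finally show False using v by simp
  qed
  moreover have "v \<otimes> m \<otimes> inv v = s m" if "m \<in> M" for m
    using comm [OF that] calculation sD(1) [OF that] M_carr v by (simp add: m_assoc)
  ultimately show ?thesis by blast
qed

subsection \<open>Skolem--Noether elements\<close>

lemma G_mult:
  assumes "s \<in> carrier G" "t \<in> carrier G"
  shows "s \<otimes>\<^bsub>G\<^esub> t = compose M s t"
proof -
  have "s \<in> Bij M" "t \<in> Bij M" using assms by (auto simp: aut_group_def)
  then have "s \<otimes>\<^bsub>BijGroup M\<^esub> t = compose M s t" by (simp add: BijGroup_def)
  then show ?thesis by (simp add: aut_group_def)
qed

lemma G_apply:
  assumes "s \<in> carrier G" "t \<in> carrier G" "m \<in> M"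
  shows "(s \<otimes>\<^bsub>G\<^esub> t) m = s (t m)"
  using G_mult [OF assms(1,2)] assms(3) by (simp add: compose_def)

lemma G_one: "\<one>\<^bsub>G\<^esub> = (\<lambda>m\<in>M. m)"
  by (simp add: aut_group_def BijGroup_def)

lemma G_eqI:
  assumes "s \<in> carrier G" "t \<in> carrier G" "\<And>m. m \<in> M \<Longrightarrow> s m = t m"
  shows "s = t"
  using extensionalityI [OF aut_groupD(7) [OF assms(1)] aut_groupD(7) [OF assms(2)]] assms(3) by blast

lemma one_G: "\<one>\<^bsub>G\<^esub> \<in> carrier G"
proof -
  have "(\<lambda>m\<in>M. m) \<in> ring_iso (A\<lparr>carrier := M\<rparr>) (A\<lparr>carrier := M\<rparr>)"
    using id_Bij [of M] M_cl by (intro ring_iso_memI) (auto simp: Bij_def)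
  moreover have "(\<lambda>m\<in>M. m) z = z" if "z \<in> F" for z using that FM by auto
  ultimately show ?thesis
        unfolding G_one using id_Bij [of M] by (simp add: aut_group_def)
qed

lemma group_G: "group G"
proof (rule groupI)
  fix s t assume s: "s \<in> carrier G" and t: "t \<in> carrier G"
  note sD = aut_groupD [OF s] and tD = aut_groupD [OF t]
  have b: "s \<in> Bij M" "t \<in> Bij M" using s t by (auto simp: aut_group_def)
  have "compose M s t \<in> ring_iso (A\<lparr>carrier := M\<rparr>) (A\<lparr>carrier := M\<rparr>)"
    using compose_Bij [OF b] sD tD M_cl
    by (intro ring_iso_memI) (auto simp: compose_def Bij_def)
  moreover have "compose M s t z = z" if "z \<in> F" for z
    using that sD(2) tD(2) FM by (auto simp: compose_def)
  ultimately show "s \<otimes>\<^bsub>G\<^esub> t \<in> carrier G"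
    unfolding G_mult [OF s t] using compose_Bij [OF b] by (simp add: aut_group_def)
next
  show "\<one>\<^bsub>G\<^esub> \<in> carrier G" by (rule one_G)
next
  fix s assume s: "s \<in> carrier G"
  have "\<one>\<^bsub>G\<^esub> \<otimes>\<^bsub>G\<^esub> s = compose M (\<lambda>m\<in>M. m) s"
    using G_mult [OF one_G s] by (simp add: G_one)
  also have "\<dots> = s"
    using aut_groupD(1) [OF s] aut_groupD(7) [OF s] by (auto simp: compose_def extensional_def fun_eq_iff)
  finally show "\<one>\<^bsub>G\<^esub> \<otimes>\<^bsub>G\<^esub> s = s" .
next
  fix s t u assume "s \<in> carrier G" "t \<in> carrier G" "u \<in> carrier G"
  then have "s \<in> carrier (BijGroup M)" "t \<in> carrier (BijGroup M)" "u \<in> carrier (BijGroup M)"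
    by (auto simp: aut_group_def BijGroup_def)
  then have "s \<otimes>\<^bsub>BijGroup M\<^esub> t \<otimes>\<^bsub>BijGroup M\<^esub> u = s \<otimes>\<^bsub>BijGroup M\<^esub> (t \<otimes>\<^bsub>BijGroup M\<^esub> u)"
    using monoid.m_assoc [OF group.is_monoid [OF group_BijGroup [of M]]] by blast
  then show "s \<otimes>\<^bsub>G\<^esub> t \<otimes>\<^bsub>G\<^esub> u = s \<otimes>\<^bsub>G\<^esub> (t \<otimes>\<^bsub>G\<^esub> u)" by (simp add: aut_group_def)
next
  fix s assume s: "s \<in> carrier G"
  obtain t where t: "t \<in> carrier G" "\<And>m. m \<in> M \<Longrightarrow> t (s m) = m"
    using aut_group_inverse [OF s] by metis
  have "t \<otimes>\<^bsub>G\<^esub> s = \<one>\<^bsub>G\<^esub>"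
    unfolding G_mult [OF t(1) s] G_one using t(2) by (auto simp: compose_def fun_eq_iff)
  then show "\<exists>t\<in>carrier G. t \<otimes>\<^bsub>G\<^esub> s = \<one>\<^bsub>G\<^esub>" using t(1) by blast
qed

sublocale G: group G by (rule group_G)

text \<open>\<open>y\<close> is a possible choice for the Skolem--Noether element of \<open>s\<close>.\<close>

definition induces :: "'a \<Rightarrow> ('a \<Rightarrow> 'a) \<Rightarrow> bool"
  where "induces y s \<longleftrightarrow> y \<in> Units A \<and> (\<forall>m\<in>M. y \<otimes> m = s m \<otimes> y)"

lemma inducesD:
  assumes "induces y s"
  shows "y \<in> Units A" "y \<in> carrier A" "m \<in> M \<Longrightarrow> y \<otimes> m = s m \<otimes> y"
    "inv y \<in> carrier A" "y \<otimes> inv y = \<one>" "inv y \<otimes> y = \<one>"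
  using assms unfolding induces_def by auto

abbreviation x where "x \<equiv> sn_elt A M"

lemma induces_x: assumes s: "s \<in> carrier G" shows "induces (x s) s"
proof -
  have "\<exists>y. y \<in> Units A \<and> (\<forall>m\<in>M. y \<otimes> m \<otimes> inv y = s m)" using skolem_noether [OF s] by blast
  then have *: "x s \<in> Units A \<and> (\<forall>m\<in>M. x s \<otimes> m \<otimes> inv (x s) = s m)"
    unfolding sn_elt_def by (rule someI_ex)
  have "x s \<otimes> m = s m \<otimes> x s" if m: "m \<in> M" for m
  proof -
    have "s m \<otimes> x s = x s \<otimes> m \<otimes> inv (x s) \<otimes> x s" using * m by simp
    also have "\<dots> = x s \<otimes> m"
      using * M_carr [OF m] Units_closed [of "x s"] Units_inv_closed [of "x s"] Units_l_inv [of "x s"]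
      by (simp add: m_assoc)
    finally show ?thesis by simp
  qed
  then show ?thesis using * by (simp add: induces_def)
qed

lemma induces_mult:
  assumes y: "induces y s" and z: "induces z t" and st: "s \<in> carrier G" "t \<in> carrier G"
  shows "induces (y \<otimes> z) (s \<otimes>\<^bsub>G\<^esub> t)"
  unfolding induces_def
proof (intro conjI ballI)
  show "y \<otimes> z \<in> Units A" using inducesD(1) [OF y] inducesD(1) [OF z] by simp
  fix m assume m: "m \<in> M"
  have mc: "t m \<in> M" "m \<in> carrier A" "t m \<in> carrier A" "s (t m) \<in> carrier A"
    using m aut_groupD(1) st M_carr by auto
  have "y \<otimes> z \<otimes> m = y \<otimes> (t m \<otimes> z)"
    using inducesD(3) [OF z m] inducesD(2) [OF y] inducesD(2) [OF z] mc by (simp add: m_assoc)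
  also have "\<dots> = s (t m) \<otimes> y \<otimes> z"
    using inducesD(3) [OF y mc(1)] inducesD(2) [OF y] inducesD(2) [OF z] mc by (simp flip: m_assoc)
  finally show "y \<otimes> z \<otimes> m = (s \<otimes>\<^bsub>G\<^esub> t) m \<otimes> (y \<otimes> z)"
    using G_apply [OF st m] inducesD(2) [OF y] inducesD(2) [OF z] mc by (simp add: m_assoc)
qed

lemma induces_inv:
  assumes y: "induces y s" and s: "s \<in> carrier G"
  shows "induces (inv y) (inv\<^bsub>G\<^esub> s)"
  unfolding induces_def
proof (intro conjI ballI)
  note yD = inducesD [OF y]
  show "inv y \<in> Units A" using yD(1) by simp
  fix m assume m: "m \<in> M"
  define k where "k = (inv\<^bsub>G\<^esub> s) m"
  have k: "k \<in> M" "k \<in> carrier A" using aut_groupD(1) [OF G.inv_closed [OF s] m] M_carr by (auto simp: k_def)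
  have "s k = m" unfolding k_def
    using G_apply [OF s G.inv_closed [OF s] m] s m by (simp add: G_one)
  then have "inv y \<otimes> m = inv y \<otimes> (s k \<otimes> (y \<otimes> inv y))" using yD M_carr m by simp
  also have "\<dots> = inv y \<otimes> (s k \<otimes> y) \<otimes> inv y"
    using yD k aut_groupD(1) [OF s k(1)] M_carr by (simp add: m_assoc)
  also have "\<dots> = inv y \<otimes> (y \<otimes> k) \<otimes> inv y" using yD(3) [OF k(1)] by simp
  also have "\<dots> = k \<otimes> inv y" using yD(2,4,6) k by (simp flip: m_assoc)
  finally show "inv y \<otimes> m = (inv\<^bsub>G\<^esub> s) m \<otimes> inv y" by (simp add: k_def)
qed

lemma induces_unit:
  assumes "u \<in> M" "u \<noteq> \<zero>"
  shows "induces u \<one>\<^bsub>G\<^esub>"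
  using M_unit(1) [OF assms] M_comm [OF assms(1)] by (auto simp: induces_def G_one)

text \<open>Inducing the identity means commuting with \<open>M\<close>, and \<open>M\<close> is its
  own centralizer.\<close>

lemma induces_one_mem:
  assumes "induces y \<one>\<^bsub>G\<^esub>"
  shows "y \<in> M" "y \<noteq> \<zero>"
proof -
  note D = inducesD [OF assms]
  show "y \<in> M" by (rule centralizer_M [OF D(2)]) (use D(3) in \<open>auto simp: G_one\<close>)
  show "y \<noteq> \<zero>" using D(4,5) one_not_zero by auto
qed

lemma induces_scale:
  assumes "u \<in> M" "u \<noteq> \<zero>" "induces y s" "s \<in> carrier G"
  shows "induces (u \<otimes> y) s"
  using induces_mult [OF induces_unit [OF assms(1,2)] assms(3) _ assms(4)] assms(4) by simp

text \<open>The quotient of two elements that induce \<open>s\<close> induces the identity. This is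
  the uniqueness of Skolem--Noether elements up to units of \<open>M\<close>.\<close>

lemma induces_unique:
  assumes y: "induces y s" and z: "induces z s" and s: "s \<in> carrier G"
  obtains u where "u \<in> M" "u \<noteq> \<zero>" "y = u \<otimes> z"
proof -
  have "induces (y \<otimes> inv z) \<one>\<^bsub>G\<^esub>"
    using induces_mult [OF y induces_inv [OF z s] s] s by simp
  note u = induces_one_mem [OF this]
  have "y = y \<otimes> inv z \<otimes> z" using inducesD [OF y] inducesD [OF z] by (simp add: m_assoc)
  then show ?thesis using that u by blast
qed

lemma induces_pow:
  assumes "induces y s" "s \<in> carrier G"
  shows "induces (y [^] (k::nat)) (s [^]\<^bsub>G\<^esub> k)"
proof (induction k)
  case 0
  show ?case using induces_unit [OF M_cl(3) one_not_zero] by simp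
next
  case (Suc k)
  show ?case using induces_mult [OF Suc assms(1) _ assms(2)] assms(2) by simp
qed

text \<open>Passing from \<open>y\<close> to \<open>y a - s(a) y\<close> kills the \<open>s\<close>-component of \<open>y\<close>.\<close>

lemma bimodule_component:
  assumes "finite S" "S \<subseteq> carrier G" "c \<in> S \<rightarrow> M" and y: "\<And>s. s \<in> S \<Longrightarrow> induces (y s) s"
    and diff: "\<And>a b. a \<in> I \<Longrightarrow> b \<in> I \<Longrightarrow> a \<ominus> b \<in> I"
    and lmul: "\<And>m a. m \<in> M \<Longrightarrow> a \<in> I \<Longrightarrow> m \<otimes> a \<in> I"
    and rmul: "\<And>m a. m \<in> M \<Longrightarrow> a \<in> I \<Longrightarrow> a \<otimes> m \<in> I"
    and mem: "(\<Oplus>s\<in>S. c s \<otimes> y s) \<in> I" and t: "t \<in> S"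
  shows "c t \<otimes> y t \<in> I"
  using assms(1-3) y mem t
proof (induction "card S" arbitrary: S c)
  case (Suc k)
  have c: "c s \<in> M" "c s \<in> carrier A" and yc: "y s \<in> carrier A" and sG: "s \<in> carrier G"
    if "s \<in> S" for s
    using that Suc.prems(2,3) M_carr inducesD(2) [OF Suc.prems(4) [OF that]] by auto
  show ?case
  proof (cases "S = {t}")
    case True
    then show ?thesis using Suc.prems(5) c yc by (simp add: finsum_insert)
  next
    case False
    then obtain s where s: "s \<in> S" "s \<noteq> t" using Suc.prems(6) by blast
    obtain a where a: "a \<in> M" "s a \<noteq> t a"
      using G_eqI [OF sG [OF s(1)] sG [OF Suc.prems(6)]] s(2) by blast
    have sa: "r a \<in> M" "r a \<in> carrier A" if "r \<in> S" for r
      using aut_groupD(1) [OF sG [OF that] a(1)] M_carr by auto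
    define d where "d = (\<lambda>r. c r \<otimes> (r a \<ominus> s a))"
    have d: "d r \<in> M" "d r \<in> carrier A" if "r \<in> S" for r
      using that c sa s M_cl(6) M_minus M_carr by (auto simp: d_def)
    let ?y = "\<Oplus>r\<in>S. c r \<otimes> y r"
    have "?y \<otimes> a \<ominus> s a \<otimes> ?y = (\<Oplus>r\<in>S. c r \<otimes> y r \<otimes> a) \<ominus> (\<Oplus>r\<in>S. s a \<otimes> (c r \<otimes> y r))"
      using c yc sa s a M_carr Suc.prems(1) by (simp add: finsum_ldistr finsum_rdistr Pi_def)
    also have "\<dots> = (\<Oplus>r\<in>S. c r \<otimes> y r \<otimes> a \<ominus> s a \<otimes> (c r \<otimes> y r))"
      using c yc sa s a M_carr by (intro finsum_diff [symmetric]) auto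
    also have "\<dots> = (\<Oplus>r\<in>S. d r \<otimes> y r)"
    proof (rule finsum_cong')
      fix r assume r: "r \<in> S"
      have "c r \<otimes> y r \<otimes> a = c r \<otimes> r a \<otimes> y r"
        using inducesD(3) [OF Suc.prems(4) [OF r] a(1)] c yc sa r a M_carr by (simp add: m_assoc)
      moreover have "s a \<otimes> (c r \<otimes> y r) = c r \<otimes> s a \<otimes> y r"
        using M_comm [OF sa(1) [OF s(1)] c(1) [OF r]] c yc sa r s by (simp flip: m_assoc)
      ultimately show "c r \<otimes> y r \<otimes> a \<ominus> s a \<otimes> (c r \<otimes> y r) = d r \<otimes> y r"
        using c yc sa r s by (simp add: d_def a_minus_def l_distr r_distr l_minus r_minus)
    qed (use d yc in auto)
    also have "\<dots> = (\<Oplus>r\<in>S - {s}. d r \<otimes> y r)"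
    proof (rule add.finprod_mono_neutral_cong_right)
      show "d r \<otimes> y r = \<zero>" if "r \<in> S - (S - {s})" for r
        using that s c sa yc by (simp add: d_def r_neg a_minus_def)
    qed (use Suc.prems(1) d yc in auto)
    finally have "(\<Oplus>r\<in>S - {s}. d r \<otimes> y r) \<in> I"
      using diff [OF rmul [OF a(1) Suc.prems(5)] lmul [OF sa(1) [OF s(1)] Suc.prems(5)]] by simp
    moreover have "k = card (S - {s})" using Suc.hyps(2) s Suc.prems(1) by simp
    ultimately have "d t \<otimes> y t \<in> I"
      using Suc.prems d s by (intro Suc.hyps(1) [of "S - {s}" d]) auto
    \<comment> \<open>By the choice of \<open>a\<close>, the factor that the component at
      \<open>t\<close> has gained is a nonzero element of \<open>M\<close>, so it can be divided out
      within the bimodule.\<close>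
    moreover define e where "e = t a \<ominus> s a"
    have e: "e \<in> M" "e \<noteq> \<zero>" using sa s Suc.prems(6) M_minus a(2) by (auto simp: e_def)
    note ei = M_unit [OF e]
    have "d t \<otimes> y t = e \<otimes> (c t \<otimes> y t)"
      using M_comm [OF c(1) [OF Suc.prems(6)] e(1)] c(2) [OF Suc.prems(6)] yc [OF Suc.prems(6)] e M_carr
      by (simp add: d_def e_def [symmetric] m_assoc)
    ultimately have "inv e \<otimes> (e \<otimes> (c t \<otimes> y t)) \<in> I" using lmul ei(2) by simp
    then show ?thesis using ei c yc Suc.prems(6) e M_carr by (simp flip: m_assoc)
  qed
qed simp

text \<open>Each component of \<open>\<zero>\<close> lies in the zero bimodule, and
  \<open>y t\<close> is a unit. The elements are arbitrary rather than the chosen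
  \<open>x s\<close>, so that products such as \<open>x k \<otimes> y [^] j\<close> are
  covered.\<close>

lemma induces_indep:
  assumes "finite S" "S \<subseteq> carrier G" "\<And>s. s \<in> S \<Longrightarrow> induces (y s) s"
  shows "fam_indep M S y"
  unfolding fam_indep_def
proof (intro ballI impI)
  fix c t assume c: "c \<in> S \<rightarrow> M" "(\<Oplus>s\<in>S. c s \<otimes> y s) = \<zero>" and t: "t \<in> S"
  have "c t \<otimes> y t \<in> {\<zero>}"
    using c(2) M_carr by (intro bimodule_component [OF assms(1,2) c(1) assms(3) _ _ _ _ t])
      (auto simp: a_minus_def)
  moreover have "c t = c t \<otimes> y t \<otimes> inv (y t)"
    using c(1) t M_carr inducesD [OF assms(3) [OF t]] by (auto simp: m_assoc Pi_iff)
  ultimately show "c t = \<zero>" using inducesD(4) [OF assms(3) [OF t]] by auto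
qed

text \<open>Distinct automorphisms yield independent elements of \<open>A\<close>, which has
  dimension \<open>n\<close> over \<open>M\<close>. So there are at most \<open>n\<close> of
  them.\<close>

lemma finite_G: "finite (carrier G)"
proof (rule ccontr)
  assume "infinite (carrier G)"
  then obtain S where S: "S \<subseteq> carrier G" "finite S" "card S = Suc n"
    using infinite_arbitrarily_large by blast
  have "fam_indep M S x" using induces_indep [OF S(2,1)] induces_x S(1) by blast
  moreover have "x \<in> S \<rightarrow> carrier A" using inducesD(2) [OF induces_x] S(1) by auto
  ultimately have "card S \<le> n" using fam_indep_card_le [OF M S(2) _ _ dim_M] by blast
  then show False using S(3) by simp
qed

end

subsection \<open>Crossed products inside the algebra\<close>

text \<open>Dimension is built up by line extensions, and these are formed with the same operations
  in the subring. What has to be checked is that the whole tower lies in \<open>B\<close>.\<close>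

lemma (in ring) dimension_subring:
  assumes B: "subring B R" and "dimension k K E" "subfield K R" "K \<subseteq> B" "E \<subseteq> B"
  shows "ring.dimension (R\<lparr>carrier := B\<rparr>) k K E"
  using assms(2-)
proof (induction k K E rule: dimension.induct)
  case (zero_dim K)
  then show ?case using ring.zero_dim [OF subring_is_ring [OF B], of K] by simp
next
  case (Suc_dim v E k K)
  note sub = space_subgroup_props [OF Suc_dim.prems(1) Suc_dim.hyps(3)]
  note Kc = subringE [OF subfieldE(1) [OF Suc_dim.prems(1)]]
  \<comment> \<open>The vector \<open>v\<close> and the smaller space are both contained in the line
    extension, hence in \<open>B\<close>.\<close>
  have "v = \<one> \<otimes> v \<oplus> \<zero>" using Suc_dim.hyps(1) by simp
  then have "v \<in> line_extension K v E" unfolding line_extension_mem_iff using Kc(3) sub(2) by blast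
  then have v: "v \<in> carrier (R\<lparr>carrier := B\<rparr>)" using Suc_dim.prems(3) by auto
  have "E \<subseteq> line_extension K v E"
  proof
    fix e assume e: "e \<in> E"
    then have "e = \<zero> \<otimes> v \<oplus> e" using Suc_dim.hyps(1) sub(1) by auto
    then show "e \<in> line_extension K v E" unfolding line_extension_mem_iff using Kc(2) e by blast
  qed
  then have "ring.dimension (R\<lparr>carrier := B\<rparr>) k K E" using Suc_dim.IH Suc_dim.prems by blast
  from ring.Suc_dim [OF subring_is_ring [OF B] v Suc_dim.hyps(2) this]
  show ?case unfolding line_extension_consistent [OF B] .
qed

lemma (in ring) subfield_subring:
  assumes "subring B R" "subfield K R" "K \<subseteq> B"
  shows "subfield K (R\<lparr>carrier := B\<rparr>)"
  using ring.subfield_iff(1) [OF subring_is_ring [OF assms(1)], of K] subfield_iff(2) [OF assms(2)] assms(3)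
  by simp

context algebra_with_maximal_subfield begin

section \<open>The ring \<open>M(H)\<close> of a subgroup \<open>H\<close>\<close>

lemma sn_span_eq_fam_span: "sn_span A M H = fam_span M H x"
  unfolding sn_span_def fam_span_def ..

context
  fixes H assumes H: "subgroup H G"
begin

abbreviation B where "B \<equiv> sn_span A M H"

lemma H_in_G: "s \<in> H \<Longrightarrow> s \<in> carrier G" using subgroup.subset [OF H] by blast
lemma finite_H: "finite H" using finite_subset [OF subgroup.subset [OF H] finite_G] .
lemma x_closed: "s \<in> H \<Longrightarrow> x s \<in> carrier A" using inducesD(2) [OF induces_x [OF H_in_G]] .
lemma one_H: "\<one>\<^bsub>G\<^esub> \<in> H" using subgroup.one_closed [OF H] .

lemma x_Pi: "x \<in> H \<rightarrow> carrier A" using x_closed by auto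

lemma x_indep: "fam_indep M H x"
  using induces_indep [OF finite_H subgroup.subset [OF H]] induces_x H_in_G by blast

lemma B_dim: "dimension (card H) M B"
  unfolding sn_span_eq_fam_span by (rule dimension_fam_span [OF M finite_H x_Pi x_indep])

lemmas B_space = fam_span_subspace [OF M finite_H x_Pi, folded sn_span_eq_fam_span]

lemma B_closed: "b \<in> B \<Longrightarrow> b \<in> carrier A" using B_space(1) by blast

text \<open>Up to a factor in \<open>M\<close>, the element \<open>y\<close> is the chosen
  \<open>x s\<close>. Thus products, powers and inverses of chosen elements lie in
  \<open>M(H)\<close> without being chosen elements themselves.\<close>

lemma B_induces: "s \<in> H \<Longrightarrow> induces y s \<Longrightarrow> y \<in> B"
  using induces_unique [OF _ induces_x [OF H_in_G] H_in_G] B_space(5,6) by metis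

lemma M_subset_B: "M \<subseteq> B"
proof
  fix m assume m: "m \<in> M"
  show "m \<in> B"
  proof (cases "m = \<zero>")
    case False
    then show ?thesis using B_induces [OF one_H induces_unit [OF m]] by blast
  qed (use B_space(2) in simp)
qed

text \<open>An induction principle: a condition on elements of \<open>M(H)\<close> that is stable
  under sums need only be checked on \<open>\<zero>\<close> and the monomials
  \<open>m \<otimes> x s\<close>.\<close>

lemma B_least:
  assumes "\<zero> \<in> E" "\<And>a b. a \<in> E \<Longrightarrow> b \<in> E \<Longrightarrow> a \<oplus> b \<in> E" "E \<subseteq> carrier A"
    "\<And>m s. m \<in> M \<Longrightarrow> s \<in> H \<Longrightarrow> m \<otimes> x s \<in> E"
  shows "B \<subseteq> E"
proof
  fix b assume "b \<in> B"
  then obtain c where c: "c \<in> H \<rightarrow> M" "b = (\<Oplus>s\<in>H. c s \<otimes> x s)"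
    unfolding sn_span_eq_fam_span by (rule fam_spanE [OF refl])
  show "b \<in> E" unfolding c(2)
    by (rule finsum_closed_in [OF assms(1-3)]) (use c(1) assms(4) in auto)
qed

text \<open>The rule \<open>(m x\<^sub>s) (m' x\<^sub>t) = m s(m') x\<^sub>s x\<^sub>t\<close>
  reduces the claim to \<open>x\<^sub>s x\<^sub>t\<close>, which induces \<open>s t\<close>.
  \<open>B_least\<close> is applied once in each factor.\<close>

lemma B_mult:
  assumes "a \<in> B" "b \<in> B"
  shows "a \<otimes> b \<in> B"
proof -
  have 1: "B \<subseteq> {b \<in> carrier A. (m \<otimes> x s) \<otimes> b \<in> B}" if m: "m \<in> M" and s: "s \<in> H" for m s
  proof (rule B_least)
    have mx: "m \<otimes> x s \<in> carrier A" using M_carr [OF m] x_closed [OF s] by simp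
    show "\<zero> \<in> {b \<in> carrier A. (m \<otimes> x s) \<otimes> b \<in> B}" using mx B_space(2) by simp
    show "b \<oplus> b' \<in> {b \<in> carrier A. (m \<otimes> x s) \<otimes> b \<in> B}"
      if "b \<in> {b \<in> carrier A. (m \<otimes> x s) \<otimes> b \<in> B}" "b' \<in> {b \<in> carrier A. (m \<otimes> x s) \<otimes> b \<in> B}" for b b'
      using that mx B_space(3) by (simp add: r_distr)
    fix m' t assume m': "m' \<in> M" and t: "t \<in> H"
    have c: "s m' \<in> M" "s m' \<in> carrier A" "m' \<in> carrier A" "m \<in> carrier A" "x s \<in> carrier A" "x t \<in> carrier A"
      using aut_groupD(1) [OF H_in_G [OF s] m'] m m' s t M_carr x_closed by auto
    have "x s \<otimes> x t \<in> B"
      using B_induces [OF subgroup.m_closed [OF H s t]]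
        induces_mult [OF induces_x [OF H_in_G [OF s]] induces_x [OF H_in_G [OF t]] H_in_G [OF s] H_in_G [OF t]] by blast
    then have "m \<otimes> s m' \<otimes> (x s \<otimes> x t) \<in> B" using B_space(5) M_cl(6) [OF m c(1)] by blast
    also have "m \<otimes> s m' \<otimes> (x s \<otimes> x t) = m \<otimes> (s m' \<otimes> x s) \<otimes> x t" using c by (simp add: m_assoc)
    also have "\<dots> = m \<otimes> (x s \<otimes> m') \<otimes> x t" using inducesD(3) [OF induces_x [OF H_in_G [OF s]] m'] by simp
    also have "\<dots> = (m \<otimes> x s) \<otimes> (m' \<otimes> x t)" using c by (simp add: m_assoc)
    finally show "m' \<otimes> x t \<in> {b \<in> carrier A. (m \<otimes> x s) \<otimes> b \<in> B}" using c by simp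
  qed auto
  have "B \<subseteq> {a \<in> carrier A. \<forall>b\<in>B. a \<otimes> b \<in> B}"
  proof (rule B_least)
    show "\<zero> \<in> {a \<in> carrier A. \<forall>b\<in>B. a \<otimes> b \<in> B}" using B_closed B_space(2) by simp
    show "a \<oplus> a' \<in> {a \<in> carrier A. \<forall>b\<in>B. a \<otimes> b \<in> B}"
      if "a \<in> {a \<in> carrier A. \<forall>b\<in>B. a \<otimes> b \<in> B}" "a' \<in> {a \<in> carrier A. \<forall>b\<in>B. a \<otimes> b \<in> B}" for a a'
      using that B_closed B_space(3) by (simp add: l_distr)
    show "m \<otimes> x s \<in> {a \<in> carrier A. \<forall>b\<in>B. a \<otimes> b \<in> B}" if "m \<in> M" "s \<in> H" for m s
      using 1 [OF that] M_carr [OF that(1)] x_closed [OF that(2)] by auto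
  qed auto
  then show ?thesis using assms by blast
qed

lemma B_subring: "subring B A"
  using B_space(1,3,4) M_subset_B M_cl(3) B_mult by (intro subringI) auto

text \<open>Otherwise \<open>y\<close> would depend on the \<open>x r\<close> with
  \<open>r \<in> H\<close>, although all these elements induce distinct automorphisms. This yields
  both the strict inclusions in the chain and the lower bound for the inner order.\<close>

lemma B_not_induces:
  assumes s: "s \<in> carrier G" "s \<notin> H" and y: "induces y s"
  shows "y \<notin> B"
proof
  assume "y \<in> B"
  then obtain c where c: "c \<in> H \<rightarrow> M" "y = (\<Oplus>r\<in>H. c r \<otimes> x r)"
    unfolding sn_span_eq_fam_span by (rule fam_spanE [OF refl])
  define z where "z = x(s := y)"
  \<comment> \<open>The expansion of \<open>y\<close>, read as a relation in which \<open>y\<close>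
    itself has the coefficient \<open>-1\<close>.\<close>
  define d where "d = c(s := \<ominus> \<one>)"
  have z: "induces (z r) r" if "r \<in> insert s H" for r
    using that y induces_x H_in_G by (auto simp: z_def)
  have zc: "z r \<in> carrier A" if "r \<in> insert s H" for r using inducesD(2) [OF z [OF that]] .
  have ind: "fam_indep M (insert s H) z"
    by (rule induces_indep) (use z finite_H s H_in_G in auto)
  have d: "d \<in> insert s H \<rightarrow> M" using c(1) M_cl(3,5) by (auto simp: d_def)
  have yc: "y \<in> carrier A" using inducesD(2) [OF y] .
  have cc: "c r \<in> carrier A" if "r \<in> H" for r using c(1) that M_carr by auto
  have "(\<Oplus>r\<in>insert s H. d r \<otimes> z r) = d s \<otimes> z s \<oplus> (\<Oplus>r\<in>H. d r \<otimes> z r)"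
    using finite_H s d zc M_carr by (intro finsum_insert) (auto simp: Pi_iff)
  also have "(\<Oplus>r\<in>H. d r \<otimes> z r) = y"
    unfolding c(2) using s(2) cc x_closed by (intro finsum_cong') (auto simp: d_def z_def)
  also have "d s \<otimes> z s \<oplus> y = \<zero>" using yc by (simp add: d_def z_def l_minus l_neg)
  finally have "d s = \<zero>" using ind d unfolding fam_indep_def by blast
  then have "\<ominus> \<one> = \<zero>" by (simp add: d_def)
  then show False using one_not_zero by (metis minus_minus minus_zero one_closed)
qed

abbreviation Z where "Z \<equiv> fixed_set M H"

lemma Z_iff: "z \<in> Z \<longleftrightarrow> z \<in> M \<and> (\<forall>s\<in>H. s z = z)" by (simp add: fixed_set_def)

text \<open>A central element commutes with \<open>M\<close>, hence lies in \<open>M\<close>; and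
  \<open>x s \<otimes> z = s z \<otimes> x s\<close> shows that it commutes with \<open>x s\<close>
  exactly when \<open>s\<close> fixes it.\<close>

lemma center_B: "ring_center (A\<lparr>carrier := B\<rparr>) = Z"
proof (intro equalityI subsetI)
  fix z assume "z \<in> ring_center (A\<lparr>carrier := B\<rparr>)"
  then have z: "z \<in> B" "\<And>b. b \<in> B \<Longrightarrow> z \<otimes> b = b \<otimes> z" by (auto simp: ring_center_def)
  have zM: "z \<in> M" using centralizer_M [OF B_closed [OF z(1)]] z(2) M_subset_B by blast
  have "s z = z" if s: "s \<in> H" for s
  proof -
    note D = inducesD [OF induces_x [OF H_in_G [OF s]]]
    have sz: "s z \<in> carrier A" "z \<in> carrier A" using aut_groupD(1) [OF H_in_G [OF s] zM] zM M_carr by auto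
    have "s z = s z \<otimes> x s \<otimes> inv (x s)" using D sz by (simp add: m_assoc)
    also have "s z \<otimes> x s = z \<otimes> x s" using D(3) [OF zM] z(2) [OF B_space(6) [OF s]] by simp
    also have "z \<otimes> x s \<otimes> inv (x s) = z" using D sz by (simp add: m_assoc)
    finally show ?thesis .
  qed
  then show "z \<in> Z" using zM by (simp add: Z_iff)
next
  fix z assume z: "z \<in> Z"
  have zc: "z \<in> M" "z \<in> carrier A" using z M_carr by (auto simp: Z_iff)
  have "B \<subseteq> {b \<in> carrier A. z \<otimes> b = b \<otimes> z}"
  proof (rule B_least)
    fix m s assume m: "m \<in> M" and s: "s \<in> H"
    have c: "m \<in> carrier A" "x s \<in> carrier A" using M_carr m x_closed s by auto
    have sz: "s z = z" using z s by (simp add: Z_iff)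
    have "m \<otimes> x s \<otimes> z = m \<otimes> (z \<otimes> x s)"
      using inducesD(3) [OF induces_x [OF H_in_G [OF s]] zc(1)] sz c zc by (simp add: m_assoc)
    also have "\<dots> = z \<otimes> (m \<otimes> x s)" using M_comm [OF m zc(1)] c zc by (simp flip: m_assoc)
    finally show "m \<otimes> x s \<in> {b \<in> carrier A. z \<otimes> b = b \<otimes> z}" using c by simp
  qed (use zc in \<open>auto simp: l_distr r_distr\<close>)
  then show "z \<in> ring_center (A\<lparr>carrier := B\<rparr>)" using zc M_subset_B by (auto simp: ring_center_def)
qed

lemma B_inv: "s \<in> H \<Longrightarrow> induces y s \<Longrightarrow> inv y \<in> B"
  using B_induces [OF subgroup.m_inv_closed [OF H]] induces_inv H_in_G by blast

lemma simple_B: "simple_ring (A\<lparr>carrier := B\<rparr>)"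
  unfolding simple_ring_def
proof (intro conjI allI impI)
  let ?S = "A\<lparr>carrier := B\<rparr>"
  show "ring ?S" using subring_is_ring [OF B_subring] .
  have one: "\<one> \<in> B" using M_cl(3) M_subset_B by blast
  then show "carrier ?S \<noteq> {\<zero>\<^bsub>?S\<^esub>}" using one_not_zero by auto
  fix I assume I: "ideal I ?S"
  have I0: "\<zero> \<in> I" using additive_subgroup.zero_closed [OF ideal.axioms(1) [OF I]] by simp
  have IB: "I \<subseteq> B" using additive_subgroup.a_subset [OF ideal.axioms(1) [OF I]] by simp
  have Iadd: "a \<oplus> b \<in> I" if "a \<in> I" "b \<in> I" for a b
    using additive_subgroup.a_closed [OF ideal.axioms(1) [OF I]] that by simp
  have Imul: "b \<otimes> a \<in> I" "a \<otimes> b \<in> I" if "a \<in> I" "b \<in> B" for a b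
    using ideal.I_l_closed [OF I, of a b] ideal.I_r_closed [OF I, of a b] that by auto
  have mone: "\<ominus> \<one> \<in> B" using B_space(4) one by blast
  have "I = carrier ?S" if ne: "I \<noteq> {\<zero>}"
  proof -
    obtain a where a: "a \<in> I" "a \<noteq> \<zero>" using ne I0 by blast
    then have "a \<in> B" using IB by blast
    then obtain c where c: "c \<in> H \<rightarrow> M" "a = (\<Oplus>s\<in>H. c s \<otimes> x s)"
      unfolding sn_span_eq_fam_span by (rule fam_spanE [OF refl])
    have "\<exists>t\<in>H. c t \<noteq> \<zero>"
    proof (rule ccontr)
      assume "\<not> ?thesis"
      then have "a = (\<Oplus>s\<in>H. \<zero>)" unfolding c(2) using x_closed by (intro finsum_cong') auto
      then show False using a(2) by simp
    qed
    then obtain t where t: "t \<in> H" "c t \<noteq> \<zero>" by blast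
    have ct: "c t \<in> M" using c(1) t by auto
    have "c t \<otimes> x t \<in> I"
    proof (rule bimodule_component [OF finite_H subgroup.subset [OF H] c(1)])
      show "(\<Oplus>s\<in>H. c s \<otimes> x s) \<in> I" using a(1) c(2) by simp
      show "a \<ominus> b \<in> I" if "a \<in> I" "b \<in> I" for a b
      proof -
        have "a \<ominus> b = a \<oplus> \<ominus> \<one> \<otimes> b" using that IB B_closed by (auto simp: a_minus_def l_minus)
        then show ?thesis using Iadd Imul(1) mone that by simp
      qed
    qed (use t induces_x H_in_G Imul M_subset_B in auto)
    \<comment> \<open>A nonzero component is itself a possible choice for \<open>t\<close>, so its
      inverse belongs to \<open>M(H)\<close>. This puts \<open>\<one>\<close> into the
      ideal.\<close>
    moreover have "induces (c t \<otimes> x t) t" using induces_scale [OF ct t(2) induces_x] H_in_G t(1) by blast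
    ultimately have "inv (c t \<otimes> x t) \<otimes> (c t \<otimes> x t) \<in> I"
      using Imul(1) B_inv [OF t(1)] by blast
    then have "\<one>\<^bsub>?S\<^esub> \<in> I" using inducesD(6) [OF \<open>induces (c t \<otimes> x t) t\<close>] by simp
    then show ?thesis by (rule ideal.one_imp_carrier [OF I])
  qed
  then show "I = {\<zero>\<^bsub>?S\<^esub>} \<or> I = carrier ?S" by auto
qed

section \<open>The fixed field of \<open>H\<close> and the degree of \<open>M\<close> over
  it\<close>

lemma F_subset_Z: "F \<subseteq> Z"
  using FM aut_groupD(2) H_in_G by (auto simp: Z_iff)

lemma Z_subfield: "subfield Z A"
proof -
  have inv_Z: "inv z \<in> Z" "z \<otimes> inv z = \<one>" "inv z \<otimes> z = \<one>" if z: "z \<in> Z" "z \<noteq> \<zero>" for z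
  proof -
    have zM: "z \<in> M" "z \<in> carrier A" using z M_carr by (auto simp: Z_iff)
    note u = M_unit [OF zM(1) z(2)]
    show "z \<otimes> inv z = \<one>" "inv z \<otimes> z = \<one>" using u by auto
    have "s (inv z) = inv z" if s: "s \<in> H" for s
    proof -
      note D = aut_groupD [OF H_in_G [OF s]]
      have sz: "s z = z" using z s by (simp add: Z_iff)
      have "s (inv z) \<otimes> z = s (inv z \<otimes> z)" using D(4) [OF u(2) zM(1)] sz by simp
      then have "s (inv z) \<otimes> z \<otimes> inv z = inv z" using u D(3) M_carr by simp
      then show ?thesis using u D(1) [OF u(2)] M_carr zM by (simp add: m_assoc)
    qed
    then show "inv z \<in> Z" using u by (simp add: Z_iff)
  qed
  have Z_M: "z \<in> M" if "z \<in> Z" for z using that by (simp add: Z_iff)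
  have Z_fix: "s z = z" if "z \<in> Z" "s \<in> H" for z s using that by (simp add: Z_iff)
  have Zc: "Z \<subseteq> carrier A" using M_carr by (auto simp: Z_iff)
  have s_minus: "s (\<ominus> m) = \<ominus> s m" if "s \<in> H" "m \<in> M" for s m
  proof -
    note D = aut_groupD [OF H_in_G [OF that(1)]]
    have "s (\<ominus> m) \<oplus> s m = s (\<ominus> m \<oplus> m)" using D(5) that M_cl(5) by simp
    also have "\<dots> = \<zero>" using D(8) M_carr that by (simp add: l_neg)
    finally show ?thesis using D(1) M_cl(5) that M_carr by (intro minus_equality [symmetric]) auto
  qed
  have "subcring Z A"
  proof (rule subcringI [OF subringI])
    show "Z \<subseteq> carrier A" by (rule Zc)
    show "\<one> \<in> Z" using M_cl(3) aut_groupD(3) H_in_G by (auto simp: Z_iff)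
    show "\<ominus> h \<in> Z" if "h \<in> Z" for h
    proof -
      have h: "h \<in> M" "\<forall>s\<in>H. s h = h" using that by (auto simp: Z_iff)
      have "s (\<ominus> h) = \<ominus> h" if "s \<in> H" for s using s_minus [OF that h(1)] bspec [OF h(2) that] by simp
      then show ?thesis using M_cl(5) [OF h(1)] by (simp add: Z_iff)
    qed
    show "h \<otimes> k \<in> Z" if hk: "h \<in> Z" "k \<in> Z" for h k
    proof -
      have "s (h \<otimes> k) = h \<otimes> k" if "s \<in> H" for s
        using aut_groupD(4) [OF H_in_G [OF that] Z_M [OF hk(1)] Z_M [OF hk(2)]] Z_fix [OF _ that] hk by simp
      then show ?thesis using M_cl(6) [OF Z_M [OF hk(1)] Z_M [OF hk(2)]] by (simp add: Z_iff)
    qed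
    show "h \<oplus> k \<in> Z" if hk: "h \<in> Z" "k \<in> Z" for h k
    proof -
      have "s (h \<oplus> k) = h \<oplus> k" if "s \<in> H" for s
        using aut_groupD(5) [OF H_in_G [OF that] Z_M [OF hk(1)] Z_M [OF hk(2)]] Z_fix [OF _ that] hk by simp
      then show ?thesis using M_cl(7) [OF Z_M [OF hk(1)] Z_M [OF hk(2)]] by (simp add: Z_iff)
    qed
    show "h \<otimes> k = k \<otimes> h" if "h \<in> Z" "k \<in> Z" for h k
      using that M_comm by (auto simp: Z_iff)
  qed
  moreover have "Units (A\<lparr>carrier := Z\<rparr>) = Z - {\<zero>}"
  proof (intro equalityI subsetI)
    fix z assume "z \<in> Units (A\<lparr>carrier := Z\<rparr>)"
    then show "z \<in> Z - {\<zero>}" using one_not_zero Zc by (auto simp: Units_def subset_iff)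
  next
    fix z assume "z \<in> Z - {\<zero>}"
    then show "z \<in> Units (A\<lparr>carrier := Z\<rparr>)" using inv_Z [of z] by (auto simp: Units_def)
  qed
  ultimately show ?thesis by (rule subfieldI)
qed

lemma dim_Z_finite: obtains m where "dimension m Z M"
proof (rule dimension_over_larger_subfield [OF F Z_subfield F_subset_Z dim_M_F])
  show "\<forall>k\<in>Z. \<forall>e\<in>M. k \<otimes> e \<in> M" using M_cl(6) by (auto simp: Z_iff)
qed

definition Tr where "Tr a = (\<Oplus>s\<in>H. s a)"

lemma H_image: "t \<in> H \<Longrightarrow> (\<lambda>s. t \<otimes>\<^bsub>G\<^esub> s) ` H = H" "t \<in> H \<Longrightarrow> inj_on (\<lambda>s. t \<otimes>\<^bsub>G\<^esub> s) H"
proof -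
  assume t: "t \<in> H"
  show inj: "inj_on (\<lambda>s. t \<otimes>\<^bsub>G\<^esub> s) H" using H_in_G t by (intro inj_onI) auto
  show "(\<lambda>s. t \<otimes>\<^bsub>G\<^esub> s) ` H = H"
    using subgroup.m_closed [OF H t] by (intro endo_inj_surj [OF finite_H _ inj]) auto
qed

lemma H_M: "s \<in> H \<Longrightarrow> a \<in> M \<Longrightarrow> s a \<in> M" using aut_groupD(1) H_in_G by blast

lemma Tr_mem: assumes a: "a \<in> M" shows "Tr a \<in> Z"
proof -
  have "Tr a \<in> M" unfolding Tr_def using H_M a by (intro M_finsum) auto
  moreover have "t (Tr a) = Tr a" if t: "t \<in> H" for t
  proof -
    have "t (Tr a) = (\<Oplus>s\<in>H. t (s a))"
      unfolding Tr_def using H_M a by (intro aut_finsum H_in_G [OF t]) auto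
    also have "\<dots> = (\<Oplus>s\<in>H. (t \<otimes>\<^bsub>G\<^esub> s) a)"
      using G_apply [OF H_in_G [OF t] H_in_G a] H_M [OF subgroup.m_closed [OF H t] a] M_carr
      by (intro finsum_cong') auto
    also have "\<dots> = (\<Oplus>s\<in>(\<lambda>s. t \<otimes>\<^bsub>G\<^esub> s) ` H. s a)"
      using H_image [OF t] H_M a M_carr by (intro finsum_reindex [symmetric]) auto
    also have "\<dots> = Tr a" using H_image(1) [OF t] by (simp add: Tr_def)
    finally show ?thesis .
  qed
  ultimately show ?thesis by (simp add: Z_iff)
qed

text \<open>Artin's theorem. The vectors \<open>w b\<^sub>j = \<Oplus>s. s(b\<^sub>j) x\<^sub>s\<close> span the \<open>M\<close>-\<open>M\<close>-bimodule generated by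
  \<open>w = \<Oplus>s. x\<^sub>s\<close>, which contains every \<open>x\<^sub>s\<close>; this is Dedekind's lemma. The other
  inequality is the usual trace argument.\<close>

lemma dim_M_Z: "dimension (card H) Z M"
proof -
  obtain m where m: "dimension m Z M" using dim_Z_finite .
  obtain b where b: "b \<in> {..<m} \<rightarrow> M" "fam_indep Z {..<m} b" "fam_span Z {..<m} b = M"
    using base_family [OF Z_subfield m] .
  have bc: "b j \<in> M" "b j \<in> carrier A" if "j \<in> {..<m}" for j using b(1) that M_carr by auto
  define w where "w = (\<Oplus>s\<in>H. x s)"
  have wc: "w \<in> carrier A" unfolding w_def using x_closed by (intro finsum_closed) auto
  have wa: "w \<otimes> a = (\<Oplus>s\<in>H. s a \<otimes> x s)" if a: "a \<in> M" for a
  proof -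
    have "w \<otimes> a = (\<Oplus>s\<in>H. x s \<otimes> a)"
      unfolding w_def using x_closed finite_H a M_carr by (intro finsum_ldistr) auto
    also have "\<dots> = (\<Oplus>s\<in>H. s a \<otimes> x s)"
      using inducesD(3) [OF induces_x [OF H_in_G] a] H_M [OF _ a] M_carr x_closed by (intro finsum_cong') auto
    finally show ?thesis .
  qed
  \<comment> \<open>Each \<open>x s\<close> with \<open>s \<in> H\<close> commutes with
    \<open>Fix(H)\<close>. Hence the coordinates of an element of \<open>M\<close> with respect to
    \<open>b\<close> can be moved to the left of \<open>w\<close>, and the
    \<open>w \<otimes> b j\<close> suffice to span all \<open>w \<otimes> a\<close>.\<close>
  have wz: "w \<otimes> z = z \<otimes> w" if z: "z \<in> Z" for z
  proof -
    have zM: "z \<in> M" "z \<in> carrier A" using z M_carr by (auto simp: Z_iff)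
    have "w \<otimes> z = (\<Oplus>s\<in>H. z \<otimes> x s)"
      unfolding wa [OF zM(1)] using z zM x_closed by (intro finsum_cong') (auto simp: Z_iff)
    also have "\<dots> = z \<otimes> w"
      unfolding w_def using x_closed finite_H zM by (intro finsum_rdistr [symmetric]) auto
    finally show ?thesis .
  qed
  define W where "W = fam_span M {..<m} (\<lambda>j. w \<otimes> b j)"
  have wb: "(\<lambda>j. w \<otimes> b j) \<in> {..<m} \<rightarrow> carrier A" using wc bc by auto
  note W = fam_span_subspace [OF M finite_lessThan wb, folded W_def]
  have W_sum: "(\<Oplus>j\<in>J. f j) \<in> W" if "f \<in> J \<rightarrow> W" for f and J :: "nat set"
    using W(1-3) that by (intro finsum_closed_in) auto
  have wM: "w \<otimes> a \<in> W" if a: "a \<in> M" for a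
  proof -
    from fam_spanE [OF b(3) a]
    obtain z where z: "z \<in> {..<m} \<rightarrow> Z" "a = (\<Oplus>j\<in>{..<m}. z j \<otimes> b j)" .
    have zj: "z j \<in> Z" "z j \<in> M" "z j \<in> carrier A" if "j \<in> {..<m}" for j
      using funcset_mem [OF z(1) that] M_carr by (auto simp: Z_iff)
    have "w \<otimes> a = (\<Oplus>j\<in>{..<m}. w \<otimes> (z j \<otimes> b j))"
      unfolding z(2) using zj bc wc by (intro finsum_rdistr) auto
    also have "\<dots> = (\<Oplus>j\<in>{..<m}. z j \<otimes> (w \<otimes> b j))"
    proof (rule finsum_cong')
      fix j assume j: "j \<in> {..<m}"
      show "w \<otimes> (z j \<otimes> b j) = z j \<otimes> (w \<otimes> b j)"
        using wz [OF zj(1) [OF j]] zj(3) [OF j] bc(2) [OF j] wc by (simp flip: m_assoc)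
    qed (use zj bc wc in auto)
    also have "\<dots> \<in> W" by (rule W_sum) (use zj W(5,6) in auto)
    finally show ?thesis .
  qed
  have W_right: "a \<otimes> k \<in> W" if a: "a \<in> W" and k: "k \<in> M" for a k
  proof -
    from a obtain d where d: "d \<in> {..<m} \<rightarrow> M" "a = (\<Oplus>j\<in>{..<m}. d j \<otimes> (w \<otimes> b j))"
      unfolding W_def by (rule fam_spanE [OF refl])
    have dj: "d j \<in> M" "d j \<in> carrier A" if "j \<in> {..<m}" for j using d(1) that M_carr by auto
    have "a \<otimes> k = (\<Oplus>j\<in>{..<m}. d j \<otimes> (w \<otimes> b j) \<otimes> k)"
      unfolding d(2) using dj bc wc k M_carr by (intro finsum_ldistr) auto
    also have "\<dots> = (\<Oplus>j\<in>{..<m}. d j \<otimes> (w \<otimes> (b j \<otimes> k)))"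
      using dj bc wc k M_carr by (intro finsum_cong') (auto simp: m_assoc)
    also have "\<dots> \<in> W" by (rule W_sum) (use dj bc k M_cl(6) wM W(5) in auto)
    finally show ?thesis .
  qed
  have xW: "x t \<in> W" if t: "t \<in> H" for t
  proof -
    have "\<one> \<otimes> x t \<in> W"
    proof (rule bimodule_component [OF finite_H subgroup.subset [OF H], of "\<lambda>_. \<one>" x W t])
      have "(\<Oplus>s\<in>H. \<one> \<otimes> x s) = w \<otimes> \<one>"
        unfolding w_def using x_closed by (simp cong: finsum_cong add: Pi_def simp_implies_def)
      then show "(\<Oplus>s\<in>H. \<one> \<otimes> x s) \<in> W" using wM [OF M_cl(3)] by simp
      show "a \<ominus> a' \<in> W" if "a \<in> W" "a' \<in> W" for a a'
        unfolding a_minus_def using that W(3,4) by blast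
    qed (use t induces_x H_in_G W(5) W_right M_cl(3) in auto)
    then show ?thesis using x_closed t by simp
  qed
  have "card H \<le> card {..<m}"
    by (rule fam_indep_card_le_span [OF M finite_H finite_lessThan x_indep x_Pi wb])
      (use xW W_def in auto)
  then have le1: "card H \<le> m" by simp
  have sb: "s (b j) \<in> M" "s (b j) \<in> carrier A" if "s \<in> H" "j \<in> {..<m}" for s j
    using H_M that bc M_carr by auto
  have Tr_nonzero: "\<exists>a\<in>M. Tr a \<noteq> \<zero>"
  proof (rule ccontr)
    assume "\<not> ?thesis"
    then have Tr0: "Tr a = \<zero>" if "a \<in> M" for a using that by blast
    from xW [OF one_H] obtain d where
      d: "d \<in> {..<m} \<rightarrow> M" "x \<one>\<^bsub>G\<^esub> = (\<Oplus>j\<in>{..<m}. d j \<otimes> (w \<otimes> b j))"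
      unfolding W_def by (rule fam_spanE [OF refl])
    have dj: "d j \<in> M" "d j \<in> carrier A" if "j \<in> {..<m}" for j using d(1) that M_carr by auto
    \<comment> \<open>Moving \<open>b j\<close> to the left past \<open>x s\<close> applies
      \<open>s\<close> to it, so \<open>e s\<close> is the coefficient of \<open>x s\<close> in the
      expansion of \<open>x\<close> at the identity: it is \<open>\<one>\<close> at the identity and
      \<open>\<zero>\<close> elsewhere. Adding up all \<open>e s\<close> expresses
      \<open>\<one>\<close> by the traces of the \<open>b j\<close>.\<close>
    define e where "e = (\<lambda>s. \<Oplus>j\<in>{..<m}. d j \<otimes> s (b j))"
    have eM: "e \<in> H \<rightarrow> M" unfolding e_def using dj sb M_cl(6) by (auto intro!: M_finsum)
    have "(\<Oplus>s\<in>H. e s \<otimes> x s) = (\<Oplus>s\<in>H. \<Oplus>j\<in>{..<m}. d j \<otimes> (s (b j) \<otimes> x s))"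
    proof (rule finsum_cong')
      fix s assume s: "s \<in> H"
      have "e s \<otimes> x s = (\<Oplus>j\<in>{..<m}. d j \<otimes> s (b j) \<otimes> x s)"
        unfolding e_def using dj sb s x_closed by (intro finsum_ldistr) auto
      also have "\<dots> = (\<Oplus>j\<in>{..<m}. d j \<otimes> (s (b j) \<otimes> x s))"
        using dj sb s x_closed by (intro finsum_cong') (auto simp: m_assoc)
      finally show "e s \<otimes> x s = (\<Oplus>j\<in>{..<m}. d j \<otimes> (s (b j) \<otimes> x s))" .
    qed (use dj sb x_closed in \<open>auto intro!: finsum_closed\<close>)
    also have "\<dots> = (\<Oplus>j\<in>{..<m}. \<Oplus>s\<in>H. d j \<otimes> (s (b j) \<otimes> x s))"
      using finite_H dj sb x_closed by (intro finsum_swap) auto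
    also have "\<dots> = x \<one>\<^bsub>G\<^esub>"
      unfolding d(2)
    proof (rule finsum_cong')
      fix j assume j: "j \<in> {..<m}"
      show "(\<Oplus>s\<in>H. d j \<otimes> (s (b j) \<otimes> x s)) = d j \<otimes> (w \<otimes> b j)"
        unfolding wa [OF bc(1) [OF j]] using finite_H dj [OF j] sb [OF _ j] x_closed
        by (intro finsum_rdistr [symmetric]) auto
    qed (use dj bc wc in auto)
    also have "\<dots> = (\<Oplus>s\<in>H. (if s = \<one>\<^bsub>G\<^esub> then \<one> else \<zero>) \<otimes> x s)"
    proof -
      have "(\<Oplus>s\<in>H. (if s = \<one>\<^bsub>G\<^esub> then \<one> else \<zero>) \<otimes> x s) = (\<Oplus>s\<in>H. if s = \<one>\<^bsub>G\<^esub> then x s else \<zero>)"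
        using x_closed by (intro finsum_cong') auto
      also have "\<dots> = x \<one>\<^bsub>G\<^esub>" using finite_H one_H x_closed by (intro finsum_delta) auto
      finally show ?thesis by simp
    qed
    finally have eq: "(\<Oplus>s\<in>H. e s \<otimes> x s) = (\<Oplus>s\<in>H. (if s = \<one>\<^bsub>G\<^esub> then \<one> else \<zero>) \<otimes> x s)" .
    have es: "e s = (if s = \<one>\<^bsub>G\<^esub> then \<one> else \<zero>)" if "s \<in> H" for s
      by (rule fam_indep_unique [OF subfieldE(1) [OF M] x_indep x_Pi eM _ eq that]) (use M_cl(2,3) in auto)
    have "\<one> = (\<Oplus>s\<in>H. if s = \<one>\<^bsub>G\<^esub> then \<one> else \<zero>)"
      using finite_H one_H by (intro finsum_delta [symmetric]) auto
    also have "\<dots> = (\<Oplus>s\<in>H. \<Oplus>j\<in>{..<m}. d j \<otimes> s (b j))"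
      using es dj sb unfolding e_def by (intro finsum_cong') (auto intro!: finsum_closed)
    also have "\<dots> = (\<Oplus>j\<in>{..<m}. \<Oplus>s\<in>H. d j \<otimes> s (b j))"
      using finite_H dj sb by (intro finsum_swap) auto
    also have "\<dots> = (\<Oplus>j\<in>{..<m}. \<zero>)"
    proof (rule finsum_cong')
      fix j assume j: "j \<in> {..<m}"
      have "(\<Oplus>s\<in>H. d j \<otimes> s (b j)) = d j \<otimes> Tr (b j)"
        unfolding Tr_def using finite_H dj [OF j] sb [OF _ j] by (intro finsum_rdistr [symmetric]) auto
      then show "(\<Oplus>s\<in>H. d j \<otimes> s (b j)) = \<zero>" using Tr0 [OF bc(1) [OF j]] dj [OF j] by simp
    qed auto
    finally show False using one_not_zero by simp
  qed
  have le2: "m \<le> card H"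
  proof (rule ccontr)
    assume "\<not> m \<le> card H"
    then have "card H < card {..<m}" by simp
    from homogeneous_system [OF M finite_H finite_lessThan this, of "\<lambda>s j. s (b j)"] sb
    obtain y where y: "y \<in> {..<m} \<rightarrow> M" "\<exists>j\<in>{..<m}. y j \<noteq> \<zero>"
      "\<forall>s\<in>H. (\<Oplus>j\<in>{..<m}. y j \<otimes> s (b j)) = \<zero>" by auto
    obtain j0 where j0: "j0 \<in> {..<m}" "y j0 \<noteq> \<zero>" using y(2) by blast
    have yj: "y j \<in> M" "y j \<in> carrier A" if "j \<in> {..<m}" for j using y(1) that M_carr by auto
    \<comment> \<open>The solution is multiplied by \<open>a\<close>, and \<open>u\<close> is
      applied to the equation of its inverse, which turns \<open>s (b j)\<close> back into
      \<open>b j\<close>. Summing over \<open>u\<close> gives a relation between the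
      \<open>b j\<close> whose coefficients are traces, hence in \<open>Fix(H)\<close>, so they all
      vanish. As \<open>y j0\<close> is a unit, \<open>a \<otimes> y j0\<close> runs through
      \<open>M\<close>, and the trace would be zero.\<close>
    have Tr_ay: "Tr (a \<otimes> y j0) = \<zero>" if a: "a \<in> M" for a
    proof -
      have ayM: "a \<otimes> y j \<in> M" if "j \<in> {..<m}" for j using M_cl(6) [OF a yj(1) [OF that]] .
      have u0: "(\<Oplus>j\<in>{..<m}. u (a \<otimes> y j) \<otimes> b j) = \<zero>" if u: "u \<in> H" for u
      proof -
        define s where "s = inv\<^bsub>G\<^esub> u"
        have s: "s \<in> H" using subgroup.m_inv_closed [OF H u] by (simp add: s_def)
        have us: "u (s k) = k" if "k \<in> M" for k
          using G_apply [OF H_in_G [OF u] H_in_G [OF s] that] H_in_G [OF u] that by (simp add: s_def G_one)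
        have "\<zero> = u (a \<otimes> (\<Oplus>j\<in>{..<m}. y j \<otimes> s (b j)))"
          using y(3) s M_carr [OF a] aut_groupD(8) [OF H_in_G [OF u]] by simp
        also have "a \<otimes> (\<Oplus>j\<in>{..<m}. y j \<otimes> s (b j)) = (\<Oplus>j\<in>{..<m}. a \<otimes> (y j \<otimes> s (b j)))"
          using M_carr [OF a] yj sb [OF s] by (intro finsum_rdistr) auto
        also have "\<dots> = (\<Oplus>j\<in>{..<m}. a \<otimes> y j \<otimes> s (b j))"
          using M_carr [OF a] yj sb [OF s] by (intro finsum_cong') (auto simp: m_assoc)
        also have "u (\<Oplus>j\<in>{..<m}. a \<otimes> y j \<otimes> s (b j)) = (\<Oplus>j\<in>{..<m}. u (a \<otimes> y j \<otimes> s (b j)))"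
          using ayM sb [OF s] M_cl(6) by (intro aut_finsum H_in_G [OF u]) auto
        also have "\<dots> = (\<Oplus>j\<in>{..<m}. u (a \<otimes> y j) \<otimes> b j)"
          using aut_groupD(4) [OF H_in_G [OF u] ayM sb(1) [OF s]] us bc H_M [OF u ayM] M_carr
          by (intro finsum_cong') auto
        finally show ?thesis by simp
      qed
      have uay: "u (a \<otimes> y j) \<in> carrier A" if "u \<in> H" "j \<in> {..<m}" for u j
        using H_M [OF that(1) ayM [OF that(2)]] M_carr by blast
      have "(\<Oplus>j\<in>{..<m}. Tr (a \<otimes> y j) \<otimes> b j) = (\<Oplus>j\<in>{..<m}. \<Oplus>u\<in>H. u (a \<otimes> y j) \<otimes> b j)"
        unfolding Tr_def using finite_H uay bc
        by (intro finsum_cong' finsum_ldistr) (auto intro!: finsum_closed)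
      also have "\<dots> = (\<Oplus>u\<in>H. \<Oplus>j\<in>{..<m}. u (a \<otimes> y j) \<otimes> b j)"
        using finite_H uay bc by (intro finsum_swap) auto
      also have "\<dots> = (\<Oplus>u\<in>H. \<zero>)" using u0 by (intro finsum_cong') auto
      finally have "(\<Oplus>j\<in>{..<m}. Tr (a \<otimes> y j) \<otimes> b j) = \<zero>" by simp
      moreover have "(\<lambda>j. Tr (a \<otimes> y j)) \<in> {..<m} \<rightarrow> Z" using Tr_mem ayM by auto
      ultimately show ?thesis using bspec [OF b(2) [unfolded fam_indep_def]] j0(1) by blast
    qed
    obtain a where a: "a \<in> M" "Tr a \<noteq> \<zero>" using Tr_nonzero by blast
    note u = M_unit [OF yj(1) [OF j0(1)] j0(2)]
    have "Tr (a \<otimes> inv (y j0) \<otimes> y j0) = \<zero>" using Tr_ay [OF M_cl(6) [OF a(1) u(2)]] .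
    moreover have "a \<otimes> inv (y j0) \<otimes> y j0 = a"
      using u a M_carr yj(2) [OF j0(1)] by (simp add: m_assoc)
    ultimately show False using a(2) by simp
  qed
  show ?thesis using m le1 le2 by simp
qed

end

text \<open>The group \<open>H'\<close> of all automorphisms fixing \<open>Fix(H)\<close> has the
  same fixed field as \<open>H\<close>, so both groups have \<open>[M : Fix(H)]\<close>
  elements.\<close>

lemma aut_group_over_fixed_set:
  assumes H: "subgroup H G"
  shows "{s \<in> carrier G. \<forall>z\<in>fixed_set M H. s z = z} = H"
proof -
  let ?Z = "fixed_set M H"
  define H' where "H' = {s \<in> carrier G. \<forall>z\<in>?Z. s z = z}"
  have sub: "H \<subseteq> H'" using subgroup.subset [OF H] by (auto simp: H'_def fixed_set_def)
  have ZM: "z \<in> M" if "z \<in> ?Z" for z using that by (simp add: fixed_set_def)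
  have H': "subgroup H' G"
  proof (rule G.subgroupI)
    show "H' \<subseteq> carrier G" by (auto simp: H'_def)
    show "H' \<noteq> {}" using sub subgroup.one_closed [OF H] by blast
    fix s assume "s \<in> H'"
    then have s: "s \<in> carrier G" "\<And>z. z \<in> ?Z \<Longrightarrow> s z = z" by (auto simp: H'_def)
    have "(inv\<^bsub>G\<^esub> s) z = z" if z: "z \<in> ?Z" for z
    proof -
      have "(inv\<^bsub>G\<^esub> s) z = (inv\<^bsub>G\<^esub> s) (s z)" using s(2) [OF z] by simp
      also have "\<dots> = z" using G_apply [OF G.inv_closed [OF s(1)] s(1) ZM [OF z]] s(1) ZM [OF z]
        by (simp add: G_one)
      finally show ?thesis .
    qed
    then show "inv\<^bsub>G\<^esub> s \<in> H'" using s(1) by (simp add: H'_def)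
    fix t assume "t \<in> H'"
    then have t: "t \<in> carrier G" "\<And>z. z \<in> ?Z \<Longrightarrow> t z = z" by (auto simp: H'_def)
    show "s \<otimes>\<^bsub>G\<^esub> t \<in> H'" using s t ZM G_apply [OF s(1) t(1)] by (simp add: H'_def)
  qed
  have "fixed_set M H' = ?Z" using sub by (auto simp: fixed_set_def H'_def)
  then have "card H = card H'"
    using dimension_is_inj [OF Z_subfield [OF H] dim_M_Z [OF H]] dim_M_Z [OF H'] by metis
  moreover have "finite H'" using finite_subset [OF subgroup.subset [OF H'] finite_G] .
  ultimately show ?thesis using card_subset_eq [OF _ sub] by (simp add: H'_def)
qed

text \<open>The degree is \<open>card H\<close>: both \<open>[M(H) : M]\<close> and
  \<open>[M : Fix(H)]\<close> equal it, so \<open>[M(H) : Fix(H)]\<close> is its square.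
  \<open>M\<close> is the Galois maximal subfield.\<close>

lemma crossed_product_sn_span:
  assumes H: "subgroup H G"
  shows "crossed_product (A\<lparr>carrier := sn_span A M H\<rparr>) (fixed_set M H) (G\<lparr>carrier := H\<rparr>)"
proof -
  let ?B = "sn_span A M H" and ?Z = "fixed_set M H"
  note Bs = B_subring [OF H] and Z = Z_subfield [OF H]
  have ZM: "?Z \<subseteq> M" by (auto simp: fixed_set_def)
  have ZB: "?Z \<subseteq> ?B" using ZM M_subset_B [OF H] by blast
  have "dimension (card H * card H) ?Z ?B"
    using telescopic_base [OF Z M dim_M_Z [OF H] B_dim [OF H]] .
  then have "central_simple (A\<lparr>carrier := ?B\<rparr>) ?Z (card H)"
    unfolding central_simple_def
    using simple_B [OF H] subfield_subring [OF Bs Z ZB] center_B [OF H]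
      dimension_subring [OF Bs _ Z ZB subset_refl] by (simp add: power2_eq_square)
  moreover have "maximal_subfield (A\<lparr>carrier := ?B\<rparr>) ?Z (card H) M"
    unfolding maximal_subfield_def
    using subfield_subring [OF Bs M M_subset_B [OF H]] ZM
      dimension_subring [OF Bs dim_M_Z [OF H] Z ZB M_subset_B [OF H]] by simp
  \<comment> \<open>\<open>M\<close> carries the same ring structure inside \<open>M(H)\<close> as
    inside \<open>A\<close>, and fixing \<open>Fix(H)\<close> includes fixing \<open>F\<close>. So
    these automorphisms are the members of \<open>G\<close> that fix \<open>Fix(H)\<close>.\<close>
  moreover have aut: "aut_group (A\<lparr>carrier := ?B\<rparr>) ?Z M = G\<lparr>carrier := H\<rparr>"
  proof -
    have "{h \<in> Bij M. h \<in> ring_iso (A\<lparr>carrier := M\<rparr>) (A\<lparr>carrier := M\<rparr>) \<and> (\<forall>z\<in>?Z. h z = z)}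
      = {s \<in> carrier G. \<forall>z\<in>?Z. s z = z}"
      using F_subset_Z [OF H] by (auto simp: aut_group_def)
    then show ?thesis using aut_group_over_fixed_set [OF H] by (simp add: aut_group_def)
  qed
  moreover have "galois_ext (A\<lparr>carrier := ?B\<rparr>) ?Z M" by (simp add: galois_ext_def aut)
  moreover have "G\<lparr>carrier := H\<rparr> \<cong> G\<lparr>carrier := H\<rparr>" by (rule iso_refl)
  ultimately show ?thesis unfolding crossed_product_def by metis
qed

end

subsection \<open>Twisted polynomials modulo \<open>t\<^sup>q - c\<close>\<close>

context ring begin

text \<open>The regrouping for a product of two polynomials of degree below \<open>q\<close>: the
  pairs with \<open>i, j < q\<close> lie on antidiagonals below \<open>q + q\<close>, and all other
  pairs contribute \<open>\<zero>\<close>.\<close>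

lemma finsum_antidiagonals:
  fixes q :: nat
  assumes h: "\<And>i j. h i j \<in> carrier R" and zero: "\<And>i j. q \<le> i \<or> q \<le> j \<Longrightarrow> h i j = \<zero>"
  shows "(\<Oplus>n\<in>{..<q + q}. \<Oplus>i\<in>{..n}. h i (n - i)) = (\<Oplus>i\<in>{..<q}. \<Oplus>j\<in>{..<q}. h i j)"
proof -
  have "(\<Oplus>n\<in>{..<q + q}. \<Oplus>i\<in>{..n}. h i (n - i))
    = (\<Oplus>n\<in>{..<q + q}. \<Oplus>i\<in>{..<q}. if i \<le> n then h i (n - i) else \<zero>)"
  proof (rule finsum_cong')
    fix n
    show "(\<Oplus>i\<in>{..n}. h i (n - i)) = (\<Oplus>i\<in>{..<q}. if i \<le> n then h i (n - i) else \<zero>)"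
      by (rule add.finprod_mono_neutral_cong) (use h zero in auto)
  qed (use h in \<open>auto intro!: finsum_closed\<close>)
  also have "\<dots> = (\<Oplus>i\<in>{..<q}. \<Oplus>n\<in>{..<q + q}. if i \<le> n then h i (n - i) else \<zero>)"
    using h by (intro finsum_swap) auto
  also have "\<dots> = (\<Oplus>i\<in>{..<q}. \<Oplus>j\<in>{..<q}. h i j)"
  proof (rule finsum_cong')
    fix i assume i: "i \<in> {..<q}"
    let ?f = "\<lambda>n. if i \<le> n then h i (n - i) else \<zero>"
    have "(\<Oplus>n\<in>{..<q + q}. ?f n) = (\<Oplus>n\<in>(\<lambda>j. i + j) ` {..<q}. ?f n)"
    proof (rule add.finprod_mono_neutral_cong_right)
      show "?f n = \<zero>" if n: "n \<in> {..<q + q} - (\<lambda>j. i + j) ` {..<q}" for n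
      proof (cases "i \<le> n")
        case True
        then have "n = i + (n - i)" by simp
        then have "\<not> n - i < q" using n by blast
        then show ?thesis using zero by auto
      qed simp
    qed (use i h in auto)
    also have "\<dots> = (\<Oplus>j\<in>{..<q}. ?f (i + j))"
      using h by (intro finsum_reindex) auto
    finally show "(\<Oplus>n\<in>{..<q + q}. ?f n) = (\<Oplus>j\<in>{..<q}. h i j)" by simp
  qed (use h in \<open>auto intro!: finsum_closed\<close>)
  finally show ?thesis .
qed

text \<open>Unlike addition and multiplication, sums and negatives are not record fields. Their
  definitions refer to the carrier, so they have to be compared between a ring and its
  subring.\<close>

lemma finsum_subring:
  assumes S: "subring S R" and f: "f \<in> I \<rightarrow> S"
  shows "finsum (R\<lparr>carrier := S\<rparr>) f I = finsum R f I"
proof -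
  interpret S: ring "R\<lparr>carrier := S\<rparr>" by (rule subring_is_ring [OF S])
  show ?thesis using f
  proof (induction I rule: infinite_finite_induct)
    case (insert a I)
    then have "finsum (R\<lparr>carrier := S\<rparr>) f (insert a I) = f a \<oplus> finsum (R\<lparr>carrier := S\<rparr>) f I"
      by (subst S.finsum_insert) auto
    also have "\<dots> = finsum R f (insert a I)"
      using insert subringE(1) [OF S] by (subst finsum_insert) auto
    finally show ?case .
  qed simp_all
qed

lemma a_inv_subring:
  assumes S: "subring S R" and a: "a \<in> S"
  shows "\<ominus>\<^bsub>R\<lparr>carrier := S\<rparr>\<^esub> a = \<ominus> a"
proof -
  interpret S: ring "R\<lparr>carrier := S\<rparr>" by (rule subring_is_ring [OF S])
  have "\<ominus> a \<oplus> a = \<zero>" using a subringE(1) [OF S] by (auto intro: l_neg)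
  then show ?thesis using S.minus_equality [of "\<ominus> a" a] a subringE(5) [OF S] by simp
qed

end

text \<open>This isolates what the isomorphism depends on: a subring stable under conjugation by a
  unit \<open>y\<close>, with a power of \<open>y\<close> inside it. In the application
  \<open>S\<close> is \<open>M(K)\<close>. The assumption \<open>nontriv\<close> makes the degree of
  \<open>t^q - c\<close> exactly \<open>q\<close>.\<close>

locale twisted_subring = ring R for R (structure) +
  fixes S :: "'a set" and y :: 'a and q :: nat
  assumes S: "subring S R" and y: "y \<in> Units R" and q: "0 < q" and nontriv: "\<one> \<noteq> \<zero>"
    and conj_S: "z \<in> S \<Longrightarrow> y \<otimes> z \<otimes> inv y \<in> S" and c_S: "y [^] q \<in> S"
begin

abbreviation S' where "S' \<equiv> R\<lparr>carrier := S\<rparr>"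
definition \<tau> where "\<tau> z = y \<otimes> z \<otimes> inv y"
abbreviation c where "c \<equiv> y [^] q"
abbreviation P where "P \<equiv> twisted_poly S' \<tau>"
abbreviation f where "f \<equiv> twisted_binomial S' \<tau> q c"

lemmas S_cl = subringE [OF S]

lemma S_carr: "a \<in> S \<Longrightarrow> a \<in> carrier R" using S_cl(1) by blast
lemma yc: "y \<in> carrier R" "inv y \<in> carrier R" "y \<otimes> inv y = \<one>" "inv y \<otimes> y = \<one>" using y by auto
lemma pow_closed: "y [^] (i::nat) \<in> carrier R" using yc by simp

lemma \<tau>_pow_closed: "z \<in> S \<Longrightarrow> (\<tau> ^^ i) z \<in> S"
  by (induction i) (auto simp: \<tau>_def conj_S)

text \<open>\<open>y\<close> obeys the rule \<open>t a = \<tau>(a) t\<close> of the twisted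
  polynomials. Stated without inverses, it can be applied inside longer products.\<close>

lemma \<tau>_pow: "z \<in> S \<Longrightarrow> (\<tau> ^^ i) z \<otimes> y [^] i = y [^] i \<otimes> z"
proof (induction i)
  case (Suc i)
  define w where "w = (\<tau> ^^ i) z"
  have w: "w \<in> carrier R" using \<tau>_pow_closed [OF Suc.prems] S_carr by (simp add: w_def)
  have zc: "z \<in> carrier R" using Suc.prems S_carr by blast
  have "(\<tau> ^^ Suc i) z \<otimes> y [^] Suc i = y \<otimes> w \<otimes> inv y \<otimes> (y \<otimes> y [^] i)"
    using yc nat_pow_mult [of y 1 i] by (simp add: \<tau>_def w_def)
  also have "\<dots> = y \<otimes> w \<otimes> (inv y \<otimes> y) \<otimes> y [^] i"
    using w yc(1,2) pow_closed by (simp add: m_assoc)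
  also have "\<dots> = y \<otimes> (w \<otimes> y [^] i)" using w yc pow_closed by (simp add: m_assoc)
  also have "\<dots> = y \<otimes> (y [^] i \<otimes> z)" using Suc by (simp add: w_def)
  also have "\<dots> = y [^] Suc i \<otimes> z"
    using yc(1) pow_closed zc nat_pow_mult [of y 1 i] by (simp flip: m_assoc)
  finally show ?case .
qed (use S_carr in auto)

lemma \<tau>_c: "\<tau> c = c"
proof -
  have "\<tau> c = y \<otimes> y [^] q \<otimes> inv y" by (simp add: \<tau>_def)
  also have "y \<otimes> y [^] q = y [^] q \<otimes> y" using yc(1) nat_pow_mult [of y 1 q] nat_pow_mult [of y q 1] by simp
  also have "\<dots> \<otimes> inv y = c" using yc pow_closed by (simp add: m_assoc)
  finally show ?thesis .
qed

text \<open>These are the coefficients of \<open>t^m\<close> and of \<open>t^q - c\<close>. When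
  such a polynomial is the right factor of a product, the twist has no effect.\<close>

lemma \<tau>_pow_simps: "(\<tau> ^^ i) \<zero> = \<zero>" "(\<tau> ^^ i) \<one> = \<one>" "(\<tau> ^^ i) (\<ominus> c) = \<ominus> c"
proof -
  have "\<tau> \<zero> = \<zero>" "\<tau> \<one> = \<one>" using yc by (auto simp: \<tau>_def)
  moreover have "\<tau> (\<ominus> c) = \<ominus> c"
    using \<tau>_c yc pow_closed by (simp add: \<tau>_def r_minus l_minus)
  ultimately show "(\<tau> ^^ i) \<zero> = \<zero>" "(\<tau> ^^ i) \<one> = \<one>" "(\<tau> ^^ i) (\<ominus> c) = \<ominus> c"
    by (induction i) auto
qed

section \<open>Coefficients of twisted polynomials\<close>

lemma up_iff: "p \<in> up S' \<longleftrightarrow> (\<forall>n. p n \<in> S) \<and> (\<exists>N. \<forall>n>N. p n = \<zero>)"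
  by (auto simp: up_def bound_def)

lemma up_S: "p \<in> up S' \<Longrightarrow> p n \<in> S" "p \<in> up S' \<Longrightarrow> p n \<in> carrier R"
  using S_carr by (auto simp: up_iff)

lemma up_bounded: "(\<And>n. p n \<in> S) \<Longrightarrow> (\<And>n. N \<le> n \<Longrightarrow> p n = \<zero>) \<Longrightarrow> p \<in> up S'"
  unfolding up_iff by (auto intro!: exI [of _ N])

lemma P_simps: "carrier P = up S'" "\<one>\<^bsub>P\<^esub> = (\<lambda>i. if i = 0 then \<one> else \<zero>)"
  by (auto simp: twisted_poly_def UP_def)

lemma P_monom: "a \<in> S \<Longrightarrow> monom P a k = (\<lambda>i. if i = k then a else \<zero>)"
  by (auto simp: twisted_poly_def UP_def fun_eq_iff)

lemma P_add: "p \<in> up S' \<Longrightarrow> p' \<in> up S' \<Longrightarrow> p \<oplus>\<^bsub>P\<^esub> p' = (\<lambda>n. p n \<oplus> p' n)"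
  by (simp add: twisted_poly_def UP_def)

lemma P_mult:
  assumes "p \<in> up S'" "p' \<in> up S'"
  shows "p \<otimes>\<^bsub>P\<^esub> p' = (\<lambda>n. \<Oplus>i\<in>{..n}. p i \<otimes> (\<tau> ^^ i) (p' (n - i)))"
proof
  fix n
  have "(\<lambda>i. p i \<otimes> (\<tau> ^^ i) (p' (n - i))) \<in> {..n} \<rightarrow> S"
    using up_S assms \<tau>_pow_closed S_cl(6) by auto
  from finsum_subring [OF S this]
  show "(p \<otimes>\<^bsub>P\<^esub> p') n = (\<Oplus>i\<in>{..n}. p i \<otimes> (\<tau> ^^ i) (p' (n - i)))"
    using assms by (simp add: twisted_poly_def)
qed

lemma UP_simps: "carrier (UP S') = up S'" "p \<in> up S' \<Longrightarrow> coeff (UP S') p = p"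
  by (simp_all add: UP_def)

lemma P_minus:
  assumes p: "p \<in> up S'" and p': "p' \<in> up S'"
  shows "p \<ominus>\<^bsub>P\<^esub> p' = (\<lambda>n. p n \<ominus> p' n)"
proof -
  interpret U: UP_ring S' "UP S'"
    by (intro UP_ring.intro subring_is_ring [OF S])
  \<comment> \<open>\<open>P\<close> differs from \<open>UP S'\<close> in its product only, so
    negatives can be computed in the ring \<open>UP S'\<close>.\<close>
  have eq: "\<ominus>\<^bsub>P\<^esub> p' = \<ominus>\<^bsub>UP S'\<^esub> p'" by (simp add: a_inv_def twisted_poly_def)
  have cl: "\<ominus>\<^bsub>UP S'\<^esub> p' \<in> up S'"
    using abelian_group.a_inv_closed [OF ring.is_abelian_group [OF U.UP_ring], of p'] p'
    unfolding UP_simps by blast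
  have "(\<ominus>\<^bsub>UP S'\<^esub> p') n = \<ominus> p' n" for n
  proof -
    have "(\<ominus>\<^bsub>UP S'\<^esub> p') n = \<ominus>\<^bsub>S'\<^esub> p' n"
      using U.coeff_a_inv [of p' n] p'
      unfolding UP_simps(1) UP_simps(2) [OF cl] UP_simps(2) [OF p'] by blast
    also have "\<dots> = \<ominus> p' n" by (rule a_inv_subring [OF S up_S(1) [OF p']])
    finally show ?thesis .
  qed
  then show ?thesis using P_add [OF p cl] eq by (simp add: a_minus_def)
qed

lemma monom_up: "a \<in> S \<Longrightarrow> (\<lambda>n. if n = k then a else \<zero>) \<in> up S'"
  using S_cl(2) by (intro up_bounded [of _ "Suc k"]) auto

lemma t_pow: "(monom P \<one> 1) [^]\<^bsub>P\<^esub> m = (\<lambda>n. if n = m then \<one> else \<zero>)"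
proof (induction m)
  case 0
  show ?case by (simp add: nat_pow_def P_simps)
next
  case (Suc m)
  have "(monom P \<one> 1) [^]\<^bsub>P\<^esub> Suc m = (monom P \<one> 1) [^]\<^bsub>P\<^esub> m \<otimes>\<^bsub>P\<^esub> monom P \<one> 1"
    by (simp add: nat_pow_def)
  also have "\<dots> = (\<lambda>n. if n = m then \<one> else \<zero>) \<otimes>\<^bsub>P\<^esub> (\<lambda>n. if n = 1 then \<one> else \<zero>)"
    using Suc P_monom [OF S_cl(3)] by simp
  also have "\<dots> = (\<lambda>n. if n = Suc m then \<one> else \<zero>)"
  proof
    fix n
    have "((\<lambda>n. if n = m then \<one> else \<zero>) \<otimes>\<^bsub>P\<^esub> (\<lambda>n. if n = 1 then \<one> else \<zero>)) n
      = (\<Oplus>i\<in>{..n}. (if i = m then \<one> else \<zero>) \<otimes> (\<tau> ^^ i) (if n - i = 1 then \<one> else \<zero>))"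
      by (simp add: P_mult [OF monom_up [OF S_cl(3)] monom_up [OF S_cl(3)]])
    also have "\<dots> = (\<Oplus>i\<in>{..n}. if i = m then if n - m = 1 then \<one> else \<zero> else \<zero>)"
      by (intro finsum_cong') (auto simp: \<tau>_pow_simps)
    also have "\<dots> = (if n = Suc m then \<one> else \<zero>)"
    proof (cases "m \<le> n")
      case True
      then have "(\<Oplus>i\<in>{..n}. if i = m then if n - m = 1 then \<one> else \<zero> else \<zero>)
        = (if n - m = 1 then \<one> else \<zero>)"
        by (intro finsum_delta) auto
      then show ?thesis using True by auto
    next
      case False
      then have "(\<Oplus>i\<in>{..n}. if i = m then if n - m = 1 then \<one> else \<zero> else \<zero>) = (\<Oplus>i\<in>{..n}. \<zero>)"
        by (intro finsum_cong') auto
      then show ?thesis using False by simp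
    qed
    finally show "((\<lambda>n. if n = m then \<one> else \<zero>) \<otimes>\<^bsub>P\<^esub> (\<lambda>n. if n = 1 then \<one> else \<zero>)) n
      = (if n = Suc m then \<one> else \<zero>)" .
  qed
  finally show ?case .
qed

lemma f_eq: "f = (\<lambda>n. if n = q then \<one> else if n = 0 then \<ominus> c else \<zero>)"
proof -
  have "f = (\<lambda>n. if n = q then \<one> else \<zero>) \<ominus>\<^bsub>P\<^esub> (\<lambda>n. if n = 0 then c else \<zero>)"
    using t_pow [of q] P_monom [OF c_S] by (simp add: twisted_binomial_def)
  also have "\<dots> = (\<lambda>n. (if n = q then \<one> else \<zero>) \<ominus> (if n = 0 then c else \<zero>))"
    by (rule P_minus [OF monom_up [OF S_cl(3)] monom_up [OF c_S]])
  finally show ?thesis using q pow_closed by (auto simp: fun_eq_iff a_minus_def)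
qed

lemma f_up: "f \<in> up S'"
  unfolding f_eq using S_cl(2,3,5) c_S by (intro up_bounded [of _ "Suc q"]) auto

text \<open>As \<open>\<tau>\<close> fixes \<open>c\<close>, the term \<open>a t^i\<close> times
  \<open>t^q - c\<close> is \<open>a t^(i + q) - a c t^i\<close>.\<close>

lemma mult_f:
  assumes p: "p \<in> up S'"
  shows "(p \<otimes>\<^bsub>P\<^esub> f) n = (if q \<le> n then p (n - q) else \<zero>) \<ominus> p n \<otimes> c"
proof -
  note pc = up_S(2) [OF p]
  have "(p \<otimes>\<^bsub>P\<^esub> f) n = (\<Oplus>i\<in>{..n}. p i \<otimes> (\<tau> ^^ i) (f (n - i)))"
    by (simp add: P_mult [OF p f_up])
  also have "\<dots> = (\<Oplus>i\<in>{..n}. (if i = n then \<ominus> (p i \<otimes> c) else \<zero>) \<oplus> (if i + q = n then p i else \<zero>))"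
  proof (rule finsum_cong')
    fix i assume i: "i \<in> {..n}"
    show "p i \<otimes> (\<tau> ^^ i) (f (n - i)) = (if i = n then \<ominus> (p i \<otimes> c) else \<zero>) \<oplus> (if i + q = n then p i else \<zero>)"
      using i q pc [of i] pow_closed unfolding f_eq by (auto simp: \<tau>_pow_simps r_minus)
  qed (use pc pow_closed in auto)
  also have "\<dots> = (\<Oplus>i\<in>{..n}. if i = n then \<ominus> (p i \<otimes> c) else \<zero>) \<oplus> (\<Oplus>i\<in>{..n}. if i + q = n then p i else \<zero>)"
    using pc pow_closed by (intro finsum_addf) auto
  also have "(\<Oplus>i\<in>{..n}. if i = n then \<ominus> (p i \<otimes> c) else \<zero>) = \<ominus> (p n \<otimes> c)"
    using pc pow_closed by (intro finsum_delta) auto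
  also have "(\<Oplus>i\<in>{..n}. if i + q = n then p i else \<zero>) = (if q \<le> n then p (n - q) else \<zero>)"
  proof (cases "q \<le> n")
    case True
    then have "(\<lambda>i. i + q = n) = (\<lambda>i. i = n - q)" by auto
    then have "(\<Oplus>i\<in>{..n}. if i + q = n then p i else \<zero>) = (\<Oplus>i\<in>{..n}. if i = n - q then p i else \<zero>)"
      by metis
    also have "\<dots> = p (n - q)" using pc by (intro finsum_delta) auto
    finally show ?thesis using True by simp
  next
    case False
    then have "(\<Oplus>i\<in>{..n}. if i + q = n then p i else \<zero>) = (\<Oplus>i\<in>{..n}. \<zero>)"
      by (intro finsum_cong') auto
    then show ?thesis using False by simp
  qed
  finally show ?thesis using pc pow_closed by (simp add: a_minus_def a_comm)
qed

text \<open>The zero polynomial has degree \<open>0\<close> and meets the second condition also for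
  \<open>k = 0\<close>; hence the conjunct \<open>0 < k\<close>.\<close>

lemma deg_less_iff:
  assumes p: "p \<in> up S'"
  shows "deg S' p < k \<longleftrightarrow> 0 < k \<and> (\<forall>n\<ge>k. p n = \<zero>)"
proof -
  have d: "deg S' p = (LEAST n. bound \<zero> n p)" by (simp add: deg_def UP_simps p)
  show ?thesis
  proof
    assume l: "deg S' p < k"
    obtain N where "bound \<zero> N p" using p by (auto simp: up_def)
    then have "bound \<zero> (deg S' p) p" unfolding d by (rule LeastI)
    then show "0 < k \<and> (\<forall>n\<ge>k. p n = \<zero>)" using l by (auto simp: bound_def)
  next
    assume r: "0 < k \<and> (\<forall>n\<ge>k. p n = \<zero>)"
    then have "bound \<zero> (k - 1) p" by (auto simp: bound_def)
    then have "deg S' p \<le> k - 1" unfolding d by (rule Least_le)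
    then show "deg S' p < k" using conjunct1 [OF r] by linarith
  qed
qed

lemma deg_f: "deg S' f = q"
proof -
  have "deg S' f < Suc q" using deg_less_iff [OF f_up, of "Suc q"] by (simp add: f_eq)
  moreover have "\<not> deg S' f < q" using deg_less_iff [OF f_up, of q] nontriv by (auto simp: f_eq)
  ultimately show ?thesis by simp
qed

text \<open>Modulo \<open>t^q - c\<close> the term \<open>a t^(n + q)\<close> becomes
  \<open>a c t^n\<close>. The bound \<open>q + q\<close> fits a product of two remainders: a single
  replacement brings all exponents below \<open>q\<close>.\<close>

lemma twisted_rem_eq:
  assumes g: "g \<in> up S'" and bound: "\<And>n. q + q \<le> n \<Longrightarrow> g n = \<zero>"
  shows "twisted_rem S' \<tau> f g = (\<lambda>n. if n < q then g n \<oplus> g (n + q) \<otimes> c else \<zero>)"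
proof -
  define r where "r = (\<lambda>n. if n < q then g n \<oplus> g (n + q) \<otimes> c else \<zero>)"
  \<comment> \<open>The quotient is the upper half of \<open>g\<close>, moved down by
    \<open>q\<close>.\<close>
  define Q where "Q = (\<lambda>i. if i < q then g (i + q) else \<zero>)"
  note gS = up_S [OF g]
  have r: "r \<in> up S'" unfolding r_def using gS S_cl(2,6,7) c_S by (intro up_bounded [of _ q]) auto
  have Q: "Q \<in> up S'" unfolding Q_def using gS S_cl(2) by (intro up_bounded [of _ q]) auto
  have mul_up: "p \<otimes>\<^bsub>P\<^esub> f \<in> up S'" if p: "p \<in> up S'" for p
  proof -
    obtain N where N: "\<And>n. N < n \<Longrightarrow> p n = \<zero>" using p unfolding up_iff by blast
    show ?thesis
    proof (rule up_bounded)
      show "(p \<otimes>\<^bsub>P\<^esub> f) n \<in> S" for n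
        unfolding mult_f [OF p] a_minus_def using up_S(1) [OF p] S_cl c_S by auto
      show "(p \<otimes>\<^bsub>P\<^esub> f) n = \<zero>" if "Suc N + q \<le> n" for n
        unfolding mult_f [OF p] using N that pow_closed by (simp add: a_minus_def)
    qed
  qed
  have g_eq: "g = Q \<otimes>\<^bsub>P\<^esub> f \<oplus>\<^bsub>P\<^esub> r"
  proof
    fix n
    have k: "g (n + q) \<otimes> c \<in> carrier R" using gS(2) pow_closed by simp
    have "(Q \<otimes>\<^bsub>P\<^esub> f) n \<oplus> r n = g n"
    proof (cases "n < q")
      case True
      then have "(Q \<otimes>\<^bsub>P\<^esub> f) n \<oplus> r n = \<ominus> (g (n + q) \<otimes> c) \<oplus> (g n \<oplus> g (n + q) \<otimes> c)"
        unfolding mult_f [OF Q] using k by (simp add: Q_def r_def a_minus_def)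
      also have "\<dots> = \<ominus> (g (n + q) \<otimes> c) \<oplus> (g (n + q) \<otimes> c \<oplus> g n)"
        using a_comm [OF gS(2) k] by simp
      also have "\<dots> = g n" by (rule r_neg1 [OF k gS(2)])
      finally show ?thesis .
    next
      case False
      then show ?thesis unfolding mult_f [OF Q]
        using gS(2) [of n] bound [of n] pow_closed by (auto simp: Q_def r_def a_minus_def)
    qed
    then show "g n = (Q \<otimes>\<^bsub>P\<^esub> f \<oplus>\<^bsub>P\<^esub> r) n" using P_add [OF mul_up [OF Q] r] by simp
  qed
  have "(THE r. r \<in> carrier P \<and> deg S' r < deg S' f \<and> (\<exists>q\<in>carrier P. g = q \<otimes>\<^bsub>P\<^esub> f \<oplus>\<^bsub>P\<^esub> r)) = r"
  proof (rule the_equality)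
    have "deg S' r < q" using deg_less_iff [OF r] q by (simp add: r_def)
    then show "r \<in> carrier P \<and> deg S' r < deg S' f \<and> (\<exists>q\<in>carrier P. g = q \<otimes>\<^bsub>P\<^esub> f \<oplus>\<^bsub>P\<^esub> r)"
      using r Q g_eq by (auto simp: P_simps deg_f)
  next
    fix r' assume "r' \<in> carrier P \<and> deg S' r' < deg S' f \<and> (\<exists>q\<in>carrier P. g = q \<otimes>\<^bsub>P\<^esub> f \<oplus>\<^bsub>P\<^esub> r')"
    then obtain Q' where r': "r' \<in> up S'" "deg S' r' < q" and Q': "Q' \<in> up S'" "g = Q' \<otimes>\<^bsub>P\<^esub> f \<oplus>\<^bsub>P\<^esub> r'"
      by (auto simp: P_simps deg_f)
    note c1 = up_S(2) [OF Q] and c2 = up_S(2) [OF Q'(1)] and c3 = up_S(2) [OF r] and c4 = up_S(2) [OF r'(1)]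
    have r'0: "r' n = \<zero>" if "q \<le> n" for n using r' deg_less_iff [OF r'(1)] that by simp
    have eq: "(Q' \<otimes>\<^bsub>P\<^esub> f) n \<oplus> r' n = (Q \<otimes>\<^bsub>P\<^esub> f) n \<oplus> r n" for n
      using P_add [OF mul_up [OF Q'(1)] r'(1)] P_add [OF mul_up [OF Q] r] g_eq Q'(2) by metis
    obtain N1 where N1: "\<And>n. N1 < n \<Longrightarrow> Q n = \<zero>" using Q unfolding up_iff by blast
    obtain N2 where N2: "\<And>n. N2 < n \<Longrightarrow> Q' n = \<zero>" using Q'(1) unfolding up_iff by blast
    \<comment> \<open>Downward induction: far out both quotients are zero, and the coefficient of
      index \<open>k + q\<close>, where the remainders vanish, determines the quotient at
      \<open>k\<close> from its value at \<open>k + q\<close>.\<close>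
    have "Q' k = Q k" for k
    proof (induction k rule: measure_induct_rule [of "\<lambda>k. Suc (N1 + N2) - k"])
      case (less k)
      show ?case
      proof (cases "N1 + N2 < k")
        case True
        then show ?thesis using N1 N2 by simp
      next
        case False
        then have ih: "Q' (k + q) = Q (k + q)" using q by (intro less.IH) simp
        have "Q' k \<ominus> Q (k + q) \<otimes> c = Q k \<ominus> Q (k + q) \<otimes> c"
          using eq [of "k + q"] r'0 [of "k + q"] c1 c2 pow_closed
          by (simp add: mult_f [OF Q] mult_f [OF Q'(1)] ih r_def)
        then show ?thesis using c1 c2 pow_closed by (simp add: a_minus_def)
      qed
    qed
    then have "Q' = Q" by auto
    then have "(Q \<otimes>\<^bsub>P\<^esub> f) n \<oplus> r' n = (Q \<otimes>\<^bsub>P\<^esub> f) n \<oplus> r n" for n using eq by simp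
    moreover have "(Q \<otimes>\<^bsub>P\<^esub> f) n \<in> carrier R" for n using up_S(2) [OF mul_up [OF Q]] .
    ultimately have "r' n = r n" for n using c3 c4 by simp
    then show "r' = r" by auto
  qed
  then show ?thesis unfolding twisted_rem_def Let_def r_def by simp
qed

section \<open>Evaluation of remainders at \<open>y\<close>\<close>

definition eval_y where "eval_y g = (\<Oplus>j\<in>{..<q}. g j \<otimes> y [^] j)"

abbreviation low where "low \<equiv> {g \<in> up S'. \<forall>n\<ge>q. g n = \<zero>}"

lemma low_S: "g \<in> low \<Longrightarrow> g n \<in> S" "g \<in> low \<Longrightarrow> g n \<in> carrier R" "g \<in> low \<Longrightarrow> q \<le> n \<Longrightarrow> g n = \<zero>"
  using up_S by auto

lemma twisted_quot_simps:
  "carrier (twisted_quot S' \<tau> f) = low" "\<one>\<^bsub>twisted_quot S' \<tau> f\<^esub> = \<one>\<^bsub>P\<^esub>"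
  "g \<oplus>\<^bsub>twisted_quot S' \<tau> f\<^esub> g' = g \<oplus>\<^bsub>P\<^esub> g'"
  "g \<otimes>\<^bsub>twisted_quot S' \<tau> f\<^esub> g' = twisted_rem S' \<tau> f (g \<otimes>\<^bsub>P\<^esub> g')"
  using deg_less_iff q by (auto simp: twisted_quot_def Let_def deg_f P_simps)

text \<open>Evaluation is insensitive to the reduction because \<open>c\<close> is
  \<open>y [^] q\<close>, and it respects products because moving \<open>y [^] i\<close> past a
  coefficient applies \<open>\<tau> ^^ i\<close>, as moving \<open>t^i\<close> does.\<close>

lemma eval_mult:
  assumes a: "a \<in> low" and b: "b \<in> low"
  shows "twisted_rem S' \<tau> f (a \<otimes>\<^bsub>P\<^esub> b) \<in> low"
    "eval_y (twisted_rem S' \<tau> f (a \<otimes>\<^bsub>P\<^esub> b)) = eval_y a \<otimes> eval_y b"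
proof -
  note aS = low_S [OF a] and bS = low_S [OF b]
  have up: "a \<in> up S'" "b \<in> up S'" using a b by auto
  define g where "g = a \<otimes>\<^bsub>P\<^esub> b"
  have g_eq: "g n = (\<Oplus>i\<in>{..n}. a i \<otimes> (\<tau> ^^ i) (b (n - i)))" for n
    by (simp add: g_def P_mult [OF up])
  have \<tau>c: "(\<tau> ^^ i) (b j) \<in> S" "(\<tau> ^^ i) (b j) \<in> carrier R" for i j
    using \<tau>_pow_closed [OF bS(1)] S_carr by auto
  have gS: "g n \<in> S" for n
    unfolding g_eq by (rule finsum_closed_in) (use S_cl aS \<tau>c in auto)
  have gc: "g n \<in> carrier R" for n using gS S_carr by blast
  have g0: "g n = \<zero>" if n: "q + q \<le> n" for n
  proof -
    have "g n = (\<Oplus>i\<in>{..n}. \<zero>)"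
      unfolding g_eq
    proof (rule finsum_cong')
      fix i
      show "a i \<otimes> (\<tau> ^^ i) (b (n - i)) = \<zero>"
      proof (cases "q \<le> i")
        case False
        then have "b (n - i) = \<zero>" using n bS(3) [of "n - i"] by simp
        then show ?thesis using aS(2) by (simp add: \<tau>_pow_simps)
      qed (use aS(3) \<tau>c in simp)
    qed auto
    then show ?thesis by simp
  qed
  have g: "g \<in> up S'" by (rule up_bounded [OF gS g0])
  define r where "r = twisted_rem S' \<tau> f g"
  have r_eq: "r = (\<lambda>n. if n < q then g n \<oplus> g (n + q) \<otimes> c else \<zero>)"
    unfolding r_def by (rule twisted_rem_eq [OF g g0])
  have "r \<in> up S'" unfolding r_eq using gS S_cl(2,6,7) c_S by (intro up_bounded [of _ q]) auto
  then show "twisted_rem S' \<tau> f (a \<otimes>\<^bsub>P\<^esub> b) \<in> low" unfolding g_def [symmetric] r_def [symmetric]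
    by (simp add: r_eq)
  have "eval_y r = (\<Oplus>n\<in>{..<q}. g n \<otimes> y [^] n \<oplus> g (n + q) \<otimes> y [^] (n + q))"
    unfolding eval_y_def
  proof (rule finsum_cong')
    fix n assume "n \<in> {..<q}"
    then show "r n \<otimes> y [^] n = g n \<otimes> y [^] n \<oplus> g (n + q) \<otimes> y [^] (n + q)"
      using gc pow_closed nat_pow_mult [OF yc(1), of q n]
      by (simp add: r_eq l_distr m_assoc add.commute)
  qed (use gc pow_closed in auto)
  also have "\<dots> = (\<Oplus>n\<in>{..<q}. g n \<otimes> y [^] n) \<oplus> (\<Oplus>n\<in>{..<q}. g (n + q) \<otimes> y [^] (n + q))"
    using gc pow_closed by (intro finsum_addf) auto
  also have "(\<Oplus>n\<in>{..<q}. g (n + q) \<otimes> y [^] (n + q)) = (\<Oplus>n\<in>(\<lambda>n. n + q) ` {..<q}. g n \<otimes> y [^] n)"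
    using gc pow_closed by (intro finsum_reindex [symmetric]) auto
  also have "(\<Oplus>n\<in>{..<q}. g n \<otimes> y [^] n) \<oplus> \<dots> = (\<Oplus>n\<in>{..<q} \<union> (\<lambda>n. n + q) ` {..<q}. g n \<otimes> y [^] n)"
    using gc pow_closed by (intro finsum_Un_disjoint [symmetric]) auto
  also have "{..<q} \<union> (\<lambda>n. n + q) ` {..<q} = {..<q + q}"
  proof -
    have "n < q \<or> n \<in> (\<lambda>n. n + q) ` {..<q}" if "n < q + q" for n
      using that by (cases "n < q") (auto intro: image_eqI [of _ _ "n - q"])
    then show ?thesis by auto
  qed
  \<comment> \<open>The two halves have been joined to the value at \<open>y\<close> of the
    unreduced product, whose terms are now split into pairs.\<close>
  also have "(\<Oplus>n\<in>{..<q + q}. g n \<otimes> y [^] n)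
    = (\<Oplus>n\<in>{..<q + q}. \<Oplus>i\<in>{..n}. (a i \<otimes> y [^] i) \<otimes> (b (n - i) \<otimes> y [^] (n - i)))"
  proof (rule finsum_cong')
    fix n
    have "g n \<otimes> y [^] n = (\<Oplus>i\<in>{..n}. a i \<otimes> (\<tau> ^^ i) (b (n - i)) \<otimes> y [^] n)"
      unfolding g_eq using aS(2) \<tau>c pow_closed by (intro finsum_ldistr) auto
    also have "\<dots> = (\<Oplus>i\<in>{..n}. (a i \<otimes> y [^] i) \<otimes> (b (n - i) \<otimes> y [^] (n - i)))"
    proof (rule finsum_cong')
      fix i assume i: "i \<in> {..n}"
      have "y [^] n = y [^] i \<otimes> y [^] (n - i)" using nat_pow_mult [OF yc(1), of i "n - i"] i by simp
      then have "a i \<otimes> (\<tau> ^^ i) (b (n - i)) \<otimes> y [^] n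
        = a i \<otimes> ((\<tau> ^^ i) (b (n - i)) \<otimes> y [^] i) \<otimes> y [^] (n - i)"
        using aS(2) \<tau>c pow_closed by (simp add: m_assoc)
      also have "\<dots> = a i \<otimes> (y [^] i \<otimes> b (n - i)) \<otimes> y [^] (n - i)" using \<tau>_pow [OF bS(1)] by simp
      also have "\<dots> = (a i \<otimes> y [^] i) \<otimes> (b (n - i) \<otimes> y [^] (n - i))"
        using aS(2) bS(2) pow_closed by (simp add: m_assoc)
      finally show "a i \<otimes> (\<tau> ^^ i) (b (n - i)) \<otimes> y [^] n = (a i \<otimes> y [^] i) \<otimes> (b (n - i) \<otimes> y [^] (n - i))" .
    qed (use aS(2) bS(2) pow_closed in auto)
    finally show "g n \<otimes> y [^] n = (\<Oplus>i\<in>{..n}. (a i \<otimes> y [^] i) \<otimes> (b (n - i) \<otimes> y [^] (n - i)))" .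
  qed (use aS(2) bS(2) pow_closed in \<open>auto intro!: finsum_closed\<close>)
  also have "\<dots> = (\<Oplus>i\<in>{..<q}. \<Oplus>j\<in>{..<q}. (a i \<otimes> y [^] i) \<otimes> (b j \<otimes> y [^] j))"
    by (rule finsum_antidiagonals) (use aS bS pow_closed in auto)
  also have "\<dots> = (\<Oplus>i\<in>{..<q}. (a i \<otimes> y [^] i) \<otimes> eval_y b)"
    unfolding eval_y_def using aS(2) bS(2) pow_closed
    by (intro finsum_cong' finsum_rdistr [symmetric]) (auto intro!: finsum_closed m_closed)
  also have "\<dots> = eval_y a \<otimes> eval_y b"
    unfolding eval_y_def using aS(2) bS(2) pow_closed
    by (intro finsum_ldistr [symmetric]) (auto intro!: finsum_closed)
  finally show "eval_y (twisted_rem S' \<tau> f (a \<otimes>\<^bsub>P\<^esub> b)) = eval_y a \<otimes> eval_y b"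
    by (simp add: r_def g_def)
qed

text \<open>That the powers of \<open>y\<close> are a left basis says that evaluation is a bijection
  from remainders to \<open>T\<close>. The isomorphism is its inverse
  \<open>\<kappa>\<close>.\<close>

lemma twisted_quot_alg_isoI:
  assumes T: "subring T R" "fam_span S {..<q} (\<lambda>j. y [^] j) = T"
    and ind: "fam_indep S {..<q} (\<lambda>j. y [^] j)" and F: "F \<subseteq> S"
  shows "twisted_quot_alg_iso F (R\<lparr>carrier := T\<rparr>) S' \<tau> f"
proof -
  let ?Q = "twisted_quot S' \<tau> f"
  have inj: "g = g'" if g: "g \<in> low" "g' \<in> low" and eq: "eval_y g = eval_y g'" for g g'
  proof
    fix n
    show "g n = g' n"
    proof (cases "n < q")
      case True
      show ?thesis
        by (rule fam_indep_unique [OF S ind _ _ _ eq [unfolded eval_y_def]])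
          (use g low_S(1) pow_closed True in auto)
    qed (use g in auto)
  qed
  have mem: "eval_y g \<in> T" if "g \<in> low" for g
    unfolding T(2) [symmetric] fam_span_def eval_y_def using low_S(1) [OF that] by blast
  have "\<exists>g. g \<in> low \<and> eval_y g = b" if b: "b \<in> T" for b
  proof -
    from fam_spanE [OF T(2) b]
    obtain a where a: "a \<in> {..<q} \<rightarrow> S" "b = (\<Oplus>j\<in>{..<q}. a j \<otimes> y [^] j)" .
    define g where "g = (\<lambda>n. if n < q then a n else \<zero>)"
    have "g \<in> up S'" unfolding g_def using a(1) S_cl(2) by (intro up_bounded [of _ q]) auto
    moreover have "eval_y g = b"
      unfolding eval_y_def a(2) using a(1) S_carr pow_closed
      by (intro finsum_cong') (auto simp: g_def Pi_iff)
    ultimately show ?thesis by (auto simp: g_def)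
  qed
  then have "\<forall>b\<in>T. \<exists>g. g \<in> low \<and> eval_y g = b" by blast
  from bchoice [OF this] obtain \<kappa> where "\<forall>b\<in>T. \<kappa> b \<in> low \<and> eval_y (\<kappa> b) = b" ..
  then have \<kappa>: "\<And>b. b \<in> T \<Longrightarrow> \<kappa> b \<in> low" "\<And>b. b \<in> T \<Longrightarrow> eval_y (\<kappa> b) = b" by blast+
  note Tc = subringE [OF T(1)]
  have const: "\<kappa> a = (\<lambda>i. if i = 0 then a else \<zero>)" if a: "a \<in> S" for a
  proof -
    let ?m = "\<lambda>i. if i = 0 then a else \<zero>"
    have m: "?m \<in> low" using monom_up [OF a, of 0] q by simp
    have "eval_y ?m = (\<Oplus>j\<in>{..<q}. if j = 0 then a else \<zero>)"
      unfolding eval_y_def using S_carr [OF a] pow_closed by (intro finsum_cong') auto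
    also have "\<dots> = a" using S_carr [OF a] q by (intro finsum_delta) auto
    finally have "eval_y ?m = a" .
    then show ?thesis using inj [OF _ m, of "\<kappa> a"] \<kappa>(1,2) [of a] mem [OF m] by simp
  qed
  have "\<kappa> \<in> ring_iso (R\<lparr>carrier := T\<rparr>) ?Q"
  proof (rule ring_iso_memI)
    fix b assume "b \<in> carrier (R\<lparr>carrier := T\<rparr>)"
    then have b: "b \<in> T" by simp
    show "\<kappa> b \<in> carrier ?Q" using \<kappa>(1) [OF b] unfolding twisted_quot_simps .
    fix b' assume "b' \<in> carrier (R\<lparr>carrier := T\<rparr>)"
    then have b': "b' \<in> T" by simp
    note k = \<kappa>(1) [OF b] \<kappa>(1) [OF b']
    \<comment> \<open>Identities between remainders are verified after evaluation, which is
      injective on them.\<close>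
    have "\<kappa> (b \<otimes> b') = twisted_rem S' \<tau> f (\<kappa> b \<otimes>\<^bsub>P\<^esub> \<kappa> b')"
      using eval_mult [OF k] \<kappa> Tc(6) [OF b b'] b b' by (intro inj) auto
    then show "\<kappa> (b \<otimes>\<^bsub>R\<lparr>carrier := T\<rparr>\<^esub> b') = \<kappa> b \<otimes>\<^bsub>?Q\<^esub> \<kappa> b'"
      by (simp add: twisted_quot_simps)
    define s where "s = (\<lambda>n. \<kappa> b n \<oplus> \<kappa> b' n)"
    have "s \<in> up S'" unfolding s_def
      using low_S [OF k(1)] low_S [OF k(2)] S_cl(7) by (intro up_bounded [of _ q]) auto
    then have s: "s \<in> low" using low_S(3) [OF k(1)] low_S(3) [OF k(2)] by (simp add: s_def)
    have "eval_y s = (\<Oplus>j\<in>{..<q}. \<kappa> b j \<otimes> y [^] j \<oplus> \<kappa> b' j \<otimes> y [^] j)"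
      unfolding eval_y_def s_def using low_S(2) [OF k(1)] low_S(2) [OF k(2)] pow_closed
      by (intro finsum_cong') (auto simp: l_distr)
    also have "\<dots> = eval_y (\<kappa> b) \<oplus> eval_y (\<kappa> b')"
      unfolding eval_y_def using low_S(2) [OF k(1)] low_S(2) [OF k(2)] pow_closed
      by (intro finsum_addf) auto
    finally have "\<kappa> (b \<oplus> b') = s"
      using s \<kappa> Tc(7) [OF b b'] b b' by (intro inj) auto
    then show "\<kappa> (b \<oplus>\<^bsub>R\<lparr>carrier := T\<rparr>\<^esub> b') = \<kappa> b \<oplus>\<^bsub>?Q\<^esub> \<kappa> b'"
      using P_add [of "\<kappa> b" "\<kappa> b'"] k by (simp add: twisted_quot_simps s_def)
  next
    show "\<kappa> \<one>\<^bsub>R\<lparr>carrier := T\<rparr>\<^esub> = \<one>\<^bsub>?Q\<^esub>"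
      using const [OF S_cl(3)] by (simp add: twisted_quot_simps P_simps)
    show "bij_betw \<kappa> (carrier (R\<lparr>carrier := T\<rparr>)) (carrier ?Q)"
      unfolding twisted_quot_simps
      by (rule bij_betw_byWitness [where f' = eval_y]) (use \<kappa> mem inj in auto)
  qed
  moreover have "\<forall>a\<in>F. \<kappa> a = monom P a 0" using const P_monom F by auto
  ultimately show ?thesis unfolding twisted_quot_alg_iso_def by blast
qed

end

subsection \<open>One step of the chain\<close>

text \<open>The coset of \<open>s\<close> generates a group of order \<open>q\<close>, so it has
  order \<open>q\<close> itself. Its powers with exponents below \<open>q\<close> are therefore all
  the cosets of \<open>N\<close>, each occurring once.\<close>

lemma (in group) cyclic_factor_decomposition:
  assumes H: "subgroup H G" and N: "N \<lhd> G\<lparr>carrier := H\<rparr>"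
    and q: "0 < q" "order (G\<lparr>carrier := H\<rparr> Mod N) = q" and s: "s \<in> H"
    and gen: "generate (G\<lparr>carrier := H\<rparr> Mod N) {N #> s} = carrier (G\<lparr>carrier := H\<rparr> Mod N)"
  shows "s [^] k \<in> N \<longleftrightarrow> q dvd k"
    and "bij_betw (\<lambda>(h, j). h \<otimes> s [^] j) (N \<times> {..<q}) H"
proof -
  let ?H = "G\<lparr>carrier := H\<rparr>" and ?Q = "G\<lparr>carrier := H\<rparr> Mod N"
  interpret HG: group ?H by (rule subgroup_imp_group [OF H])
  interpret N: normal N ?H by (rule N)
  interpret Q: group ?Q by (rule N.factorgroup_is_group)
  have NH: "h \<in> H" if "h \<in> N" for h using N.subset that by auto
  have HG': "h \<in> carrier G" if "h \<in> H" for h using subgroup.subset [OF H] that by auto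
  have sH: "s [^] j \<in> H" for j :: nat
    using HG.nat_pow_closed [of s j] s nat_pow_consistent [of s j H] by simp
  have rc: "N #>\<^bsub>?H\<^esub> a = N #> a" for a by (simp add: r_coset_def)
  have pow: "(N #> s) [^]\<^bsub>?Q\<^esub> j = N #> s [^] j" for j :: nat
    using N.FactGroup_pow [of s j] s nat_pow_consistent [of s j H] by (simp add: rc)
  have g: "N #> s \<in> carrier ?Q" using s by (auto simp: FactGroup_def RCOSETS_def rc)
  have fin: "finite (carrier ?Q)" using q unfolding order_def by (metis card.infinite less_irrefl)
  have ord: "Q.ord (N #> s) = q"
    using Q.generate_pow_card [OF g] gen q(2) by (simp add: order_def)
  have oneQ: "\<one>\<^bsub>?Q\<^esub> = N" by (simp add: FactGroup_def)
  show dvd: "s [^] k \<in> N \<longleftrightarrow> q dvd k" for k :: nat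
  proof -
    have "N #> s [^] k = N \<longleftrightarrow> q dvd k" using Q.pow_eq_id [OF g, of k] by (simp add: pow ord oneQ)
    moreover have "N #> s [^] k = N \<longleftrightarrow> s [^] k \<in> N"
      using HG.coset_join1 [of N "s [^] k"] HG.coset_join2 [of "s [^] k" N] sH [of k] N.subgroup_axioms
      by (auto simp: rc)
    ultimately show ?thesis by simp
  qed
  \<comment> \<open>Cancelling the smaller power leaves \<open>s [^] (j' - j)\<close> in
    \<open>N\<close>, so \<open>q\<close> divides a difference that is smaller than
    \<open>q\<close>.\<close>
  have le: "j = j'" if eq: "h \<otimes> s [^] j = h' \<otimes> s [^] j'" and h: "h \<in> N" "h' \<in> N"
    and j: "j \<le> j'" "j' < q" for h h' and j j' :: nat
  proof -
    have c: "h \<in> carrier G" "h' \<in> carrier G" "s \<in> carrier G" using h NH HG' s by auto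
    have "s [^] j' = s [^] (j' - j) \<otimes> s [^] j" using nat_pow_mult [OF c(3), of "j' - j" j] j by simp
    then have "h \<otimes> s [^] j = h' \<otimes> s [^] (j' - j) \<otimes> s [^] j" using eq c by (simp add: m_assoc)
    then have "h = h' \<otimes> s [^] (j' - j)" using c by simp
    then have "s [^] (j' - j) = inv h' \<otimes> h" using c by (simp flip: m_assoc)
    moreover have "inv h' = inv\<^bsub>?H\<^esub> h'" using m_inv_consistent [OF H NH [OF h(2)]] by simp
    ultimately have "s [^] (j' - j) \<in> N" using N.m_closed [OF N.m_inv_closed [OF h(2)] h(1)] by simp
    then have "q dvd j' - j" by (simp add: dvd)
    then show ?thesis using j by (auto dest: dvd_imp_le)
  qed
  show "bij_betw (\<lambda>(h, j). h \<otimes> s [^] j) (N \<times> {..<q}) H"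
    unfolding bij_betw_def
  proof (intro conjI equalityI subsetI)
    show "inj_on (\<lambda>(h, j). h \<otimes> s [^] j) (N \<times> {..<q})"
    proof (rule inj_onI)
      fix p p' assume p: "p \<in> N \<times> {..<q}" "p' \<in> N \<times> {..<q}"
        and eq: "(\<lambda>(h, j). h \<otimes> s [^] j) p = (\<lambda>(h, j). h \<otimes> s [^] j) p'"
      obtain h j h' j' where d: "p = (h, j)" "p' = (h', j')" by (cases p, cases p') auto
      have hj: "h \<in> N" "h' \<in> N" "j < q" "j' < q" "h \<otimes> s [^] j = h' \<otimes> s [^] j'"
        using p eq d by auto
      have "j = j'" using le [OF hj(5,1,2) _ hj(4)] le [OF hj(5) [symmetric] hj(2,1) _ hj(3)] by linarith
      then show "p = p'" using hj NH HG' s d by simp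
    qed
  next
    fix r assume "r \<in> (\<lambda>(h, j). h \<otimes> s [^] j) ` (N \<times> {..<q})"
    then show "r \<in> H" using NH sH subgroup.m_closed [OF H] by auto
  next
    fix r assume r: "r \<in> H"
    have "N #> r \<in> carrier ?Q" using r by (auto simp: FactGroup_def RCOSETS_def rc)
    then have "N #> r \<in> {(N #> s) [^]\<^bsub>?Q\<^esub> k | k. k \<in> (UNIV :: nat set)}"
      using gen Q.generate_pow_on_finite_carrier [OF fin g] by simp
    then obtain j where j: "N #> r = N #> s [^] j" "j < q"
      unfolding Q.ord_elems [OF fin g] ord using q(1) by (auto simp: pow)
    have "r \<in> N #> s [^] j"
      using HG.rcos_self [of r N] r N.subgroup_axioms unfolding rc j(1) by simp
    then obtain h where "h \<in> N" "r = h \<otimes> s [^] j" by (auto simp: r_coset_def)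
    then show "r \<in> (\<lambda>(h, j). h \<otimes> s [^] j) ` (N \<times> {..<q})" using j(2) by force
  qed
qed

context algebra_with_maximal_subfield begin

lemma cyclic_step:
  assumes K: "subgroup K G" and H: "subgroup H G" and norm: "K \<lhd> G\<lparr>carrier := H\<rparr>"
    and q: "prime q" "order (G\<lparr>carrier := H\<rparr> Mod K) = q" and s: "s \<in> H"
    and gen: "generate (G\<lparr>carrier := H\<rparr> Mod K) {K #>\<^bsub>G\<^esub> s} = carrier (G\<lparr>carrier := H\<rparr> Mod K)"
  defines "t \<equiv> (\<lambda>z. x s \<otimes> z \<otimes> inv (x s))" and "c \<equiv> x s [^] q"
  shows "sn_span A M K \<subset> sn_span A M H"
    and "twisted_quot_alg_iso F (A\<lparr>carrier := sn_span A M H\<rparr>) (A\<lparr>carrier := sn_span A M K\<rparr>) t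
      (twisted_binomial (A\<lparr>carrier := sn_span A M K\<rparr>) t q c)"
    and "t \<in> ring_iso (A\<lparr>carrier := sn_span A M K\<rparr>) (A\<lparr>carrier := sn_span A M K\<rparr>)"
    and "\<forall>a\<in>F. t a = a"
    and "has_inner_order (A\<lparr>carrier := sn_span A M K\<rparr>) t q"
    and "\<forall>m\<in>M. t m = s m"
    and "c \<in> Units (A\<lparr>carrier := sn_span A M K\<rparr>)" and "t c = c"
proof -
  let ?K = "sn_span A M K" and ?H = "sn_span A M H"
  define y where "y = x s"
  have q0: "0 < q" "1 < q" using q(1) prime_gt_1_nat prime_gt_0_nat by auto
  note dec = G.cyclic_factor_decomposition [OF H norm q0(1) q(2) s gen]
  have sG: "s \<in> carrier G" using s subgroup.subset [OF H] by blast
  have KH: "K \<subseteq> H" using normal_imp_subgroup [OF norm] subgroup.subset by fastforce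
  have iy: "induces y s" using induces_x [OF sG] by (simp add: y_def)
  note yD = inducesD [OF iy]
  have iyk: "induces (y [^] j) (s [^]\<^bsub>G\<^esub> j)" for j :: nat by (rule induces_pow [OF iy sG])
  note ykD = inducesD [OF iyk]
  have Kc: "z \<in> carrier A" if "z \<in> ?K" for z using B_closed [OF K that] .
  have K_cl: "subring ?K A" and H_cl: "subring ?H A" using B_subring [OF K] B_subring [OF H] by auto
  note Kr = subringE [OF K_cl] and Hr = subringE [OF H_cl]
  have conj_one: "r \<otimes>\<^bsub>G\<^esub> k \<otimes>\<^bsub>G\<^esub> inv\<^bsub>G\<^esub> r \<in> K" if r: "r \<in> H" and k: "k \<in> K" for r k
  proof -
    have "r \<otimes>\<^bsub>G\<lparr>carrier := H\<rparr>\<^esub> k \<otimes>\<^bsub>G\<lparr>carrier := H\<rparr>\<^esub> inv\<^bsub>G\<lparr>carrier := H\<rparr>\<^esub> r \<in> K"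
      using normal.inv_op_closed2 [OF norm] r k by simp
    then show ?thesis using G.m_inv_consistent [OF H r] by simp
  qed
  \<comment> \<open>By normality \<open>r k r^-1\<close> lies in \<open>K\<close>, so conjugation
    sends \<open>m x\<^sub>k\<close> to \<open>r(m)\<close> times an element of \<open>M(K)\<close>.
    Arbitrary \<open>z\<close> and \<open>r\<close> let the statement serve for \<open>y\<close> and
    for its inverse.\<close>
  have conj_K: "z \<otimes> b \<otimes> inv z \<in> ?K" if z: "induces z r" "r \<in> H" and b: "b \<in> ?K" for z r b
  proof -
    note zD = inducesD [OF z(1)]
    have rG: "r \<in> carrier G" using z(2) subgroup.subset [OF H] by blast
    have "?K \<subseteq> {b \<in> carrier A. z \<otimes> b \<otimes> inv z \<in> ?K}"
    proof (rule B_least [OF K])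
      fix m k assume m: "m \<in> M" and k: "k \<in> K"
      have kG: "k \<in> carrier G" using k subgroup.subset [OF K] by blast
      have cl: "m \<in> carrier A" "x k \<in> carrier A" "r m \<in> M" "r m \<in> carrier A"
        using m M_carr x_closed [OF K k] aut_groupD(1) [OF rG] by auto
      have "induces (z \<otimes> x k \<otimes> inv z) (r \<otimes>\<^bsub>G\<^esub> k \<otimes>\<^bsub>G\<^esub> inv\<^bsub>G\<^esub> r)"
        using z(1) kG rG by (intro induces_mult induces_inv induces_x) auto
      then have "z \<otimes> x k \<otimes> inv z \<in> ?K" using B_induces [OF K conj_one [OF z(2) k]] by blast
      then have "r m \<otimes> (z \<otimes> x k \<otimes> inv z) \<in> ?K" using B_space(5) [OF K cl(3)] by blast
      also have "r m \<otimes> (z \<otimes> x k \<otimes> inv z) = r m \<otimes> z \<otimes> x k \<otimes> inv z"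
        using cl zD(2,4) by (simp add: m_assoc)
      also have "\<dots> = z \<otimes> m \<otimes> x k \<otimes> inv z" using zD(3) [OF m] by simp
      also have "\<dots> = z \<otimes> (m \<otimes> x k) \<otimes> inv z" using cl zD(2,4) by (simp add: m_assoc)
      finally show "m \<otimes> x k \<in> {b \<in> carrier A. z \<otimes> b \<otimes> inv z \<in> ?K}" using cl by simp
    next
      show "\<zero> \<in> {b \<in> carrier A. z \<otimes> b \<otimes> inv z \<in> ?K}" using zD(2,4) Kr(2) by simp
      show "b \<oplus> b' \<in> {b \<in> carrier A. z \<otimes> b \<otimes> inv z \<in> ?K}"
        if "b \<in> {b \<in> carrier A. z \<otimes> b \<otimes> inv z \<in> ?K}" "b' \<in> {b \<in> carrier A. z \<otimes> b \<otimes> inv z \<in> ?K}" for b b'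
        using that zD(2,4) Kr(7) by (simp add: r_distr l_distr)
    qed auto
    then show ?thesis using b by blast
  qed
  have t_eq: "t z = y \<otimes> z \<otimes> inv y" for z by (simp add: t_def y_def)
  have tK: "t z \<in> ?K" if "z \<in> ?K" for z using conj_K [OF iy s that] by (simp add: t_eq)
  have sqK: "s [^]\<^bsub>G\<^esub> q \<in> K" using dec(1) by simp
  have c_eq: "c = y [^] q" by (simp add: c_def y_def)
  \<comment> \<open>\<open>c\<close> induces \<open>s^q\<close>, a member of \<open>K\<close>, and
    so belongs to \<open>M(K)\<close> together with its inverse, whatever element was chosen for
    \<open>x s\<close>.\<close>
  have cK: "c \<in> ?K" "inv c \<in> ?K" unfolding c_eq using B_induces [OF K sqK iyk] B_inv [OF K sqK iyk] by auto
  interpret tw: twisted_subring A ?K y q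
  proof (intro twisted_subring.intro twisted_subring_axioms.intro)
    show "ring A" by (rule ring_axioms)
    show "subring ?K A" by (rule K_cl)
    show "y \<in> Units A" by (rule yD)
    show "0 < q" by (rule q0)
    show "\<one> \<noteq> \<zero>" by (rule one_not_zero)
    show "y \<otimes> z \<otimes> inv y \<in> ?K" if "z \<in> ?K" for z using tK [OF that] by (simp add: t_eq)
    show "y [^] q \<in> ?K" using cK c_eq by simp
  qed
  have \<tau>_eq: "tw.\<tau> = t" by (auto simp: fun_eq_iff tw.\<tau>_def t_eq)
  have KsubH: "?K \<subseteq> ?H"
    using B_least [OF K Hr(2,7,1)] Hr(6) M_subset_B [OF H] B_space(6) [OF H] KH by blast
  have yH: "y [^] j \<in> ?H" for j :: nat
  proof -
    have "s [^]\<^bsub>G\<^esub> j \<in> H"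
      using subgroup.m_closed [OF H _ s] subgroup.one_closed [OF H] by (induction j) simp_all
    then show ?thesis using B_induces [OF H _ iyk] by blast
  qed
  have not_K: "s [^]\<^bsub>G\<^esub> l \<notin> K" if "0 < l" "l < q" for l
    using dec(1) [of l] that by (auto dest: dvd_imp_le)
  have y_not_K: "y [^] l \<notin> ?K" if "0 < l" "l < q" for l
    by (rule B_not_induces [OF K _ not_K [OF that] iyk]) (use sG in auto)
  show "sn_span A M K \<subset> sn_span A M H"
  proof (rule psubsetI [OF KsubH], rule notI)
    assume "?K = ?H"
    then show False using yH [of 1] y_not_K [OF zero_less_one q0(2)] by simp
  qed
  define D where "D = K \<times> {..<q}"
  define h where "h = (\<lambda>(k, j). k \<otimes>\<^bsub>G\<^esub> s [^]\<^bsub>G\<^esub> (j::nat))"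
  have hb: "bij_betw h D H" using dec(2) by (simp add: h_def D_def)
  \<comment> \<open>For \<open>r = k s^j\<close> this is \<open>x k \<otimes> y [^] j\<close>. It
    induces \<open>r\<close>, like \<open>x r\<close>, from which it may differ by a factor in
    \<open>M\<close>; so it gives another left basis of \<open>M(H)\<close> over \<open>M\<close>,
    adapted to the powers of \<open>y\<close>.\<close>
  define v where "v = (\<lambda>r. case inv_into D h r of (k, j) \<Rightarrow> x k \<otimes> y [^] j)"
  have v_h: "v (k \<otimes>\<^bsub>G\<^esub> s [^]\<^bsub>G\<^esub> j) = x k \<otimes> y [^] j" if "k \<in> K" "j < q" for k j
  proof -
    have "inv_into D h (h (k, j)) = (k, j)"
      using hb that by (intro inv_into_f_f) (auto simp: bij_betw_def D_def)
    then show ?thesis by (simp add: v_def h_def)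
  qed
  have iv: "induces (x k \<otimes> y [^] j) (k \<otimes>\<^bsub>G\<^esub> s [^]\<^bsub>G\<^esub> j)" if "k \<in> K" for k and j :: nat
    using that subgroup.subset [OF K] sG by (intro induces_mult induces_x iyk) auto
  have H_E: "\<exists>k j. k \<in> K \<and> j < q \<and> r = k \<otimes>\<^bsub>G\<^esub> s [^]\<^bsub>G\<^esub> j" if "r \<in> H" for r
    using hb that by (auto simp: bij_betw_def D_def h_def image_iff)
  have iv': "induces (v r) r" if "r \<in> H" for r
    using H_E [OF that] iv v_h by auto
  have v_ind: "fam_indep M H v"
    by (rule induces_indep [OF finite_H [OF H] subgroup.subset [OF H] iv'])
  have v_Pi: "v \<in> H \<rightarrow> carrier A" using inducesD(2) [OF iv'] by auto
  have D_ind: "fam_indep M D (\<lambda>p. v (h p))"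
  proof -
    have "inj_on h D" "h ` D = H" using hb by (auto simp: bij_betw_def)
    then show ?thesis using fam_reindex(2) [of h D v M] v_Pi v_ind M_cl(1) by simp
  qed
  have ind: "fam_indep ?K {..<q} (\<lambda>j. y [^] j)"
    unfolding fam_indep_def
  proof (intro ballI impI)
    fix a j0 assume a: "a \<in> {..<q} \<rightarrow> ?K" "(\<Oplus>j\<in>{..<q}. a j \<otimes> y [^] j) = \<zero>" and j0: "j0 \<in> {..<q}"
    \<comment> \<open>Expanding every \<open>a j\<close> over \<open>M\<close> turns a relation
      between the \<open>y [^] j\<close> into one between the \<open>v r\<close>, indexed by the
      pairs in \<open>D\<close>.\<close>
    have "\<forall>j\<in>{..<q}. \<exists>d. d \<in> K \<rightarrow> M \<and> a j = (\<Oplus>k\<in>K. d k \<otimes> x k)"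
      using a(1) unfolding sn_span_eq_fam_span fam_span_def by blast
    from bchoice [OF this] obtain d
      where d: "\<forall>j\<in>{..<q}. d j \<in> K \<rightarrow> M \<and> a j = (\<Oplus>k\<in>K. d j k \<otimes> x k)" ..
    have dM: "d j k \<in> M" "d j k \<in> carrier A" if "j \<in> {..<q}" "k \<in> K" for j k
      using d that M_carr by auto
    have xk: "x k \<in> carrier A" if "k \<in> K" for k using x_closed [OF K that] .
    have yc: "y [^] j \<in> carrier A" for j :: nat using yD(2) by simp
    have "(\<Oplus>p\<in>D. d (snd p) (fst p) \<otimes> v (h p)) = (\<Oplus>p\<in>D. d (snd p) (fst p) \<otimes> x (fst p) \<otimes> y [^] snd p)"
      using dM xk yc v_h by (intro finsum_cong') (auto simp: D_def h_def m_assoc)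
    also have "\<dots> = (\<Oplus>j\<in>{..<q}. \<Oplus>k\<in>K. d j k \<otimes> x k \<otimes> y [^] j)"
    proof -
      have "D = (\<Union>j\<in>{..<q}. (\<lambda>k. (k, j)) ` K)" by (auto simp: D_def)
      then have "(\<Oplus>p\<in>D. d (snd p) (fst p) \<otimes> x (fst p) \<otimes> y [^] snd p)
        = (\<Oplus>j\<in>{..<q}. \<Oplus>p\<in>(\<lambda>k. (k, j)) ` K. d (snd p) (fst p) \<otimes> x (fst p) \<otimes> y [^] snd p)"
        using finite_H [OF K] dM xk yc
        by (simp only:) (intro add.finprod_UN_disjoint, auto simp: pairwise_def disjnt_def)
      also have "\<dots> = (\<Oplus>j\<in>{..<q}. \<Oplus>k\<in>K. d j k \<otimes> x k \<otimes> y [^] j)"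
      proof (rule finsum_cong')
        fix j assume j: "j \<in> {..<q}"
        show "(\<Oplus>p\<in>(\<lambda>k. (k, j)) ` K. d (snd p) (fst p) \<otimes> x (fst p) \<otimes> y [^] snd p)
          = (\<Oplus>k\<in>K. d j k \<otimes> x k \<otimes> y [^] j)"
          using dM j xk yc by (subst finsum_reindex) (auto simp: inj_on_def)
      qed (use dM xk yc in \<open>auto intro!: finsum_closed\<close>)
      finally show ?thesis .
    qed
    also have "\<dots> = (\<Oplus>j\<in>{..<q}. a j \<otimes> y [^] j)"
    proof (rule finsum_cong')
      fix j assume j: "j \<in> {..<q}"
      have "a j = (\<Oplus>k\<in>K. d j k \<otimes> x k)" using d j by blast
      then show "(\<Oplus>k\<in>K. d j k \<otimes> x k \<otimes> y [^] j) = a j \<otimes> y [^] j"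
        using finite_H [OF K] dM [OF j] xk yc by (simp add: finsum_ldistr Pi_def)
    qed (use a(1) Kc yc in auto)
    finally have "(\<Oplus>p\<in>D. d (snd p) (fst p) \<otimes> v (h p)) = \<zero>" using a(2) by simp
    moreover have "(\<lambda>p. d (snd p) (fst p)) \<in> D \<rightarrow> M" using dM by (auto simp: D_def)
    ultimately have "\<forall>p\<in>D. d (snd p) (fst p) = \<zero>" using bspec [OF D_ind [unfolded fam_indep_def]] by blast
    then have d0: "d j0 k = \<zero>" if "k \<in> K" for k using j0 that by (force simp: D_def)
    have "a j0 = (\<Oplus>k\<in>K. d j0 k \<otimes> x k)" using d j0 by blast
    also have "\<dots> = (\<Oplus>k\<in>K. \<zero>)" using d0 xk by (intro finsum_cong') auto
    finally show "a j0 = \<zero>" by simp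
  qed
  have span: "fam_span ?K {..<q} (\<lambda>j. y [^] j) = ?H"
  proof (intro equalityI)
    let ?E = "fam_span ?K {..<q} (\<lambda>j. y [^] j)"
    show "?E \<subseteq> ?H"
    proof
      fix b assume "b \<in> ?E"
      then obtain a where a: "a \<in> {..<q} \<rightarrow> ?K" "b = (\<Oplus>j\<in>{..<q}. a j \<otimes> y [^] j)"
        by (rule fam_spanE [OF refl])
      have Pi: "(\<lambda>j. a j \<otimes> y [^] j) \<in> {..<q} \<rightarrow> ?H"
      proof
        fix j assume "j \<in> {..<q}"
        then have "a j \<in> ?H" using funcset_mem [OF a(1)] KsubH by blast
        then show "a j \<otimes> y [^] j \<in> ?H" using yH by (rule Hr(6))
      qed
      show "b \<in> ?H" unfolding a(2) by (rule finsum_closed_in [OF Hr(2,7,1) Pi])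
    qed
    have yc: "y [^] j \<in> carrier A" for j :: nat using yD(2) by simp
    show "?H \<subseteq> ?E"
    proof (rule B_least [OF H])
      have "(\<Oplus>j\<in>{..<q}. \<zero> \<otimes> y [^] j) = (\<Oplus>j\<in>{..<q}. \<zero>)"
        using yc by (intro finsum_cong') auto
      then show "\<zero> \<in> ?E"
        using fam_spanI [of "\<lambda>_. \<zero>" "{..<q}" ?K "\<lambda>j. y [^] j"] Kr(2) by simp
      show "?E \<subseteq> carrier A"
        unfolding fam_span_def using Kc yc by (auto intro!: finsum_closed simp: Pi_iff)
    next
      fix b b' assume "b \<in> ?E"
      then obtain a where a: "a \<in> {..<q} \<rightarrow> ?K" "b = (\<Oplus>j\<in>{..<q}. a j \<otimes> y [^] j)"
        by (rule fam_spanE [OF refl])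
      assume "b' \<in> ?E"
      then obtain a' where a': "a' \<in> {..<q} \<rightarrow> ?K" "b' = (\<Oplus>j\<in>{..<q}. a' j \<otimes> y [^] j)"
        by (rule fam_spanE [OF refl])
      have ac: "a j \<in> carrier A" "a' j \<in> carrier A" if "j \<in> {..<q}" for j using a(1) a'(1) that Kc by auto
      have "(\<Oplus>j\<in>{..<q}. (a j \<oplus> a' j) \<otimes> y [^] j) = (\<Oplus>j\<in>{..<q}. a j \<otimes> y [^] j \<oplus> a' j \<otimes> y [^] j)"
        using ac yc by (intro finsum_cong') (auto simp: l_distr)
      also have "\<dots> = b \<oplus> b'" unfolding a(2) a'(2) using ac yc by (intro finsum_addf) auto
      finally have eq: "b \<oplus> b' = (\<Oplus>j\<in>{..<q}. (a j \<oplus> a' j) \<otimes> y [^] j)" by simp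
      have "(\<lambda>j. a j \<oplus> a' j) \<in> {..<q} \<rightarrow> ?K" using a(1) a'(1) Kr(7) by auto
      from fam_spanI [OF this, of "\<lambda>j. y [^] j"] eq show "b \<oplus> b' \<in> ?E" by simp
    next
      fix m r assume m: "m \<in> M" and r: "r \<in> H"
      obtain k j where kj: "k \<in> K" "j < q" "r = k \<otimes>\<^bsub>G\<^esub> s [^]\<^bsub>G\<^esub> j" using H_E [OF r] by blast
      have rG: "r \<in> carrier G" using r subgroup.subset [OF H] by blast
      \<comment> \<open>\<open>x r\<close> and \<open>x k \<otimes> y [^] j\<close> induce the same
        automorphism, so \<open>m \<otimes> x r\<close> is an element of \<open>M(K)\<close> times a
        single power of \<open>y\<close>.\<close>
      obtain u where u: "u \<in> M" "x r = u \<otimes> (x k \<otimes> y [^] j)"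
        using induces_unique [OF induces_x [OF rG] iv [OF kj(1), of j, folded kj(3)] rG] by blast
      define a where "a = m \<otimes> u \<otimes> x k"
      have aK: "a \<in> ?K" unfolding a_def
        using B_space(5) [OF K M_cl(6) [OF m u(1)] B_space(6) [OF K kj(1)]] .
      have "m \<otimes> x r = a \<otimes> y [^] j"
        unfolding u(2) a_def using M_carr m u(1) x_closed [OF K kj(1)] yc by (simp add: m_assoc)
      also have "\<dots> = (\<Oplus>i\<in>{..<q}. if i = j then a \<otimes> y [^] i else \<zero>)"
        using kj(2) Kc [OF aK] yc by (intro finsum_delta [symmetric]) auto
      also have "\<dots> = (\<Oplus>i\<in>{..<q}. (if i = j then a else \<zero>) \<otimes> y [^] i)"
        using Kc [OF aK] yc by (intro finsum_cong') auto
      finally have eq: "m \<otimes> x r = (\<Oplus>i\<in>{..<q}. (if i = j then a else \<zero>) \<otimes> y [^] i)" .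
      have "(\<lambda>i. if i = j then a else \<zero>) \<in> {..<q} \<rightarrow> ?K" using aK Kr(2) by auto
      from fam_spanI [OF this, of "\<lambda>i. y [^] i"] eq show "m \<otimes> x r \<in> ?E" by simp
    qed
  qed
  have FK: "F \<subseteq> ?K" using FM M_subset_B [OF K] by blast
  show "twisted_quot_alg_iso F (A\<lparr>carrier := ?H\<rparr>) (A\<lparr>carrier := ?K\<rparr>) t
      (twisted_binomial (A\<lparr>carrier := ?K\<rparr>) t q c)"
    using tw.twisted_quot_alg_isoI [OF H_cl span ind FK] unfolding \<tau>_eq c_eq .
  show "t c = c" using tw.\<tau>_c unfolding \<tau>_eq c_eq .
  have iycK: "induces c (s [^]\<^bsub>G\<^esub> q)" unfolding c_eq by (rule iyk)
  show c_unit: "c \<in> Units (A\<lparr>carrier := ?K\<rparr>)"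
    using cK inducesD(5,6) [OF iycK] by (auto simp: Units_def)
  show "\<forall>m\<in>M. t m = s m"
  proof
    fix m assume m: "m \<in> M"
    have "s m \<in> carrier A" using aut_groupD(1) [OF sG m] M_carr by blast
    then show "t m = s m" unfolding t_eq yD(3) [OF m] using yD by (simp add: m_assoc)
  qed
  then show "\<forall>a\<in>F. t a = a" using FM aut_groupD(2) [OF sG] by auto
  have conj_mult: "t (a \<otimes> b) = t a \<otimes> t b" if "a \<in> carrier A" "b \<in> carrier A" for a b
  proof -
    have "t a \<otimes> t b = y \<otimes> a \<otimes> (inv y \<otimes> y) \<otimes> b \<otimes> inv y"
      unfolding t_eq using that yD(2,4) by (simp add: m_assoc)
    then show ?thesis unfolding t_eq using that yD(2,4,6) by (simp add: m_assoc)
  qed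
  have inv_conj: "inv y \<otimes> z \<otimes> y \<in> ?K" if z: "z \<in> ?K" for z
    using conj_K [OF induces_inv [OF iy sG] subgroup.m_inv_closed [OF H s] z] yD(1) by simp
  have yzy: "t (inv y \<otimes> z \<otimes> y) = z" "inv y \<otimes> t z \<otimes> y = z" if "z \<in> carrier A" for z
  proof -
    have "t (inv y \<otimes> z \<otimes> y) = (y \<otimes> inv y) \<otimes> z \<otimes> (y \<otimes> inv y)"
      unfolding t_eq using that yD(2,4) by (simp add: m_assoc)
    then show "t (inv y \<otimes> z \<otimes> y) = z" using that yD(5) by simp
    have "inv y \<otimes> t z \<otimes> y = (inv y \<otimes> y) \<otimes> z \<otimes> (inv y \<otimes> y)"
      unfolding t_eq using that yD(2,4) by (simp add: m_assoc)
    then show "inv y \<otimes> t z \<otimes> y = z" using that yD(6) by simp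
  qed
  show "t \<in> ring_iso (A\<lparr>carrier := ?K\<rparr>) (A\<lparr>carrier := ?K\<rparr>)"
  proof (rule ring_iso_memI)
    show "bij_betw t (carrier (A\<lparr>carrier := ?K\<rparr>)) (carrier (A\<lparr>carrier := ?K\<rparr>))"
      by (rule bij_betw_byWitness [where f' = "\<lambda>z. inv y \<otimes> z \<otimes> y"]) (use yzy Kc tK inv_conj in auto)
    show "t \<one>\<^bsub>A\<lparr>carrier := ?K\<rparr>\<^esub> = \<one>\<^bsub>A\<lparr>carrier := ?K\<rparr>\<^esub>" using yD by (simp add: t_eq)
  next
    fix a b assume "a \<in> carrier (A\<lparr>carrier := ?K\<rparr>)" "b \<in> carrier (A\<lparr>carrier := ?K\<rparr>)"
    then have "a \<in> carrier A" "b \<in> carrier A" using Kc by auto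
    then show "t (a \<otimes>\<^bsub>A\<lparr>carrier := ?K\<rparr>\<^esub> b) = t a \<otimes>\<^bsub>A\<lparr>carrier := ?K\<rparr>\<^esub> t b"
      "t (a \<oplus>\<^bsub>A\<lparr>carrier := ?K\<rparr>\<^esub> b) = t a \<oplus>\<^bsub>A\<lparr>carrier := ?K\<rparr>\<^esub> t b"
      using conj_mult yD(2,4) by (auto simp: t_eq r_distr l_distr)
  qed (use tK in auto)
  have t_pow: "(t ^^ l) z = y [^] l \<otimes> z \<otimes> inv (y [^] l)" if z: "z \<in> ?K" for z l
  proof -
    have "(t ^^ l) z \<otimes> y [^] l = y [^] l \<otimes> z" using tw.\<tau>_pow [OF z, of l] by (simp add: \<tau>_eq)
    moreover have "(t ^^ l) z \<in> carrier A" using tw.\<tau>_pow_closed [OF z, of l] Kc by (simp add: \<tau>_eq)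
    ultimately show ?thesis using ykD(2,4,5) [of l] by (metis m_assoc r_one)
  qed
  \<comment> \<open>Inner automorphisms of the subring refer to its own inverses, which agree with
    those of \<open>A\<close>.\<close>
  have m_inv: "inv\<^bsub>A\<lparr>carrier := ?K\<rparr>\<^esub> u = inv u" if "u \<in> Units (A\<lparr>carrier := ?K\<rparr>)" for u
    using m_inv_monoid_consistent [OF that subring.axioms(2) [OF K_cl]] by simp
  show "has_inner_order (A\<lparr>carrier := ?K\<rparr>) t q"
    unfolding has_inner_order_def
  proof (intro conjI allI impI)
    show "0 < q" by (rule q0)
    show "inner_aut (A\<lparr>carrier := ?K\<rparr>) (t ^^ q)"
      unfolding inner_aut_def using c_unit t_pow [of _ q] m_inv [OF c_unit] c_eq by (intro bexI [of _ c]) auto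
    fix l assume l: "0 < l \<and> l < q"
    show "\<not> inner_aut (A\<lparr>carrier := ?K\<rparr>) (t ^^ l)"
    proof
      assume "inner_aut (A\<lparr>carrier := ?K\<rparr>) (t ^^ l)"
      then obtain u where u: "u \<in> Units (A\<lparr>carrier := ?K\<rparr>)"
        "\<And>z. z \<in> ?K \<Longrightarrow> (t ^^ l) z = u \<otimes> z \<otimes> inv\<^bsub>A\<lparr>carrier := ?K\<rparr>\<^esub> u"
        by (auto simp: inner_aut_def)
      have uK: "u \<in> ?K" using u(1) by (auto simp: Units_def)
      have uU: "u \<in> Units A" using u(1) Kc by (auto simp: Units_def)
      then have uc: "u \<in> carrier A" "inv u \<in> carrier A" "inv u \<otimes> u = \<one>" "u \<otimes> inv u = \<one>" by auto
      have "induces u (s [^]\<^bsub>G\<^esub> l)"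
        unfolding induces_def
      proof (intro conjI ballI uU)
        fix m assume m: "m \<in> M"
        have mK: "m \<in> ?K" using m M_subset_B [OF K] by blast
        have sm: "(s [^]\<^bsub>G\<^esub> l) m \<in> carrier A" "m \<in> carrier A"
          using aut_groupD(1) [OF G.nat_pow_closed [OF sG] m] M_carr m by auto
        have "(s [^]\<^bsub>G\<^esub> l) m = (s [^]\<^bsub>G\<^esub> l) m \<otimes> (y [^] l \<otimes> inv (y [^] l))" using ykD(5) sm by simp
        also have "\<dots> = (t ^^ l) m"
          unfolding t_pow [OF mK] ykD(3) [OF m] using ykD(2,4) sm by (simp add: m_assoc)
        also have "\<dots> = u \<otimes> m \<otimes> inv u" using u(2) [OF mK] m_inv [OF u(1)] by simp
        finally show "u \<otimes> m = (s [^]\<^bsub>G\<^esub> l) m \<otimes> u" using uc sm by (simp add: m_assoc)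
      qed
      then show False using B_not_induces [OF K _ not_K] sG l uK by blast
    qed
  qed
qed

end

section \<open>The chain of the algebras \<open>M(G\<^sub>i)\<close>\<close>

theorem theorem7:
  fixes A :: "('a, 'b) ring_scheme" and F M :: "'a set"
    and G :: "('a \<Rightarrow> 'a) monoid" and Gs :: "nat \<Rightarrow> ('a \<Rightarrow> 'a) set"
    and \<sigma> :: "nat \<Rightarrow> 'a \<Rightarrow> 'a" and q :: "nat \<Rightarrow> nat" and n k :: nat
  assumes A: "central_simple A F n"
    and M: "maximal_subfield A F n M"
    and G: "G = aut_group A F M"
    and nontrivial: "\<not> trivial_group G"
    and solvable: "solvable G"
    and subgroups: "\<forall>j \<le> k. subgroup (Gs j) G"
    and bottom: "Gs 0 = {\<one>\<^bsub>G\<^esub>}"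
    and top: "Gs k = carrier G"
    and normal: "\<forall>j < k. Gs j \<lhd> (G\<lparr>carrier := Gs (Suc j)\<rparr>)"
    and prime_order: "\<forall>j < k. prime (q j) \<and> order (G\<lparr>carrier := Gs (Suc j)\<rparr> Mod Gs j) = q j"
    and generator: "\<forall>j < k. \<sigma> (Suc j) \<in> Gs (Suc j) \<and>
      generate (G\<lparr>carrier := Gs (Suc j)\<rparr> Mod Gs j) {Gs j #>\<^bsub>G\<^esub> \<sigma> (Suc j)}
        = carrier (G\<lparr>carrier := Gs (Suc j)\<rparr> Mod Gs j)"
  shows "\<exists>(As :: nat \<Rightarrow> 'a set) (\<tau> :: nat \<Rightarrow> 'a \<Rightarrow> 'a) (c :: nat \<Rightarrow> 'a).
    As 0 = M \<and> As k = sn_span A M (carrier G) \<and> As k \<subseteq> carrier A \<and>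
    (\<forall>i < k. As i \<subset> As (Suc i)) \<and>
    (\<forall>i \<le> k. subring (As i) A \<and> F \<subseteq> As i \<and>
      crossed_product (A\<lparr>carrier := As i\<rparr>) (fixed_set M (Gs i)) (G\<lparr>carrier := Gs i\<rparr>)) \<and>
    (\<forall>i < k.
      twisted_quot_alg_iso F (A\<lparr>carrier := As (Suc i)\<rparr>) (A\<lparr>carrier := As i\<rparr>) (\<tau> i)
        (twisted_binomial (A\<lparr>carrier := As i\<rparr>) (\<tau> i) (q i) (c i)) \<and>
      \<tau> i \<in> ring_iso (A\<lparr>carrier := As i\<rparr>) (A\<lparr>carrier := As i\<rparr>) \<and>
      (\<forall>a \<in> F. \<tau> i a = a) \<and>
      has_inner_order (A\<lparr>carrier := As i\<rparr>) (\<tau> i) (q i) \<and>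
      (\<forall>m \<in> M. \<tau> i m = \<sigma> (Suc i) m) \<and>
      c i \<in> Units (A\<lparr>carrier := As i\<rparr>) \<and> \<tau> i (c i) = c i)"
proof -
  interpret algebra_with_maximal_subfield A F M n
    using A M by (intro algebra_with_maximal_subfield.intro algebra_with_maximal_subfield_axioms.intro)
      (simp_all add: central_simple_def simple_ring_def)
  let ?As = "\<lambda>i. sn_span A M (Gs i)"
  let ?x = "sn_elt A M"
  let ?\<tau> = "\<lambda>i z. ?x (\<sigma> (Suc i)) \<otimes>\<^bsub>A\<^esub> z \<otimes>\<^bsub>A\<^esub> inv\<^bsub>A\<^esub> ?x (\<sigma> (Suc i))"
  let ?c = "\<lambda>i. ?x (\<sigma> (Suc i)) [^]\<^bsub>A\<^esub> q i"
  have sub: "subgroup (Gs i) (aut_group A F M)" if "i \<le> k" for i using subgroups that G by simp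
  \<comment> \<open>The element chosen for the identity need not be \<open>\<one>\<close>, but it
    commutes with \<open>M\<close> and so lies in \<open>M\<close>; hence the span for the trivial
    group is \<open>M\<close> itself.\<close>
  have bottom': "?As 0 = M"
  proof (intro equalityI)
    show "M \<subseteq> ?As 0" by (rule M_subset_B [OF sub]) simp
    show "?As 0 \<subseteq> M"
    proof (rule B_least [OF sub])
      fix m s assume m: "m \<in> M" and "s \<in> Gs 0"
      then have "s = \<one>\<^bsub>aut_group A F M\<^esub>" using bottom G by simp
      then have "?x s \<in> M" using induces_one_mem(1) induces_x [OF one_G] by blast
      then show "m \<otimes>\<^bsub>A\<^esub> ?x s \<in> M" using M_cl(6) m by blast
    qed (use M_cl in auto)
  qed
  have F_sub: "F \<subseteq> ?As i" if "i \<le> k" for i using FM M_subset_B [OF sub [OF that]] by blast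
  have step: "?As i \<subset> ?As (Suc i) \<and>
      twisted_quot_alg_iso F (A\<lparr>carrier := ?As (Suc i)\<rparr>) (A\<lparr>carrier := ?As i\<rparr>) (?\<tau> i)
        (twisted_binomial (A\<lparr>carrier := ?As i\<rparr>) (?\<tau> i) (q i) (?c i)) \<and>
      ?\<tau> i \<in> ring_iso (A\<lparr>carrier := ?As i\<rparr>) (A\<lparr>carrier := ?As i\<rparr>) \<and>
      (\<forall>a \<in> F. ?\<tau> i a = a) \<and>
      has_inner_order (A\<lparr>carrier := ?As i\<rparr>) (?\<tau> i) (q i) \<and>
      (\<forall>m \<in> M. ?\<tau> i m = \<sigma> (Suc i) m) \<and>
      ?c i \<in> Units (A\<lparr>carrier := ?As i\<rparr>) \<and> ?\<tau> i (?c i) = ?c i" if i: "i < k" for i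
  proof -
    have g: "Gs i \<lhd> aut_group A F M\<lparr>carrier := Gs (Suc i)\<rparr>" "prime (q i)"
      "order (aut_group A F M\<lparr>carrier := Gs (Suc i)\<rparr> Mod Gs i) = q i" "\<sigma> (Suc i) \<in> Gs (Suc i)"
      "generate (aut_group A F M\<lparr>carrier := Gs (Suc i)\<rparr> Mod Gs i)
        {Gs i #>\<^bsub>aut_group A F M\<^esub> \<sigma> (Suc i)}
        = carrier (aut_group A F M\<lparr>carrier := Gs (Suc i)\<rparr> Mod Gs i)"
      using normal prime_order generator i G by auto
    have "i \<le> k" "Suc i \<le> k" using i by auto
    note st = cyclic_step [OF sub sub g, OF this]
    show ?thesis by (intro conjI st)
  qed
  show ?thesis
  proof (intro exI conjI allI impI)
    show "?As 0 = M" by (rule bottom')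
    show "?As k = sn_span A M (carrier G)" using top by simp
    show "?As k \<subseteq> carrier A" by (rule B_space(1) [OF sub]) simp
    fix i
    assume i: "i \<le> k"
    show "subring (?As i) A" by (rule B_subring [OF sub [OF i]])
    show "F \<subseteq> ?As i" by (rule F_sub [OF i])
    show "crossed_product (A\<lparr>carrier := ?As i\<rparr>) (fixed_set M (Gs i)) (G\<lparr>carrier := Gs i\<rparr>)"
      unfolding G by (rule crossed_product_sn_span [OF sub [OF i]])
  qed (use step in blast)+
qed

end
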